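(* Let $d\ge 1$, let $h:E^d\to\mathbb{R}$ be measurable and symmetric under permutations of its $d$ arguments, and let $(\gamma_n)_{n\ge1}$ be a sequence of positive numbers such that, for some constant $C<\infty$, (i) $\gamma_n$ is nondecreasing; (ii) $\gamma_{2n}\le C\gamma_n$ for every $n$; (iii) $\sum_{k\ge l}\frac{2^{dk}}{\gamma_{2^k}^2}\le C\,\frac{2^{dl}}{\gamma_{2^l}^2}$ for every $l=1,2,\ldots$. Let the sets $A_{k,l}\subset E^d$ ($k\ge1$, $1\le l\le d$) be defined as in the context. Then the following six conditions are equivalent: (a) $\frac{1}{\gamma_n}\sum_{\mathbf{i}\in I_n}\varepsilon_{\mathbf{i}}\,h(X_{\mathbf{i}})\to 0$ a.s. as $n\to\infty$; (b) $\frac{1}{\gamma_n}\sum_{\mathbf{i}\in C_n}\tilde\varepsilon_{\mathbf{i}}\,h(\tilde X_{\mathbf{i}})\to 0$ a.s. as $n\to\infty$; (c) $\frac{1}{\gamma_n^2}\sum_{\mathbf{i}\in I_n}h^2(X_{\mathbf{i}})\to 0$ a.s. as $n\to\infty$; (d) $\frac{1}{\gamma_n^2}\sum_{\mathbf{i}\in C_n}h^2(\tilde X_{\mathbf{i}})\to 0$ a.s. as $n\to\infty$; (e) $\sum_{k=1}^\infty P\big(\exists\,\mathbf{i}\in I_{2^k}:\ X_{\mathbf{i}}\notin A_{k,d}\big)<\infty$; (f) $\sum_{k=1}^\infty P\big(\exists\,\mathbf{i}\in C_{2^k}:\ \tilde X_{\mathbf{i}}\notin A_{k,d}\big)<\i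nfty$.
   Context: $(X_j)_{j\ge1}$ is a sequence of i.i.d. random variables with values in a measurable space $E$ and common law $\mu$; $(X^{(k)}_j)_{j\ge1}$, $k=1,\dots,d$, are independent copies of the sequence $(X_j)$. $(\varepsilon_i)_{i\ge1}$ is a Rademacher sequence (i.i.d. symmetric random variables with values $\pm1$) and $(\varepsilon^{(k)}_i)_{i\ge1,\,1\le k\le d}$ is a doubly indexed Rademacher sequence (all entries i.i.d.), each independent of all the other random variables. For a multiindex $\mathbf{i}=(i_1,\dots,i_d)$ of positive integers: $X_{\mathbf{i}}=(X_{i_1},\dots,X_{i_d})$, $\tilde X_{\mathbf{i}}=(X^{(1)}_{i_1},\dots,X^{(d)}_{i_d})$, $\varepsilon_{\mathbf{i}}=\varepsilon_{i_1}\cdots\varepsilon_{i_d}$, $\tilde\varepsilon_{\mathbf{i}}=\varepsilon^{(1)}_{i_1}\cdots\varepsilon^{(d)}_{i_d}$. Index sets: $I_n=\{\mathbf{i}:1\le i_1<i_2<\dots<i_d\le n\}$ and $C_n=\{\mathbf{i}:1\le i_1,\dots,i_d\le n\}$. For $I\subset\{1,\dots,d\}$ and a nonnegative measurable $g$ on $E^d$, $E_I g(x)$ denotes the integral of $g$ over the coordinates with index in $I$, each with respect to $\mu$ (independently), the coordinates $x_k$, $k\notin I$, being kept fixed. $I_A$ for a set $A\subset E^d$ denotes its indicator function. The sets $A_{k,l}$ are defined, for $k=1,2,\dots$, by $$A_{k,1}=\{x\in E^d:\ h^2(x)\le\gamma_{2^k}^2\},$$ and for $l=1,\dots,d-1$,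 $$A_{k,l+1}=\{x\in A_{k,l}:\ 2^{kl}E_I\big(h^2I_{A_{k,l}}\big)(x)\le\gamma_{2^k}^2\ \text{ for all } I\subset\{1,\dots,d\}\text{ with } \mathrm{Card}(I)=l\}.$$ *)

theory Defs
  imports "HOL-Probability.Probability"
begin

text \<open>
  Points of \<open>E\<^sup>d\<close> are elements of \<open>PiM {1..d} (\<lambda>_. E)\<close>, i.e. functions
  extensional on \<open>{1..d}\<close>; multiindices are extensional functions on \<open>{1..d}\<close> as well.
\<close>

definition index_cube :: "nat \<Rightarrow> nat \<Rightarrow> (nat \<Rightarrow> nat) set" where
  "index_cube d n = {1..d} \<rightarrow>\<^sub>E {1..n}"

definition index_simplex :: "nat \<Rightarrow> nat \<Rightarrow> (nat \<Rightarrow> nat) set" where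
  "index_simplex d n = {i \<in> index_cube d n. strict_mono_on {1..d} i}"

definition multi_X :: "nat \<Rightarrow> (nat \<Rightarrow> 'w \<Rightarrow> 'a) \<Rightarrow> (nat \<Rightarrow> nat) \<Rightarrow> 'w \<Rightarrow> nat \<Rightarrow> 'a" where
  "multi_X d X i \<omega> = (\<lambda>k\<in>{1..d}. X (i k) \<omega>)"

definition multi_X_dec ::
    "nat \<Rightarrow> (nat \<Rightarrow> nat \<Rightarrow> 'w \<Rightarrow> 'a) \<Rightarrow> (nat \<Rightarrow> nat) \<Rightarrow> 'w \<Rightarrow> nat \<Rightarrow> 'a" where
  "multi_X_dec d X' i \<omega> = (\<lambda>k\<in>{1..d}. X' k (i k) \<omega>)"

definition multi_sign :: "nat \<Rightarrow> (nat \<Rightarrow> 'w \<Rightarrow> real) \<Rightarrow> (nat \<Rightarrow> nat) \<Rightarrow> 'w \<Rightarrow> real" where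
  "multi_sign d \<epsilon> i \<omega> = (\<Prod>k\<in>{1..d}. \<epsilon> (i k) \<omega>)"

definition multi_sign_dec ::
    "nat \<Rightarrow> (nat \<Rightarrow> nat \<Rightarrow> 'w \<Rightarrow> real) \<Rightarrow> (nat \<Rightarrow> nat) \<Rightarrow> 'w \<Rightarrow> real" where
  "multi_sign_dec d \<epsilon>' i \<omega> = (\<Prod>k\<in>{1..d}. \<epsilon>' k (i k) \<omega>)"

definition symmetric_kernel :: "nat \<Rightarrow> 'a measure \<Rightarrow> ((nat \<Rightarrow> 'a) \<Rightarrow> real) \<Rightarrow> bool" where
  "symmetric_kernel d E h \<longleftrightarrow>
     (\<forall>\<sigma>. \<sigma> permutes {1..d} \<longrightarrow> (\<forall>x\<in>space (PiM {1..d} (\<lambda>_. E)). h (x \<circ> \<sigma>) = h x))"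

text \<open>The partial expectation \<open>E\<^sub>I g (x)\<close>: the coordinates in \<open>I\<close> are integrated out.\<close>

definition partial_expectation ::
    "nat \<Rightarrow> 'a measure \<Rightarrow> nat set \<Rightarrow> ((nat \<Rightarrow> 'a) \<Rightarrow> ennreal) \<Rightarrow> (nat \<Rightarrow> 'a) \<Rightarrow> ennreal" where
  "partial_expectation d \<mu> I g x =
     (\<integral>\<^sup>+ y. g (merge I ({1..d} - I) (y, x)) \<partial>PiM I (\<lambda>_. \<mu>))"

text \<open>The sets \<open>A\<^bsub>k,l\<^esub>\<close> are meant for \<open>1 \<le> l \<le> d\<close>; the clause for \<open>l = 0\<close> is a dummy.\<close>

fun trunc_set ::
    "nat \<Rightarrow> 'a measure \<Rightarrow> ((nat \<Rightarrow> 'a) \<Rightarrow> real) \<Rightarrow> (nat \<Rightarrow> real) \<Rightarrow> nat \<Rightarrow> nat \<Rightarrow> (nat \<Rightarrow> 'a) set" where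
  "trunc_set d \<mu> h \<gamma> k 0 = space (PiM {1..d} (\<lambda>_. \<mu>))"
| "trunc_set d \<mu> h \<gamma> k (Suc 0) =
     {x \<in> space (PiM {1..d} (\<lambda>_. \<mu>)). (h x)\<^sup>2 \<le> (\<gamma> (2 ^ k))\<^sup>2}"
| "trunc_set d \<mu> h \<gamma> k (Suc (Suc l)) =
     {x \<in> trunc_set d \<mu> h \<gamma> k (Suc l).
        \<forall>I. I \<subseteq> {1..d} \<and> card I = Suc l \<longrightarrow>
          2 ^ (k * Suc l) *
            partial_expectation d \<mu> I
              (\<lambda>z. ennreal ((h z)\<^sup>2) * indicator (trunc_set d \<mu> h \<gamma> k (Suc l)) z) x
          \<le> ennreal ((\<gamma> (2 ^ k))\<^sup>2)}"

definition rademacher_family :: "'w measure \<Rightarrow> ('i \<Rightarrow> 'w \<Rightarrow> real) \<Rightarrow> 'i set \<Rightarrow> bool" where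
  "rademacher_family M \<epsilon> J \<longleftrightarrow>
     prob_space.indep_vars M (\<lambda>_. borel) \<epsilon> J \<and>
     (\<forall>i\<in>J. measure M {\<omega> \<in> space M. \<epsilon> i \<omega> = 1} = 1 / 2 \<and>
            measure M {\<omega> \<in> space M. \<epsilon> i \<omega> = -1} = 1 / 2)"

text \<open>
  Independence of two random elements. The library's \<open>indep_var\<close> requires both to take
  values in the same type, which fails for the random elements considered here.
\<close>

definition indep_elements ::
    "'w measure \<Rightarrow> 'b measure \<Rightarrow> ('w \<Rightarrow> 'b) \<Rightarrow> 'c measure \<Rightarrow> ('w \<Rightarrow> 'c) \<Rightarrow> bool" where
  "indep_elements M S Y T Z \<longleftrightarrow>
     Y \<in> measurable M S \<and> Z \<in> measurable M T \<and>
     prob_space.indep_set M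
       {Y -` A \<inter> space M | A. A \<in> sets S} {Z -` B \<inter> space M | B. B \<in> sets T}"

end

theory Submission
  imports Defs
begin

text \<open>
  Write \<open>a\<^sub>k\<close> for \<open>(\<gamma> (2 ^ k))\<^sup>2\<close>. All six conditions are compared with (f), that is, with the
  summability of the probabilities \<open>p\<^sub>k\<close> that some decoupled tuple with indices up to \<open>2 ^ k\<close>
  leaves \<open>A\<^bsub>k,d\<^esub>\<close>. The implications proved are (e) \<open>\<longleftrightarrow>\<close> (f), (f) \<open>\<Longrightarrow>\<close> (a) \<open>\<Longrightarrow>\<close> (c) \<open>\<Longrightarrow>\<close> (f)
  and (f) \<open>\<Longrightarrow>\<close> (b) \<open>\<Longrightarrow>\<close> (d) \<open>\<Longrightarrow>\<close> (f).

  \<^emph>\<open>(e) and (f).\<close> The tuples that take their \<open>\<kappa>\<close>-th index from the \<open>\<kappa>\<close>-th of \<open>d\<close> consecutive blocks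
  are increasing, and the variables in different blocks are independent; so the increasing tuples
  contain a decoupled family of smaller size (\<open>simplex_escape_lower\<close>), and enlarging that size by a
  constant factor costs a constant factor in probability (\<open>escapes_cover\<close>). Conversely, colour the
  indices with \<open>d\<close> colours: the increasing tuples whose \<open>\<kappa>\<close>-th index has colour \<open>\<kappa>\<close> behave like
  decoupled ones, and every tuple is coloured in this way by a fixed proportion of the colourings
  (\<open>simplex_escape_upper\<close>).

  \<^emph>\<open>What the truncation achieves.\<close> Let \<open>f\<close> be bounded by \<open>h\<^sup>2\<close> times the indicator of \<open>A\<^bsub>k,l\<^esub>\<close>, viewed as a
  function of \<open>l\<close> of its coordinates, and let \<open>S\<close> be the decoupled sum of \<open>f\<close>, with mean \<open>m\<close>. In
  \<open>E S\<^sup>2\<close> the pairs of multiindices that differ exactly on a proper subset \<open>D\<close> of the coordinates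
  bring in the factor \<open>2\<^bsup>k|D|\<^esup> E\<^sub>D f\<close>, which is at most \<open>a\<^sub>k\<close> by the definition of \<open>A\<^bsub>k,l\<^esub>\<close>. Hence
  \<open>E S\<^sup>2 \<le> m\<^sup>2 + 2\<^sup>l a\<^sub>k m\<close> (\<open>sample_sum_second_moment\<close>), and the Paley-Zygmund inequality
  bounds from below the probability that \<open>S > m / 2\<close>. This is used twice.

  First, a tuple that lies in \<open>A\<^bsub>k,l\<^esub>\<close> but not in \<open>A\<^bsub>k,l+1\<^esub>\<close> has a section whose mean exceeds \<open>a\<^sub>k\<close>,
  and outside \<open>A\<^bsub>k,1\<^esub>\<close> a single square exceeds \<open>a\<^sub>k\<close>; so \<open>p\<^sub>k\<close> is at most a
  constant times the probability that the sum of squares exceeds \<open>a\<^sub>k / 2\<close>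
  (\<open>escape_forces_large_square_sum\<close>). Sums over disjoint dyadic blocks of indices are
  independent; if they are eventually small almost surely, the second Borel-Cantelli lemma makes
  these probabilities summable. This gives (c) \<open>\<Longrightarrow>\<close> (f) and (d) \<open>\<Longrightarrow>\<close> (f).

  Secondly, (f) implies \<open>\<Sum>\<^sub>k 2\<^bsup>dk\<^esup> E(h\<^sup>2; A\<^bsub>k,d\<^esub>) / a\<^sub>k < \<infinity>\<close> (\<open>summable_energy\<close>): by the regularity of
  \<open>\<gamma>\<close> it suffices to sum over the level at which a point first enters one of the sets \<open>A\<^bsub>k,d\<^esub>\<close>, and
  the points that enter at level \<open>k\<close> lie outside \<open>A\<^bsub>k-1,d\<^esub>\<close>, so that Paley-Zygmund bounds their
  share by a multiple of \<open>p\<^bsub>k-1\<^esub>\<close>.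

  \<^emph>\<open>Signed sums.\<close> Given the variables \<open>X\<close>, a signed sum is a Walsh polynomial of degree \<open>d\<close> in
  the signs, its mean square is the sum of squares, and it is a martingale in \<open>n\<close>. Kolmogorov's
  maximal inequality and the summability above give (f) \<open>\<Longrightarrow>\<close> (a) and (f) \<open>\<Longrightarrow>\<close> (b). In the other
  direction the fourth moment of a Walsh polynomial is at most \<open>9 ^ d\<close> times the square of its
  second moment, so, conditionally on \<open>X\<close>, the signed sum is at least of the order of its
  standard deviation with probability at least \<open>1 / (4 * 9 ^ d)\<close>; thus it cannot be
  \<open>o(\<gamma> n)\<close> unless the sum of squares is \<open>o((\<gamma> n)\<^sup>2)\<close>. This is (a) \<open>\<Longrightarrow>\<close> (c) and (b) \<open>\<Longrightarrow>\<close> (d).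
\<close>

section \<open>Walsh polynomials in finitely many signs\<close>

text \<open>
  A vector of signs is encoded by the set \<open>U\<close> of its negative entries; \<open>walsh A U\<close> is then the
  product of the entries with index in \<open>A\<close>.
\<close>

definition walsh :: "'i set \<Rightarrow> 'i set \<Rightarrow> real" where
  "walsh A U = (-1) ^ card (A \<inter> U)"

definition walsh_poly :: "('i set \<Rightarrow> real) \<Rightarrow> 'i set \<Rightarrow> 'i set \<Rightarrow> real" where
  "walsh_poly c J U = (\<Sum>A\<in>Pow J. c A * walsh A U)"

lemma sum_Pow_insert:
  fixes F :: "'i set \<Rightarrow> 'b::comm_monoid_add"
  assumes "finite J" "j \<notin> J"
  shows "(\<Sum>U\<in>Pow (insert j J). F U) = (\<Sum>U\<in>Pow J. F U + F (insert j U))"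
proof -
  have "inj_on (insert j) (Pow J)" using assms by (auto simp: inj_on_def)
  moreover have "Pow J \<inter> insert j ` Pow J = {}" using assms by auto
  ultimately show ?thesis
    using assms by (simp add: Pow_insert sum.union_disjoint sum.reindex sum.distrib)
qed

lemma walsh_insert:
  assumes "finite J" "j \<notin> J" "A \<subseteq> J" "U \<subseteq> J"
  shows "walsh A (insert j U) = walsh A U"
    and "walsh (insert j A) U = walsh A U"
    and "walsh (insert j A) (insert j U) = - walsh A U"
proof -
  have j: "j \<notin> A" "j \<notin> U" and fin: "finite (A \<inter> U)"
    using assms finite_subset[of A J] by auto
  then show "walsh A (insert j U) = walsh A U" "walsh (insert j A) U = walsh A U"
    by (simp_all add: walsh_def)
  have "insert j A \<inter> insert j U = insert j (A \<inter> U)" by auto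
  then show "walsh (insert j A) (insert j U) = - walsh A U"
    using j fin by (simp add: walsh_def)
qed

lemma walsh_poly_insert:
  assumes "finite J" "j \<notin> J" "U \<subseteq> J"
  shows "walsh_poly c (insert j J) U = walsh_poly c J U + walsh_poly (\<lambda>A. c (insert j A)) J U"
    and "walsh_poly c (insert j J) (insert j U)
           = walsh_poly c J U - walsh_poly (\<lambda>A. c (insert j A)) J U"
  unfolding walsh_poly_def sum_Pow_insert[OF assms(1,2)]
  using assms by (simp_all add: walsh_insert[of J j] sum.distrib sum_subtractf sum_negf)

lemma walsh_Int: "A \<subseteq> J \<Longrightarrow> walsh A (U \<inter> J) = walsh A U"
  unfolding walsh_def by (rule arg_cong[where f = "\<lambda>S. (-1) ^ card S"]) auto

lemma walsh_poly_Int: "J \<subseteq> J' \<Longrightarrow> walsh_poly c J (U \<inter> J') = walsh_poly c J U"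
  unfolding walsh_poly_def by (intro sum.cong refl) (metis PowD subset_trans walsh_Int)

text \<open>
  Parseval's identity. In the induction \<open>P = Q \<plusminus> R\<close>, the sign being the new entry, and the cross
  terms cancel by the parallelogram law.
\<close>

lemma walsh_second_moment:
  assumes "finite J"
  shows "(\<Sum>U\<in>Pow J. (walsh_poly c J U)\<^sup>2) = 2 ^ card J * (\<Sum>A\<in>Pow J. (c A)\<^sup>2)"
  using assms
proof (induction J arbitrary: c rule: finite_induct)
  case empty
  then show ?case by (simp add: walsh_poly_def walsh_def)
next
  case (insert j J)
  have par: "(a + b)\<^sup>2 + (a - b)\<^sup>2 = 2 * a\<^sup>2 + 2 * b\<^sup>2" for a b :: real
    by (simp add: power2_eq_square algebra_simps)
  have "(\<Sum>U\<in>Pow (insert j J). (walsh_poly c (insert j J) U)\<^sup>2)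
      = (\<Sum>U\<in>Pow J. 2 * (walsh_poly c J U)\<^sup>2 + 2 * (walsh_poly (\<lambda>A. c (insert j A)) J U)\<^sup>2)"
    unfolding sum_Pow_insert[OF insert.hyps]
    using insert.hyps by (intro sum.cong refl) (simp add: walsh_poly_insert par)
  also have "\<dots> = 2 ^ card (insert j J) * (\<Sum>A\<in>Pow J. (c A)\<^sup>2 + (c (insert j A))\<^sup>2)"
    using insert.hyps
    by (simp add: sum.distrib sum_distrib_left[symmetric] insert.IH distrib_left)
  finally show ?case by (simp add: sum_Pow_insert[OF insert.hyps])
qed

text \<open>
  Hypercontractivity with constant \<open>9 ^ d\<close>. Again \<open>P = Q \<plusminus> R\<close>, and now \<open>R\<close> has degree at most
  \<open>d - 1\<close>, which gains a factor \<open>9\<close> in \<open>E R ^ 4\<close> and, by Cauchy-Schwarz, a factor \<open>3\<close> in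
  \<open>E Q\<^sup>2 R\<^sup>2\<close>; this turns the coefficient \<open>6\<close> of the mixed term into the \<open>2\<close> of a binomial square.
\<close>

lemma walsh_fourth_moment:
  assumes "finite J" and deg: "\<And>A. A \<subseteq> J \<Longrightarrow> card A > d \<Longrightarrow> c A = 0"
  shows "(\<Sum>U\<in>Pow J. (walsh_poly c J U) ^ 4)
           \<le> 2 ^ card J * 9 ^ d * (\<Sum>A\<in>Pow J. (c A)\<^sup>2)\<^sup>2"
  using assms
proof (induction J arbitrary: c d rule: finite_induct)
  case empty
  have "(c {})\<^sup>2 * (c {})\<^sup>2 \<le> 9 ^ d * ((c {})\<^sup>2 * (c {})\<^sup>2)"
    by (simp add: mult_le_cancel_right1)
  then show ?case by (simp add: walsh_poly_def walsh_def power4_eq_xxxx power2_eq_square mult.assoc)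
next
  case (insert j J)
  define c' where "c' = (\<lambda>A. c (insert j A))"
  define Q where "Q = walsh_poly c J"
  define R where "R = walsh_poly c' J"
  define q where "q = (\<Sum>A\<in>Pow J. (c A)\<^sup>2)"
  define r where "r = (\<Sum>A\<in>Pow J. (c' A)\<^sup>2)"
  define N :: real where "N = 2 ^ card J"
  define a :: real where "a = 9 ^ d"
  have a: "a \<ge> 1" and N: "N > 0" by (simp_all add: a_def N_def)
  have qr: "q \<ge> 0" "r \<ge> 0" unfolding q_def r_def by (simp_all add: sum_nonneg)
  have card_ins: "card (insert j A) = Suc (card A)" if "A \<subseteq> J" for A
    using that insert.hyps finite_subset by (metis card_insert_disjoint subsetD)
  have Q4: "(\<Sum>U\<in>Pow J. Q U ^ 4) \<le> N * a * q\<^sup>2"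
    unfolding Q_def N_def a_def q_def
    by (rule insert.IH) (use insert.prems in auto)
  have R4: "(\<Sum>U\<in>Pow J. R U ^ 4) \<le> N * (a / 9) * r\<^sup>2"
  proof (cases d)
    case 0
    have "c' A = 0" if "A \<subseteq> J" for A
      unfolding c'_def using that insert.prems[of "insert j A"] card_ins[OF that] 0 by auto
    then have "R U = 0" for U unfolding R_def walsh_poly_def by simp
    then show ?thesis using N a by simp
  next
    case (Suc d')
    have "(\<Sum>U\<in>Pow J. R U ^ 4) \<le> N * 9 ^ d' * r\<^sup>2"
      unfolding R_def N_def r_def
    proof (rule insert.IH)
      fix A assume "A \<subseteq> J" "d' < card A"
      then show "c' A = 0"
        unfolding c'_def using insert.prems[of "insert j A"] card_ins[of A] Suc by auto
    qed
    then show ?thesis using Suc by (simp add: a_def)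
  qed
  have QR: "(\<Sum>U\<in>Pow J. (Q U)\<^sup>2 * (R U)\<^sup>2) \<le> N * a * q * r / 3"
  proof (rule power2_le_imp_le)
    have "(\<Sum>U\<in>Pow J. (Q U)\<^sup>2 * (R U)\<^sup>2)\<^sup>2
        \<le> (\<Sum>U\<in>Pow J. ((Q U)\<^sup>2)\<^sup>2) * (\<Sum>U\<in>Pow J. ((R U)\<^sup>2)\<^sup>2)"
      by (rule Cauchy_Schwarz_ineq_sum)
    also have "\<dots> = (\<Sum>U\<in>Pow J. Q U ^ 4) * (\<Sum>U\<in>Pow J. R U ^ 4)" by simp
    also have "\<dots> \<le> (N * a * q\<^sup>2) * (N * (a / 9) * r\<^sup>2)"
      using N a qr by (intro mult_mono Q4 R4 sum_nonneg) auto
    also have "\<dots> = (N * a * q * r / 3)\<^sup>2"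
      by (simp add: power2_eq_square field_simps)
    finally show "(\<Sum>U\<in>Pow J. (Q U)\<^sup>2 * (R U)\<^sup>2)\<^sup>2 \<le> (N * a * q * r / 3)\<^sup>2" .
    show "0 \<le> N * a * q * r / 3" using N a qr by simp
  qed
  have exp4: "(x + y) ^ 4 + (x - y) ^ 4 = 2 * x ^ 4 + 12 * (x\<^sup>2 * y\<^sup>2) + 2 * y ^ 4" for x y :: real
    by (simp add: power4_eq_xxxx power2_eq_square algebra_simps)
  have "(\<Sum>U\<in>Pow (insert j J). (walsh_poly c (insert j J) U) ^ 4)
      = (\<Sum>U\<in>Pow J. 2 * Q U ^ 4 + 12 * ((Q U)\<^sup>2 * (R U)\<^sup>2) + 2 * R U ^ 4)"
    unfolding sum_Pow_insert[OF insert.hyps] Q_def R_def c'_def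
    using insert.hyps by (intro sum.cong refl) (simp add: walsh_poly_insert exp4)
  also have "\<dots> = 2 * (\<Sum>U\<in>Pow J. Q U ^ 4) + 12 * (\<Sum>U\<in>Pow J. (Q U)\<^sup>2 * (R U)\<^sup>2)
      + 2 * (\<Sum>U\<in>Pow J. R U ^ 4)"
    by (simp add: sum.distrib sum_distrib_left)
  also have "\<dots> \<le> 2 * (N * a * q\<^sup>2) + 12 * (N * a * q * r / 3) + 2 * (N * (a / 9) * r\<^sup>2)"
    using Q4 QR R4 by linarith
  also have "\<dots> \<le> 2 * (N * a * q\<^sup>2) + 12 * (N * a * q * r / 3) + 2 * (N * a * r\<^sup>2)"
    using N a qr by simp
  also have "\<dots> = 2 * N * a * (q + r)\<^sup>2"
    by (simp add: power2_eq_square algebra_simps)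
  also have "\<dots> = 2 ^ card (insert j J) * 9 ^ d * (\<Sum>A\<in>Pow (insert j J). (c A)\<^sup>2)\<^sup>2"
    unfolding sum_Pow_insert[OF insert.hyps] N_def a_def q_def r_def c'_def
    using insert.hyps by (simp add: sum.distrib)
  finally show ?case .
qed

lemma walsh_Paley_Zygmund:
  assumes "finite J" and deg: "\<And>A. A \<subseteq> J \<Longrightarrow> card A > d \<Longrightarrow> c A = 0"
  shows "2 ^ card J / (4 * 9 ^ d)
    \<le> real (card {U \<in> Pow J. (\<Sum>A\<in>Pow J. (c A)\<^sup>2) / 2 \<le> (walsh_poly c J U)\<^sup>2})"
proof -
  define V where "V = (\<Sum>A\<in>Pow J. (c A)\<^sup>2)"
  define P where "P = walsh_poly c J"
  define N :: real where "N = 2 ^ card J"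
  define G where "G = {U \<in> Pow J. V / 2 \<le> (P U)\<^sup>2}"
  have N: "N > 0" "real (card (Pow J)) = N" using assms by (simp_all add: N_def card_Pow)
  have V0: "V \<ge> 0" unfolding V_def by (simp add: sum_nonneg)
  have fin: "finite (Pow J)" "finite G" using assms by (auto simp: G_def)
  show ?thesis
  proof (cases "V = 0")
    case True
    then have "G = Pow J" by (auto simp: G_def)
    then have "real (card G) = N" using N by simp
    moreover have "N / (4 * 9 ^ d) \<le> N / 1"
      using N(1) one_le_power[of "9::real" d] by (intro divide_left_mono) linarith+
    ultimately show ?thesis by (simp add: G_def V_def P_def N_def)
  next
    case False
    then have V: "V > 0" using V0 by simp
    have "N * V = (\<Sum>U\<in>Pow J. (P U)\<^sup>2)"
      unfolding N_def V_def P_def using walsh_second_moment[OF assms(1), of c] by simp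
    also have "\<dots> \<le> (\<Sum>U\<in>Pow J. V / 2 + (P U)\<^sup>2 * indicator G U)"
      using V by (intro sum_mono) (auto simp: G_def indicator_def)
    also have "\<dots> = N * V / 2 + (\<Sum>U\<in>Pow J. (P U)\<^sup>2 * indicator G U)"
      using N by (simp add: sum.distrib)
    finally have "N * V / 2 \<le> (\<Sum>U\<in>Pow J. (P U)\<^sup>2 * indicator G U)" by simp
    then have "(N * V / 2)\<^sup>2 \<le> (\<Sum>U\<in>Pow J. (P U)\<^sup>2 * indicator G U)\<^sup>2"
      using N V by (intro power_mono) auto
    also have "\<dots> \<le> (\<Sum>U\<in>Pow J. ((P U)\<^sup>2)\<^sup>2) * (\<Sum>U\<in>Pow J. (indicator G U)\<^sup>2)"
      by (rule Cauchy_Schwarz_ineq_sum)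
    also have "(\<Sum>U\<in>Pow J. (indicator G U)\<^sup>2) = (\<Sum>U\<in>Pow J. (indicator G U :: real))"
      by (intro sum.cong) (auto simp: indicator_def)
    also have "\<dots> = real (card G)"
      unfolding indicator_def using fin by (simp add: sum.If_cases G_def Int_def conj_ac)
    also have "(\<Sum>U\<in>Pow J. ((P U)\<^sup>2)\<^sup>2) * real (card G) \<le> (N * 9 ^ d * V\<^sup>2) * real (card G)"
      using walsh_fourth_moment[OF assms]
      by (intro mult_right_mono) (simp_all add: N_def V_def P_def)
    finally have "N * V\<^sup>2 * N \<le> N * V\<^sup>2 * (real (card G) * (4 * 9 ^ d))"
      by (simp add: power2_eq_square field_simps)
    then have "N \<le> real (card G) * (4 * 9 ^ d)"
      using N V by (simp add: mult_le_cancel_left_pos)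
    then show ?thesis by (simp add: G_def V_def P_def N_def field_simps)
  qed
qed

text \<open>
  Flipping the entry \<open>j\<close> changes the sign of every term.
\<close>

lemma sum_walsh_cancel:
  assumes "finite J" "j \<in> A" "A \<subseteq> J" and G: "\<And>U. G (insert j U) = (G U :: real)"
  shows "(\<Sum>U\<in>Pow J. walsh A U * G U) = 0"
proof -
  define J' where "J' = J - {j}"
  define A' where "A' = A - {j}"
  have *: "J = insert j J'" "j \<notin> J'" "finite J'" "A = insert j A'" "A' \<subseteq> J'"
    using assms by (auto simp: J'_def A'_def)
  show ?thesis
    unfolding * sum_Pow_insert[OF *(3,2)]
    by (rule sum.neutral) (use * G in \<open>simp add: walsh_insert[of J' j]\<close>)
qed

text \<open>
  Kolmogorov's argument: split according to the first \<open>n\<close> at which the threshold is reached. That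
  event depends on the signs in \<open>J n\<close> only, while every monomial of \<open>P N - P n\<close> contains a sign
  outside \<open>J n\<close>, so the increment is orthogonal to \<open>P n\<close> on the event.
\<close>

lemma walsh_maximal_inequality:
  fixes J :: "nat \<Rightarrow> 'i set"
  assumes fin: "\<And>n. finite (J n)" and mono: "mono J" and t: "t \<ge> 0"
  shows "t\<^sup>2 * real (card {U \<in> Pow (J N). \<exists>n\<le>N. t \<le> \<bar>walsh_poly c (J n) U\<bar>})
      \<le> 2 ^ card (J N) * (\<Sum>A\<in>Pow (J N). (c A)\<^sup>2)"
proof -
  define P where "P n = walsh_poly c (J n)" for n
  define G where "G n = {U. t \<le> \<bar>P n U\<bar> \<and> (\<forall>m<n. \<bar>P m U\<bar> < t)}" for n
  have J: "J m \<subseteq> J n" if "m \<le> n" for m n using mono that by (auto dest: monoD)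
  have P_ins: "P m (insert j U) = P m U" if "j \<notin> J n" "m \<le> n" for m n j U
  proof -
    have "insert j U \<inter> J m = U \<inter> J m" using that J[of m n] by auto
    then show ?thesis unfolding P_def by (metis order_refl walsh_poly_Int)
  qed
  have G_ins: "insert j U \<in> G n \<longleftrightarrow> U \<in> G n" if "j \<notin> J n" for j U n
    using P_ins[OF that] by (auto simp: G_def)
  have cross: "(\<Sum>U\<in>Pow (J N). (P N U - P n U) * (P n U * indicator (G n) U)) = 0" if n: "n \<le> N" for n
  proof -
    have "P N U - P n U = (\<Sum>A\<in>Pow (J N) - Pow (J n). c A * walsh A U)" for U
      unfolding P_def walsh_poly_def using fin J[OF n] by (subst sum_diff) auto
    then have "(\<Sum>U\<in>Pow (J N). (P N U - P n U) * (P n U * indicator (G n) U))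
        = (\<Sum>U\<in>Pow (J N). \<Sum>A\<in>Pow (J N) - Pow (J n).
             c A * (walsh A U * (P n U * indicator (G n) U)))"
      by (simp add: sum_distrib_right mult.assoc)
    also have "\<dots> = (\<Sum>A\<in>Pow (J N) - Pow (J n).
        c A * (\<Sum>U\<in>Pow (J N). walsh A U * (P n U * indicator (G n) U)))"
      by (subst sum.swap) (simp add: sum_distrib_left)
    also have "\<dots> = 0"
    proof (rule sum.neutral, rule ballI)
      fix A assume "A \<in> Pow (J N) - Pow (J n)"
      then have A: "A \<subseteq> J N" "\<not> A \<subseteq> J n" by auto
      then obtain j where j: "j \<in> A" "j \<notin> J n" by auto
      have "(\<Sum>U\<in>Pow (J N). walsh A U * (P n U * indicator (G n) U)) = 0"
        using fin j A P_ins[OF j(2) order_refl] G_ins[OF j(2)]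
        by (intro sum_walsh_cancel[of _ j]) (auto simp: indicator_def)
      then show "c A * (\<Sum>U\<in>Pow (J N). walsh A U * (P n U * indicator (G n) U)) = 0" by simp
    qed
    finally show ?thesis .
  qed
  have ex1: "(\<Sum>n\<le>N. indicator (G n) U) = (if \<exists>n\<le>N. t \<le> \<bar>P n U\<bar> then 1 else 0 :: real)" for U
  proof (cases "\<exists>n\<le>N. t \<le> \<bar>P n U\<bar>")
    case True
    define m where "m = (LEAST n. t \<le> \<bar>P n U\<bar>)"
    have "\<exists>n. t \<le> \<bar>P n U\<bar>" using True by blast
    then have m: "t \<le> \<bar>P m U\<bar>" unfolding m_def by (rule LeastI_ex)
    have m': "\<bar>P n U\<bar> < t" if "n < m" for n
      using not_less_Least[OF that[unfolded m_def]] by simp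
    have "m \<le> N" unfolding m_def using True by (meson Least_le order_trans)
    moreover have "U \<in> G n \<longleftrightarrow> n = m" for n
    proof
      assume "U \<in> G n"
      then have n: "t \<le> \<bar>P n U\<bar>" "\<And>k. k < n \<Longrightarrow> \<bar>P k U\<bar> < t" by (auto simp: G_def)
      show "n = m"
        by (rule linorder_cases[of n m]) (use m n(1) m'[of n] n(2)[of m] in linarith)+
    qed (use m m' in \<open>auto simp: G_def\<close>)
    ultimately have "(\<Sum>n\<le>N. indicator (G n) U) = (\<Sum>n\<le>N. if n = m then 1 else 0 :: real)"
      by (intro sum.cong) (auto simp: indicator_def)
    then show ?thesis using True \<open>m \<le> N\<close> by simp
  next
    case False
    then show ?thesis by (auto simp: G_def indicator_def intro!: sum.neutral)
  qed
  have "t\<^sup>2 * real (card {U \<in> Pow (J N). \<exists>n\<le>N. t \<le> \<bar>P n U\<bar>})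
      = t\<^sup>2 * (\<Sum>U\<in>Pow (J N). if \<exists>n\<le>N. t \<le> \<bar>P n U\<bar> then 1 else 0)"
    using fin by (simp add: sum.If_cases Int_def)
  also have "\<dots> = (\<Sum>U\<in>Pow (J N). \<Sum>n\<le>N. t\<^sup>2 * indicator (G n) U)"
    by (simp add: ex1[symmetric] sum_distrib_left)
  also have "\<dots> \<le> (\<Sum>U\<in>Pow (J N). \<Sum>n\<le>N. (P N U)\<^sup>2 * indicator (G n) U
      - 2 * ((P N U - P n U) * (P n U * indicator (G n) U)))"
  proof (intro sum_mono)
    fix U n
    have "t\<^sup>2 \<le> (P N U)\<^sup>2 - 2 * ((P N U - P n U) * P n U)" if "U \<in> G n"
    proof -
      have "t\<^sup>2 \<le> (P n U)\<^sup>2"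
        using that t by (intro abs_le_square_iff[THEN iffD1]) (auto simp: G_def)
      also have "\<dots> \<le> (P n U)\<^sup>2 + (P N U - P n U)\<^sup>2" by simp
      finally show ?thesis by (simp add: power2_eq_square algebra_simps)
    qed
    then show "t\<^sup>2 * indicator (G n) U \<le> (P N U)\<^sup>2 * indicator (G n) U
      - 2 * ((P N U - P n U) * (P n U * indicator (G n) U))"
      by (cases "U \<in> G n") auto
  qed
  also have "\<dots> = (\<Sum>U\<in>Pow (J N). (P N U)\<^sup>2 * (\<Sum>n\<le>N. indicator (G n) U))
      - 2 * (\<Sum>n\<le>N. \<Sum>U\<in>Pow (J N). (P N U - P n U) * (P n U * indicator (G n) U))"
    unfolding sum_distrib_left by (subst (2) sum.swap) (simp add: sum_subtractf)
  also have "\<dots> \<le> (\<Sum>U\<in>Pow (J N). (P N U)\<^sup>2)"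
    by (simp add: cross ex1 sum_mono)
  also have "\<dots> = 2 ^ card (J N) * (\<Sum>A\<in>Pow (J N). (c A)\<^sup>2)"
    unfolding P_def by (rule walsh_second_moment[OF fin])
  finally show ?thesis by (simp add: P_def)
qed

section \<open>Random signs independent of the coefficients\<close>

text \<open>
  The sign vector of a sample point, in the encoding used for \<^const>\<open>walsh\<close>.
\<close>

definition neg_set :: "('i \<Rightarrow> 'w \<Rightarrow> real) \<Rightarrow> 'w \<Rightarrow> 'i set" where
  "neg_set \<epsilon> \<omega> = {j. \<epsilon> j \<omega> = -1}"

text \<open>
  Only the events \<open>\<epsilon> j = -1\<close> and their complements enter, so that the null set on which some
  \<open>\<epsilon> j\<close> is not a sign does no harm.
\<close>

lemma neg_set_joint_law:
  fixes \<epsilon> :: "'i \<Rightarrow> 'w \<Rightarrow> real"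
  assumes M: "prob_space M"
    and rad: "rademacher_family M \<epsilon> K"
    and ind: "indep_elements M (PiM K (\<lambda>_. borel)) (\<lambda>\<omega>. \<lambda>i\<in>K. \<epsilon> i \<omega>) T Z"
    and J: "finite J" "J \<subseteq> K" and U: "U \<subseteq> J" and B: "B \<in> sets T"
  shows "measure M {\<omega>\<in>space M. neg_set \<epsilon> \<omega> \<inter> J = U \<and> Z \<omega> \<in> B}
     = measure M {\<omega>\<in>space M. Z \<omega> \<in> B} / 2 ^ card J"
proof (cases "J = {}")
  case True
  then show ?thesis using U by simp
next
  case False
  interpret prob_space M by fact
  define S where "S j = (if j \<in> U then {-1} else - {-1 :: real})" for j
  have S[measurable]: "S j \<in> sets borel" for j by (simp add: S_def)
  have indep: "indep_vars (\<lambda>_. borel) \<epsilon> K"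
    and half: "\<And>i. i \<in> K \<Longrightarrow> prob {\<omega> \<in> space M. \<epsilon> i \<omega> = -1} = 1 / 2"
    using rad by (auto simp: rademacher_family_def)
  have [measurable]: "\<epsilon> i \<in> borel_measurable M" if "i \<in> K" for i
    using indep that by (auto simp: indep_vars_def)
  define P where "P = prod_emb K (\<lambda>_. borel) J (PiE J S)"
  have P: "P \<in> sets (PiM K (\<lambda>_. borel))"
    unfolding P_def using J by (intro sets_PiM_I) auto
  have eq: "{\<omega>\<in>space M. neg_set \<epsilon> \<omega> \<inter> J = U} = (\<Inter>j\<in>J. \<epsilon> j -` S j \<inter> space M)"
    using U False by (auto simp: neg_set_def S_def split: if_splits)
  have eq': "{\<omega>\<in>space M. neg_set \<epsilon> \<omega> \<inter> J = U} = (\<lambda>\<omega>. \<lambda>i\<in>K. \<epsilon> i \<omega>) -` P \<inter> space M"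
    unfolding eq P_def prod_emb_def using J False
    by (auto simp: PiE_iff extensional_restrict subset_iff)
  have half': "prob (\<epsilon> j -` S j \<inter> space M) = 1 / 2" if "j \<in> J" for j
  proof (cases "j \<in> U")
    case True
    then have "\<epsilon> j -` S j \<inter> space M = {\<omega> \<in> space M. \<epsilon> j \<omega> = -1}" by (auto simp: S_def)
    then show ?thesis using half[of j] J that by auto
  next
    case F: False
    have jK: "j \<in> K" using J that by auto
    have "\<epsilon> j -` S j \<inter> space M = space M - {\<omega> \<in> space M. \<epsilon> j \<omega> = -1}"
      using F by (auto simp: S_def)
    moreover have "{\<omega> \<in> space M. \<epsilon> j \<omega> = -1} \<in> events" using jK by measurable
    ultimately show ?thesis using half[OF jK] by (simp add: prob_compl)
  qed
  have "prob {\<omega>\<in>space M. neg_set \<epsilon> \<omega> \<inter> J = U} = (\<Prod>j\<in>J. prob (\<epsilon> j -` S j \<inter> space M))"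
    unfolding eq by (rule indep_varsD[OF indep False J]) simp
  also have "\<dots> = (\<Prod>j\<in>J. 1 / 2)" by (intro prod.cong refl half')
  finally have pr: "prob {\<omega>\<in>space M. neg_set \<epsilon> \<omega> \<inter> J = U} = 1 / 2 ^ card J"
    by (simp add: power_divide)
  have "indep_set {(\<lambda>\<omega>. \<lambda>i\<in>K. \<epsilon> i \<omega>) -` A \<inter> space M | A. A \<in> sets (PiM K (\<lambda>_. borel))}
      {Z -` B \<inter> space M | B. B \<in> sets T}"
    using ind by (simp add: indep_elements_def)
  then have "prob (((\<lambda>\<omega>. \<lambda>i\<in>K. \<epsilon> i \<omega>) -` P \<inter> space M) \<inter> (Z -` B \<inter> space M))
      = prob ((\<lambda>\<omega>. \<lambda>i\<in>K. \<epsilon> i \<omega>) -` P \<inter> space M) * prob (Z -` B \<inter> space M)"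
    by (rule indep_setD) (use P B in auto)
  moreover have "{\<omega>\<in>space M. neg_set \<epsilon> \<omega> \<inter> J = U \<and> Z \<omega> \<in> B}
      = {\<omega>\<in>space M. neg_set \<epsilon> \<omega> \<inter> J = U} \<inter> (Z -` B \<inter> space M)" by auto
  moreover have "{\<omega>\<in>space M. Z \<omega> \<in> B} = Z -` B \<inter> space M" by auto
  ultimately show ?thesis using pr by (simp add: eq')
qed

lemma neg_set_Int_measurable:
  fixes \<epsilon> :: "'i \<Rightarrow> 'w \<Rightarrow> real"
  assumes \<epsilon>: "\<And>j. j \<in> J \<Longrightarrow> \<epsilon> j \<in> borel_measurable M" and J: "finite J"
  shows "(\<lambda>\<omega>. neg_set \<epsilon> \<omega> \<inter> J) \<in> measurable M (count_space (Pow J))"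
proof (rule measurable_count_space_eq_countable[THEN iffD2])
  show "countable (Pow J)" using J by (simp add: countable_finite)
next
  have "(\<lambda>\<omega>. neg_set \<epsilon> \<omega> \<inter> J) -` {U} \<inter> space M \<in> sets M" if "U \<subseteq> J" for U
  proof -
    have "(\<lambda>\<omega>. neg_set \<epsilon> \<omega> \<inter> J) -` {U} \<inter> space M
        = {\<omega>\<in>space M. \<forall>j\<in>J. (\<epsilon> j \<omega> = -1) = (j \<in> U)}"
      using that by (auto simp: neg_set_def)
    moreover have "{\<omega>\<in>space M. \<forall>j\<in>J. (\<epsilon> j \<omega> = -1) = (j \<in> U)} \<in> sets M"
    proof (rule sets.sets_Collect_finite_All[OF _ J])
      fix j assume "j \<in> J"
      then have [measurable]: "\<epsilon> j \<in> borel_measurable M" by (rule \<epsilon>)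
      show "{\<omega>\<in>space M. (\<epsilon> j \<omega> = -1) = (j \<in> U)} \<in> sets M"
        by (cases "j \<in> U") simp_all
    qed
    ultimately show ?thesis by simp
  qed
  then show "(\<lambda>\<omega>. neg_set \<epsilon> \<omega> \<inter> J) \<in> space M \<rightarrow> Pow J \<and>
      (\<forall>U\<in>Pow J. (\<lambda>\<omega>. neg_set \<epsilon> \<omega> \<inter> J) -` {U} \<inter> space M \<in> sets M)" by auto
qed

text \<open>
  Fubini's theorem for finitely many signs: the signs may be averaged out first, with \<open>Z\<close> frozen.
\<close>

lemma emeasure_neg_set:
  fixes \<epsilon> :: "'i \<Rightarrow> 'w \<Rightarrow> real"
  assumes M: "prob_space M"
    and rad: "rademacher_family M \<epsilon> K"
    and ind: "indep_elements M (PiM K (\<lambda>_. borel)) (\<lambda>\<omega>. \<lambda>i\<in>K. \<epsilon> i \<omega>) T Z"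
    and J: "finite J" "J \<subseteq> K"
    and Q: "\<And>U. U \<subseteq> J \<Longrightarrow> {z\<in>space T. Q U z} \<in> sets T"
  shows "{\<omega>\<in>space M. Q (neg_set \<epsilon> \<omega> \<inter> J) (Z \<omega>)} \<in> sets M"
    and "emeasure M {\<omega>\<in>space M. Q (neg_set \<epsilon> \<omega> \<inter> J) (Z \<omega>)}
     = (\<integral>\<^sup>+\<omega>. ennreal (card {U\<in>Pow J. Q U (Z \<omega>)} / 2 ^ card J) \<partial>M)"
proof -
  interpret prob_space M by fact
  have Z[measurable]: "Z \<in> measurable M T" using ind by (simp add: indep_elements_def)
  then have Zsp: "\<omega> \<in> space M \<Longrightarrow> Z \<omega> \<in> space T" for \<omega> by (rule measurable_space)
  have "indep_vars (\<lambda>_. borel) \<epsilon> K" using rad by (simp add: rademacher_family_def)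
  then have \<epsilon>: "\<epsilon> j \<in> borel_measurable M" if "j \<in> J" for j
    using J that by (auto simp: indep_vars_def)
  define E where "E U = {\<omega>\<in>space M. neg_set \<epsilon> \<omega> \<inter> J = U \<and> Z \<omega> \<in> {z\<in>space T. Q U z}}" for U
  have E: "E U \<in> sets M" if "U \<in> Pow J" for U
  proof -
    have "E U = ((\<lambda>\<omega>. neg_set \<epsilon> \<omega> \<inter> J) -` {U} \<inter> space M)
        \<inter> (Z -` {z\<in>space T. Q U z} \<inter> space M)"
      by (auto simp: E_def)
    also have "\<dots> \<in> sets M"
    proof (rule sets.Int)
      show "(\<lambda>\<omega>. neg_set \<epsilon> \<omega> \<inter> J) -` {U} \<inter> space M \<in> sets M"
        using that by (intro measurable_sets[OF neg_set_Int_measurable[OF \<epsilon> J(1)]]) auto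
      show "Z -` {z\<in>space T. Q U z} \<inter> space M \<in> sets M"
        using that by (intro measurable_sets[OF Z] Q) auto
    qed
    finally show ?thesis .
  qed
  have un: "{\<omega>\<in>space M. Q (neg_set \<epsilon> \<omega> \<inter> J) (Z \<omega>)} = (\<Union>U\<in>Pow J. E U)"
    using Zsp by (auto simp: E_def)
  show meas: "{\<omega>\<in>space M. Q (neg_set \<epsilon> \<omega> \<inter> J) (Z \<omega>)} \<in> sets M"
    unfolding un using J E by (intro sets.finite_UN) auto
  have QZ: "{\<omega>\<in>space M. Q U (Z \<omega>)} \<in> sets M" if "U \<in> Pow J" for U
  proof -
    have "{\<omega>\<in>space M. Q U (Z \<omega>)} = Z -` {z\<in>space T. Q U z} \<inter> space M" using Zsp by auto
    then show ?thesis using Q[of U] that Z by (simp add: measurable_sets)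
  qed
  have "emeasure M {\<omega>\<in>space M. Q (neg_set \<epsilon> \<omega> \<inter> J) (Z \<omega>)} = (\<Sum>U\<in>Pow J. emeasure M (E U))"
    unfolding un using J E
    by (subst sum_emeasure) (auto simp: disjoint_family_on_def E_def)
  also have "\<dots> = (\<Sum>U\<in>Pow J. ennreal (1 / 2 ^ card J) * emeasure M {\<omega>\<in>space M. Q U (Z \<omega>)})"
  proof (intro sum.cong refl)
    fix U assume U: "U \<in> Pow J"
    have "measure M (E U) = measure M {\<omega>\<in>space M. Z \<omega> \<in> {z\<in>space T. Q U z}} / 2 ^ card J"
      unfolding E_def using U Q[of U] by (intro neg_set_joint_law[OF M rad ind J]) auto
    also have "{\<omega>\<in>space M. Z \<omega> \<in> {z\<in>space T. Q U z}} = {\<omega>\<in>space M. Q U (Z \<omega>)}" using Zsp by auto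
    finally show "emeasure M (E U) = ennreal (1 / 2 ^ card J) * emeasure M {\<omega>\<in>space M. Q U (Z \<omega>)}"
      by (simp add: emeasure_eq_measure ennreal_mult'[symmetric])
  qed
  also have "\<dots> = (\<Sum>U\<in>Pow J. \<integral>\<^sup>+\<omega>. ennreal (1 / 2 ^ card J) * indicator {\<omega>\<in>space M. Q U (Z \<omega>)} \<omega> \<partial>M)"
    by (intro sum.cong refl nn_integral_cmult_indicator[symmetric] QZ)
  also have "\<dots> = (\<integral>\<^sup>+\<omega>. (\<Sum>U\<in>Pow J. ennreal (1 / 2 ^ card J) * indicator {\<omega>\<in>space M. Q U (Z \<omega>)} \<omega>) \<partial>M)"
    by (rule nn_integral_sum[symmetric]) (use QZ in simp)
  also have "\<dots> = (\<integral>\<^sup>+\<omega>. ennreal (card {U\<in>Pow J. Q U (Z \<omega>)} / 2 ^ card J) \<partial>M)"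
  proof (intro nn_integral_cong)
    fix \<omega> assume w: "\<omega> \<in> space M"
    have "(\<Sum>U\<in>Pow J. ennreal (1 / 2 ^ card J) * indicator {\<omega>\<in>space M. Q U (Z \<omega>)} \<omega>)
      = (\<Sum>U\<in>Pow J. ennreal (if Q U (Z \<omega>) then 1 / 2 ^ card J else 0))"
      using w by (intro sum.cong) (auto simp: indicator_def)
    also have "\<dots> = ennreal (\<Sum>U\<in>Pow J. if Q U (Z \<omega>) then 1 / 2 ^ card J else 0)"
      by (rule sum_ennreal) auto
    also have "(\<Sum>U\<in>Pow J. if Q U (Z \<omega>) then 1 / 2 ^ card J else 0) = card {U\<in>Pow J. Q U (Z \<omega>)} / 2 ^ card J"
      using J by (simp add: sum.If_cases Int_def)
    finally show "(\<Sum>U\<in>Pow J. ennreal (1 / 2 ^ card J) * indicator {\<omega>\<in>space M. Q U (Z \<omega>)} \<omega>)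
      = ennreal (card {U\<in>Pow J. Q U (Z \<omega>)} / 2 ^ card J)" .
  qed
  finally show "emeasure M {\<omega>\<in>space M. Q (neg_set \<epsilon> \<omega> \<inter> J) (Z \<omega>)}
     = (\<integral>\<^sup>+\<omega>. ennreal (card {U\<in>Pow J. Q U (Z \<omega>)} / 2 ^ card J) \<partial>M)" .
qed

section \<open>Almost sure convergence of Rademacher chaoses\<close>

text \<open>
  The coefficients of the chaos are functions of \<open>Z\<close>, and \<open>J n\<close> contains the signs in use at time \<open>n\<close>.
\<close>

locale rademacher_chaos =
  fixes M :: "'w measure" and \<epsilon> :: "'i \<Rightarrow> 'w \<Rightarrow> real" and K :: "'i set"
    and T :: "'t measure" and Z :: "'w \<Rightarrow> 't" and J :: "nat \<Rightarrow> 'i set"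
  assumes prob_M: "prob_space M"
    and rademacher: "rademacher_family M \<epsilon> K"
    and indep: "indep_elements M (PiM K (\<lambda>_. borel)) (\<lambda>\<omega>. \<lambda>i\<in>K. \<epsilon> i \<omega>) T Z"
    and fin_J: "finite (J n)" and J_sub: "J n \<subseteq> K" and mono_J: "mono J"
begin

sublocale prob_space M by (rule prob_M)

definition chaos :: "('t \<Rightarrow> 'i set \<Rightarrow> real) \<Rightarrow> nat \<Rightarrow> 'w \<Rightarrow> real" where
  "chaos c n \<omega> = walsh_poly (c (Z \<omega>)) (J n) (neg_set \<epsilon> \<omega>)"

definition energy :: "('t \<Rightarrow> 'i set \<Rightarrow> real) \<Rightarrow> nat \<Rightarrow> 't \<Rightarrow> real" where
  "energy c n z = (\<Sum>A\<in>Pow (J n). (c z A)\<^sup>2)"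

lemma Z_measurable[measurable]: "Z \<in> measurable M T"
  using indep by (simp add: indep_elements_def)

lemma energy_measurable[measurable]:
  assumes [measurable]: "\<And>A. (\<lambda>z. c z A) \<in> borel_measurable T"
  shows "energy c n \<in> borel_measurable T"
  unfolding energy_def by measurable

lemma walsh_poly_measurable:
  assumes [measurable]: "\<And>A. (\<lambda>z. c z A) \<in> borel_measurable T"
  shows "(\<lambda>z. walsh_poly (c z) (J n) U) \<in> borel_measurable T"
  unfolding walsh_poly_def by measurable

lemma walsh_poly_neg_set_Int: "n \<le> N \<Longrightarrow> walsh_poly c (J n) (neg_set \<epsilon> \<omega> \<inter> J N) = walsh_poly c (J n) (neg_set \<epsilon> \<omega>)"
  using mono_J by (intro walsh_poly_Int) (auto dest: monoD)

lemma chaos_measurable[measurable]: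
  assumes c: "\<And>A. (\<lambda>z. c z A) \<in> borel_measurable T"
  shows "chaos c n \<in> borel_measurable M"
proof (rule borel_measurableI_le)
  fix y :: real
  note [measurable] = walsh_poly_measurable[OF c]
  have "{\<omega> \<in> space M. walsh_poly (c (Z \<omega>)) (J n) (neg_set \<epsilon> \<omega> \<inter> J n) \<le> y} \<in> sets M"
    by (rule emeasure_neg_set(1)[OF prob_M rademacher indep fin_J J_sub]) measurable
  then show "{\<omega> \<in> space M. chaos c n \<omega> \<le> y} \<in> sets M"
    by (simp add: chaos_def walsh_poly_neg_set_Int)
qed

text \<open>
  A conditional Paley-Zygmund inequality: the restriction \<open>R\<close> to an arbitrary event that depends
  on \<open>Z\<close> makes it possible to apply it at a random time determined by \<open>Z\<close>.
\<close>

lemma chaos_anticoncentration: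
  assumes c: "\<And>A. (\<lambda>z. c z A) \<in> borel_measurable T"
    and deg: "\<And>z A. finite A \<Longrightarrow> card A > d \<Longrightarrow> c z A = 0"
    and R: "{z\<in>space T. R z} \<in> sets T"
  shows "emeasure M {\<omega>\<in>space M. R (Z \<omega>)}
    \<le> ennreal (4 * 9 ^ d) * emeasure M {\<omega>\<in>space M. R (Z \<omega>) \<and> energy c n (Z \<omega>) / 2 \<le> (chaos c n \<omega>)\<^sup>2}"
proof -
  note [measurable] = walsh_poly_measurable[OF c] energy_measurable[OF c] R[unfolded pred_def[symmetric]]
  let ?Q = "\<lambda>U z. R z \<and> energy c n z / 2 \<le> (walsh_poly (c z) (J n) U)\<^sup>2"
  have "emeasure M {\<omega>\<in>space M. R (Z \<omega>) \<and> energy c n (Z \<omega>) / 2 \<le> (chaos c n \<omega>)\<^sup>2}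
      = emeasure M {\<omega>\<in>space M. ?Q (neg_set \<epsilon> \<omega> \<inter> J n) (Z \<omega>)}"
    by (simp add: chaos_def walsh_poly_neg_set_Int)
  also have "\<dots> = (\<integral>\<^sup>+\<omega>. ennreal (card {U\<in>Pow (J n). ?Q U (Z \<omega>)} / 2 ^ card (J n)) \<partial>M)"
    by (rule emeasure_neg_set(2)[OF prob_M rademacher indep fin_J J_sub]) measurable
  also have "\<dots> \<ge> (\<integral>\<^sup>+\<omega>. ennreal (1 / (4 * 9 ^ d)) * indicator {\<omega>\<in>space M. R (Z \<omega>)} \<omega> \<partial>M)"
  proof (intro nn_integral_mono)
    fix \<omega> assume w: "\<omega> \<in> space M"
    show "ennreal (1 / (4 * 9 ^ d)) * indicator {\<omega>\<in>space M. R (Z \<omega>)} \<omega>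
      \<le> ennreal (card {U\<in>Pow (J n). ?Q U (Z \<omega>)} / 2 ^ card (J n))"
    proof (cases "R (Z \<omega>)")
      case True
      have "2 ^ card (J n) / (4 * 9 ^ d) \<le> real (card {U \<in> Pow (J n).
          (\<Sum>A\<in>Pow (J n). (c (Z \<omega>) A)\<^sup>2) / 2 \<le> (walsh_poly (c (Z \<omega>)) (J n) U)\<^sup>2})"
        using fin_J by (intro walsh_Paley_Zygmund deg) (auto intro: finite_subset)
      then have "1 / (4 * 9 ^ d) \<le> real (card {U\<in>Pow (J n). ?Q U (Z \<omega>)}) / 2 ^ card (J n)"
        using True by (simp add: energy_def field_simps)
      then show ?thesis using True w by (simp add: ennreal_leI)
    qed simp
  qed
  finally have *: "ennreal (1 / (4 * 9 ^ d)) * emeasure M {\<omega>\<in>space M. R (Z \<omega>)}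
      \<le> emeasure M {\<omega>\<in>space M. R (Z \<omega>) \<and> energy c n (Z \<omega>) / 2 \<le> (chaos c n \<omega>)\<^sup>2}"
    by (subst (asm) nn_integral_cmult_indicator) simp_all
  have "ennreal (4 * 9 ^ d) * ennreal (1 / (4 * 9 ^ d)) = 1"
    by (subst ennreal_mult[symmetric]) simp_all
  then have "emeasure M {\<omega>\<in>space M. R (Z \<omega>)}
      = ennreal (4 * 9 ^ d) * (ennreal (1 / (4 * 9 ^ d)) * emeasure M {\<omega>\<in>space M. R (Z \<omega>)})"
    by (simp only: mult.assoc[symmetric] mult_1_left)
  also have "\<dots> \<le> ennreal (4 * 9 ^ d)
      * emeasure M {\<omega>\<in>space M. R (Z \<omega>) \<and> energy c n (Z \<omega>) / 2 \<le> (chaos c n \<omega>)\<^sup>2}"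
    by (intro mult_left_mono *) simp
  finally show ?thesis .
qed

text \<open>
  If the energy exceeds \<open>2 \<delta> (\<gamma> n)\<^sup>2\<close> for some \<open>n > N\<close>, consider the first such \<open>n\<close>. It depends on
  \<open>Z\<close> only, so that by anticoncentration the square of the chaos exceeds \<open>\<delta> (\<gamma> n)\<^sup>2\<close> at this
  very \<open>n\<close> with conditional probability at least \<open>1 / (4 * 9 ^ d)\<close>. The probability of the latter
  vanishes as \<open>N\<close> grows, hence so does that of the former.
\<close>

lemma chaos_convergence_imp_energy_convergence:
  assumes c: "\<And>A. (\<lambda>z. c z A) \<in> borel_measurable T"
    and deg: "\<And>z A. finite A \<Longrightarrow> card A > d \<Longrightarrow> c z A = 0"
    and \<gamma>: "\<And>n. n \<ge> 1 \<Longrightarrow> \<gamma> n > (0::real)"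
    and conv: "AE \<omega> in M. (\<lambda>n. 1 / \<gamma> n * chaos c n \<omega>) \<longlonglongrightarrow> 0"
  shows "AE \<omega> in M. (\<lambda>n. 1 / (\<gamma> n)\<^sup>2 * energy c n (Z \<omega>)) \<longlonglongrightarrow> 0"
proof -
  note [measurable] = energy_measurable[OF c] chaos_measurable[OF c]
  have main: "AE \<omega> in M. \<exists>N. \<forall>n\<ge>N. energy c n (Z \<omega>) < 2 * \<delta> * (\<gamma> n)\<^sup>2" if \<delta>: "\<delta> > 0" for \<delta> :: real
  proof -
    define G where "G N = {\<omega>\<in>space M. \<exists>n\<ge>Suc N. \<delta> * (\<gamma> n)\<^sup>2 \<le> (chaos c n \<omega>)\<^sup>2}" for N
    define H where "H N = {\<omega>\<in>space M. \<exists>n\<ge>Suc N. 2 * \<delta> * (\<gamma> n)\<^sup>2 \<le> energy c n (Z \<omega>)}" for N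
    have [measurable]: "G N \<in> sets M" "H N \<in> sets M" for N unfolding G_def H_def by measurable
    have HG: "emeasure M (H N) \<le> ennreal (4 * 9 ^ d) * emeasure M (G N)" for N
    proof -
      define R where "R k z \<longleftrightarrow> 2 * \<delta> * (\<gamma> (Suc N + k))\<^sup>2 \<le> energy c (Suc N + k) z
         \<and> (\<forall>m<k. energy c (Suc N + m) z < 2 * \<delta> * (\<gamma> (Suc N + m))\<^sup>2)" for k z
      define B where "B k = {\<omega>\<in>space M. R k (Z \<omega>)}" for k
      define D where "D k = {\<omega>\<in>space M. R k (Z \<omega>) \<and>
          energy c (Suc N + k) (Z \<omega>) / 2 \<le> (chaos c (Suc N + k) \<omega>)\<^sup>2}" for k
      have R[measurable]: "Measurable.pred T (R k)" for k unfolding R_def by measurable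
      have [measurable]: "B k \<in> sets M" "D k \<in> sets M" for k unfolding B_def D_def by measurable
      have uniq: "k = l" if "R k z" "R l z" for k l z
        using that unfolding R_def by (metis linorder_neqE_nat not_le)
      have disj: "disjoint_family B" "disjoint_family D"
        unfolding disjoint_family_on_def B_def D_def using uniq by auto
      have "H N \<subseteq> (\<Union>k. B k)"
      proof
        fix \<omega> assume w: "\<omega> \<in> H N"
        let ?P = "\<lambda>k. 2 * \<delta> * (\<gamma> (Suc N + k))\<^sup>2 \<le> energy c (Suc N + k) (Z \<omega>)"
        obtain n where n: "n \<ge> Suc N" "2 * \<delta> * (\<gamma> n)\<^sup>2 \<le> energy c n (Z \<omega>)"
          using w by (auto simp: H_def)
        then have "?P (n - Suc N)" by simp
        then have ex: "\<exists>k. ?P k" by (rule exI[of ?P])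
        have "R (LEAST k. ?P k) (Z \<omega>)"
          unfolding R_def
        proof (intro conjI allI impI)
          show "?P (LEAST k. ?P k)" by (rule LeastI_ex[of ?P, OF ex])
          fix m assume "m < (LEAST k. ?P k)"
          from not_less_Least[OF this]
          show "energy c (Suc N + m) (Z \<omega>) < 2 * \<delta> * (\<gamma> (Suc N + m))\<^sup>2" by simp
        qed
        then show "\<omega> \<in> (\<Union>k. B k)" using w unfolding B_def H_def by blast
      qed
      then have "emeasure M (H N) \<le> emeasure M (\<Union>k. B k)" by (intro emeasure_mono) auto
      also have "\<dots> = (\<Sum>k. emeasure M (B k))"
        by (rule suminf_emeasure[symmetric]) (use disj in auto)
      also have "\<dots> \<le> (\<Sum>k. ennreal (4 * 9 ^ d) * emeasure M (D k))"
      proof (intro suminf_le allI)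
        fix k
        show "emeasure M (B k) \<le> ennreal (4 * 9 ^ d) * emeasure M (D k)"
          unfolding B_def D_def
          by (rule chaos_anticoncentration[OF c deg]) (use R[of k] in \<open>auto simp: pred_def\<close>)
      qed auto
      also have "\<dots> = ennreal (4 * 9 ^ d) * emeasure M (\<Union>k. D k)"
        by (subst suminf_emeasure[symmetric]) (use disj in auto)
      also have "\<dots> \<le> ennreal (4 * 9 ^ d) * emeasure M (G N)"
      proof (intro mult_left_mono emeasure_mono)
        show "(\<Union>k. D k) \<subseteq> G N"
        proof safe
          fix \<omega> k assume w: "\<omega> \<in> D k"
          then have "\<delta> * (\<gamma> (Suc N + k))\<^sup>2 \<le> (chaos c (Suc N + k) \<omega>)\<^sup>2"
            unfolding D_def R_def by auto
          then show "\<omega> \<in> G N" using w unfolding G_def D_def by (auto intro!: exI[of _ "Suc N + k"])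
        qed
      qed auto
      finally show ?thesis .
    qed
    then have HG': "measure M (H N) \<le> 4 * 9 ^ d * measure M (G N)" for N
      using HG[of N] by (simp add: emeasure_eq_measure ennreal_mult'[symmetric])
    have "prob (\<Inter>N. G N) = 0"
    proof (rule prob_eq_0[THEN iffD2])
      show "(\<Inter>N. G N) \<in> sets M" by measurable
      show "AE \<omega> in M. \<omega> \<notin> (\<Inter>N. G N)"
        using conv
      proof eventually_elim
        fix \<omega> assume "(\<lambda>n. 1 / \<gamma> n * chaos c n \<omega>) \<longlonglongrightarrow> 0"
        then have "(\<lambda>n. (1 / \<gamma> n * chaos c n \<omega>)\<^sup>2) \<longlonglongrightarrow> 0\<^sup>2" by (intro tendsto_power)
        then have "\<forall>\<^sub>F n in sequentially. (1 / \<gamma> n * chaos c n \<omega>)\<^sup>2 < \<delta>"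
          using \<delta> by (intro order_tendstoD) auto
        then obtain N where N: "\<And>n. n \<ge> N \<Longrightarrow> (1 / \<gamma> n * chaos c n \<omega>)\<^sup>2 < \<delta>"
          by (auto simp: eventually_sequentially)
        have "\<omega> \<notin> G N"
        proof
          assume "\<omega> \<in> G N"
          then obtain n where n: "n \<ge> Suc N" "\<delta> * (\<gamma> n)\<^sup>2 \<le> (chaos c n \<omega>)\<^sup>2" by (auto simp: G_def)
          then have "\<gamma> n > 0" using \<gamma>[of n] by simp
          then have "\<delta> \<le> (1 / \<gamma> n * chaos c n \<omega>)\<^sup>2" using n by (simp add: power_divide field_simps)
          then show False using N[of n] n by simp
        qed
        then show "\<omega> \<notin> (\<Inter>N. G N)" by blast
      qed
    qed
    moreover have "(\<lambda>N. prob (G N)) \<longlonglongrightarrow> prob (\<Inter>N. G N)"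
      by (rule finite_Lim_measure_decseq) (auto simp: decseq_def G_def intro: Suc_leD order_trans)
    ultimately have lim: "(\<lambda>N. 4 * 9 ^ d * prob (G N)) \<longlonglongrightarrow> 4 * 9 ^ d * 0" by (intro tendsto_mult) auto
    have "prob (\<Inter>N. H N) \<le> 4 * 9 ^ d * prob (G N)" for N
    proof -
      have "prob (\<Inter>N. H N) \<le> prob (H N)" by (intro finite_measure_mono) auto
      then show ?thesis using HG'[of N] by linarith
    qed
    then have "prob (\<Inter>N. H N) \<le> 4 * 9 ^ d * 0"
      by (intro LIMSEQ_le_const[OF lim]) blast
    then have "prob (\<Inter>N. H N) = 0" by (intro antisym) simp_all
    then have "AE \<omega> in M. \<omega> \<notin> (\<Inter>N. H N)" by (subst (asm) prob_eq_0) auto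
    then show ?thesis
      using AE_space
    proof eventually_elim
      fix \<omega> assume "\<omega> \<notin> (\<Inter>N. H N)" "\<omega> \<in> space M"
      then obtain N where N: "\<not> (\<exists>n\<ge>Suc N. 2 * \<delta> * (\<gamma> n)\<^sup>2 \<le> energy c n (Z \<omega>))"
        by (auto simp: H_def)
      show "\<exists>N. \<forall>n\<ge>N. energy c n (Z \<omega>) < 2 * \<delta> * (\<gamma> n)\<^sup>2"
        by (rule exI[of _ "Suc N"]) (use N in \<open>meson not_le\<close>)
    qed
  qed
  have "AE \<omega> in M. \<forall>m. \<exists>N. \<forall>n\<ge>N. energy c n (Z \<omega>) < 2 * (1 / real (Suc m)) * (\<gamma> n)\<^sup>2"
    unfolding AE_all_countable by (intro allI main) simp
  then show ?thesis
  proof eventually_elim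
    fix \<omega> assume *: "\<forall>m. \<exists>N. \<forall>n\<ge>N. energy c n (Z \<omega>) < 2 * (1 / real (Suc m)) * (\<gamma> n)\<^sup>2"
    show "(\<lambda>n. 1 / (\<gamma> n)\<^sup>2 * energy c n (Z \<omega>)) \<longlonglongrightarrow> 0"
    proof (rule LIMSEQ_I)
      fix r :: real assume r: "r > 0"
      then obtain m where m: "2 / real (Suc m) < r"
        using reals_Archimedean[of "r / 2"] by (auto simp: field_simps)
      obtain N where N: "\<And>n. n \<ge> N \<Longrightarrow> energy c n (Z \<omega>) < 2 * (1 / real (Suc m)) * (\<gamma> n)\<^sup>2"
        using * by blast
      show "\<exists>N. \<forall>n\<ge>N. norm (1 / (\<gamma> n)\<^sup>2 * energy c n (Z \<omega>) - 0) < r"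
      proof (intro exI[of _ "Suc N"] allI impI)
        fix n assume n: "n \<ge> Suc N"
        then have g: "(\<gamma> n)\<^sup>2 > 0" using \<gamma>[of n] by simp
        have "energy c n (Z \<omega>) < 2 * (1 / real (Suc m)) * (\<gamma> n)\<^sup>2" using N n by simp
        also have "\<dots> < r * (\<gamma> n)\<^sup>2" using mult_strict_right_mono[OF m g] by simp
        finally have "energy c n (Z \<omega>) < r * (\<gamma> n)\<^sup>2" .
        moreover have "energy c n (Z \<omega>) \<ge> 0" by (simp add: energy_def sum_nonneg)
        ultimately show "norm (1 / (\<gamma> n)\<^sup>2 * energy c n (Z \<omega>) - 0) < r"
          using g by (simp add: field_simps)
      qed
    qed
  qed
qed

lemma chaos_maximal_inequality:
  assumes c: "\<And>A. (\<lambda>z. c z A) \<in> borel_measurable T" and t: "t > 0"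
  shows "emeasure M {\<omega>\<in>space M. \<exists>n\<le>N. t \<le> \<bar>chaos c n \<omega>\<bar>}
    \<le> (\<integral>\<^sup>+\<omega>. ennreal (energy c N (Z \<omega>) / t\<^sup>2) \<partial>M)"
proof -
  note [measurable] = walsh_poly_measurable[OF c]
  let ?Q = "\<lambda>U z. \<exists>n\<le>N. t \<le> \<bar>walsh_poly (c z) (J n) U\<bar>"
  have "{\<omega>\<in>space M. \<exists>n\<le>N. t \<le> \<bar>chaos c n \<omega>\<bar>} = {\<omega>\<in>space M. ?Q (neg_set \<epsilon> \<omega> \<inter> J N) (Z \<omega>)}"
    by (auto simp: chaos_def walsh_poly_neg_set_Int)
  then have "emeasure M {\<omega>\<in>space M. \<exists>n\<le>N. t \<le> \<bar>chaos c n \<omega>\<bar>}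
      = emeasure M {\<omega>\<in>space M. ?Q (neg_set \<epsilon> \<omega> \<inter> J N) (Z \<omega>)}" by simp
  also have "\<dots> = (\<integral>\<^sup>+\<omega>. ennreal (card {U\<in>Pow (J N). ?Q U (Z \<omega>)} / 2 ^ card (J N)) \<partial>M)"
    by (rule emeasure_neg_set(2)[OF prob_M rademacher indep fin_J J_sub]) measurable
  also have "\<dots> \<le> (\<integral>\<^sup>+\<omega>. ennreal (energy c N (Z \<omega>) / t\<^sup>2) \<partial>M)"
  proof (intro nn_integral_mono ennreal_leI)
    fix \<omega>
    have "t\<^sup>2 * real (card {U\<in>Pow (J N). ?Q U (Z \<omega>)}) \<le> 2 ^ card (J N) * energy c N (Z \<omega>)"
      unfolding energy_def using t by (intro walsh_maximal_inequality fin_J mono_J) simp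
    then show "card {U\<in>Pow (J N). ?Q U (Z \<omega>)} / 2 ^ card (J N) \<le> energy c N (Z \<omega>) / t\<^sup>2"
      using t by (simp add: field_simps)
  qed
  finally show ?thesis .
qed

text \<open>
  Borel-Cantelli along powers of two. The truncated coefficients \<open>c' k\<close> are used for the times up to
  \<open>2 ^ k\<close>, and the maximal inequality controls all these times at once; the doubling property
  absorbs the passage from \<open>n\<close> to the next power of two.
\<close>

lemma chaos_convergence_of_summable_energy:
  fixes C :: real
  assumes c: "\<And>A. (\<lambda>z. c z A) \<in> borel_measurable T"
    and c': "\<And>k A. (\<lambda>z. c' k z A) \<in> borel_measurable T"
    and \<gamma>: "\<And>n. n \<ge> 1 \<Longrightarrow> \<gamma> n > 0" "mono_on {1..} \<gamma>" "\<And>n. n \<ge> 1 \<Longrightarrow> \<gamma> (2 * n) \<le> C * \<gamma> n"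
    and sum: "(\<Sum>k. \<integral>\<^sup>+\<omega>. ennreal (energy (c' k) (2 ^ k) (Z \<omega>) / (\<gamma> (2 ^ k))\<^sup>2) \<partial>M) \<noteq> \<infinity>"
    and ev: "AE \<omega> in M. \<forall>\<^sub>F k in sequentially. \<forall>A\<subseteq>J (2 ^ k). c (Z \<omega>) A = c' k (Z \<omega>) A"
  shows "AE \<omega> in M. (\<lambda>n. 1 / \<gamma> n * chaos c n \<omega>) \<longlonglongrightarrow> 0"
proof -
  note [measurable] = chaos_measurable[OF c'] energy_measurable[OF c']
  have C: "C > 0" using \<gamma>(1)[of 1] \<gamma>(1)[of 2] \<gamma>(3)[of 1]
    by (simp add: zero_less_mult_iff) (smt (verit) mult_nonneg_nonneg mult_nonpos_nonneg)
  have main: "AE \<omega> in M. \<forall>\<^sub>F k in sequentially. \<forall>n\<le>2 ^ k. \<bar>chaos (c' k) n \<omega>\<bar> < \<delta> * \<gamma> (2 ^ k)"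
    if \<delta>: "\<delta> > 0" for \<delta>
  proof -
    define E where "E k = {\<omega>\<in>space M. \<exists>n\<le>2 ^ k. \<delta> * \<gamma> (2 ^ k) \<le> \<bar>chaos (c' k) n \<omega>\<bar>}" for k
    have [measurable]: "E k \<in> sets M" for k unfolding E_def by measurable
    have le: "ennreal (prob (E k)) \<le> ennreal (1 / \<delta>\<^sup>2) *
        (\<integral>\<^sup>+\<omega>. ennreal (energy (c' k) (2 ^ k) (Z \<omega>) / (\<gamma> (2 ^ k))\<^sup>2) \<partial>M)" for k
    proof -
      have "ennreal (prob (E k)) \<le> (\<integral>\<^sup>+\<omega>. ennreal (energy (c' k) (2 ^ k) (Z \<omega>) / (\<delta> * \<gamma> (2 ^ k))\<^sup>2) \<partial>M)"
        unfolding E_def emeasure_eq_measure[symmetric]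
        by (rule chaos_maximal_inequality[OF c']) (use \<delta> \<gamma>(1) in simp)
      also have "\<dots> = (\<integral>\<^sup>+\<omega>. ennreal (1 / \<delta>\<^sup>2) * ennreal (energy (c' k) (2 ^ k) (Z \<omega>) / (\<gamma> (2 ^ k))\<^sup>2) \<partial>M)"
        by (intro nn_integral_cong) (simp add: ennreal_mult'[symmetric] power_mult_distrib)
      also have "\<dots> = ennreal (1 / \<delta>\<^sup>2) *
        (\<integral>\<^sup>+\<omega>. ennreal (energy (c' k) (2 ^ k) (Z \<omega>) / (\<gamma> (2 ^ k))\<^sup>2) \<partial>M)"
        by (rule nn_integral_cmult) measurable
      finally show ?thesis .
    qed
    have "(\<Sum>k. ennreal (prob (E k))) \<le> (\<Sum>k. ennreal (1 / \<delta>\<^sup>2) *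
        (\<integral>\<^sup>+\<omega>. ennreal (energy (c' k) (2 ^ k) (Z \<omega>) / (\<gamma> (2 ^ k))\<^sup>2) \<partial>M))"
      by (intro suminf_le allI le) auto
    also have "\<dots> < \<top>"
      using sum by (simp add: ennreal_mult_less_top less_top)
    finally have "summable (\<lambda>k. prob (E k))"
      by (intro summable_suminf_not_top) auto
    then have "AE \<omega> in M. \<forall>\<^sub>F k in sequentially. \<omega> \<in> space M - E k"
      by (intro borel_cantelli_AE1) (auto simp: emeasure_eq_measure)
    then show ?thesis
    proof eventually_elim
      fix \<omega> assume "\<forall>\<^sub>F k in sequentially. \<omega> \<in> space M - E k"
      then show "\<forall>\<^sub>F k in sequentially. \<forall>n\<le>2 ^ k. \<bar>chaos (c' k) n \<omega>\<bar> < \<delta> * \<gamma> (2 ^ k)"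
        by eventually_elim (auto simp: E_def not_le[symmetric])
    qed
  qed
  have "AE \<omega> in M. \<forall>m. \<forall>\<^sub>F k in sequentially. \<forall>n\<le>2 ^ k. \<bar>chaos (c' k) n \<omega>\<bar> < 1 / real (Suc m) * \<gamma> (2 ^ k)"
    unfolding AE_all_countable by (intro allI main) simp
  with ev show ?thesis
  proof eventually_elim
    fix \<omega> assume eq: "\<forall>\<^sub>F k in sequentially. \<forall>A\<subseteq>J (2 ^ k). c (Z \<omega>) A = c' k (Z \<omega>) A"
      and *: "\<forall>m. \<forall>\<^sub>F k in sequentially. \<forall>n\<le>2 ^ k. \<bar>chaos (c' k) n \<omega>\<bar> < 1 / real (Suc m) * \<gamma> (2 ^ k)"
    show "(\<lambda>n. 1 / \<gamma> n * chaos c n \<omega>) \<longlonglongrightarrow> 0"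
    proof (rule LIMSEQ_I)
      fix r :: real assume r: "r > 0"
      then obtain m where m: "1 / real (Suc m) * C < r"
        using reals_Archimedean[of "r / C"] C by (auto simp: field_simps)
      from eq *[rule_format, of m]
      have "\<forall>\<^sub>F k in sequentially. \<forall>n\<le>2 ^ k. \<bar>chaos c n \<omega>\<bar> < 1 / real (Suc m) * \<gamma> (2 ^ k)"
      proof eventually_elim
        fix k assume eq: "\<forall>A\<subseteq>J (2 ^ k). c (Z \<omega>) A = c' k (Z \<omega>) A"
          and *: "\<forall>n\<le>2 ^ k. \<bar>chaos (c' k) n \<omega>\<bar> < 1 / real (Suc m) * \<gamma> (2 ^ k)"
        have "chaos c n \<omega> = chaos (c' k) n \<omega>" if "n \<le> 2 ^ k" for n
          unfolding chaos_def walsh_poly_def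
        proof (intro sum.cong refl)
          fix A assume "A \<in> Pow (J n)"
          then have "A \<subseteq> J (2 ^ k)" using monoD[OF mono_J that] by auto
          then show "c (Z \<omega>) A * walsh A (neg_set \<epsilon> \<omega>) = c' k (Z \<omega>) A * walsh A (neg_set \<epsilon> \<omega>)"
            using eq by simp
        qed
        then show "\<forall>n\<le>2 ^ k. \<bar>chaos c n \<omega>\<bar> < 1 / real (Suc m) * \<gamma> (2 ^ k)" using * by simp
      qed
      then obtain k0 where k0: "\<And>k n. k \<ge> k0 \<Longrightarrow> n \<le> 2 ^ k \<Longrightarrow> \<bar>chaos c n \<omega>\<bar> < 1 / real (Suc m) * \<gamma> (2 ^ k)"
        by (auto simp: eventually_sequentially)
      show "\<exists>N. \<forall>n\<ge>N. norm (1 / \<gamma> n * chaos c n \<omega> - 0) < r"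
      proof (intro exI[of _ "2 ^ k0 + 1"] allI impI)
        fix n :: nat assume n: "n \<ge> 2 ^ k0 + 1"
        then have "n \<ge> 2" using one_le_power[of "2::nat" k0] by linarith
        then obtain k where k: "2 ^ k < n" "n \<le> 2 ^ (k + 1)" using ex_power_ivl2[of 2 n] by auto
        have g: "\<gamma> n > 0" using \<gamma>(1) \<open>n \<ge> 2\<close> by simp
        have "(2::nat) ^ k0 < 2 ^ (k + 1)" using n k by linarith
        then have "k0 < k + 1" by (rule power_less_imp_less_exp[rotated]) simp
        then have "k0 \<le> k + 1" by simp
        then have "\<bar>chaos c n \<omega>\<bar> < 1 / real (Suc m) * \<gamma> (2 ^ (k + 1))" using k0 k by blast
        also have "\<dots> \<le> 1 / real (Suc m) * (C * \<gamma> (2 ^ k))"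
          using \<gamma>(3)[of "2 ^ k"] by (intro mult_left_mono) auto
        also have "\<dots> \<le> 1 / real (Suc m) * (C * \<gamma> n)"
          using C k by (intro mult_left_mono mono_onD[OF \<gamma>(2)]) auto
        also have "\<dots> < r * \<gamma> n" using mult_strict_right_mono[OF m g] by (simp add: mult.assoc)
        finally show "norm (1 / \<gamma> n * chaos c n \<omega> - 0) < r"
          using g by (simp add: abs_mult field_simps)
      qed
    qed
  qed
qed

end

section \<open>Second moments of decoupled sums\<close>

lemma product_sigma_finite_const: "prob_space \<mu> \<Longrightarrow> product_sigma_finite (\<lambda>_. \<mu>)"
  by (simp add: product_sigma_finite_def prob_space_imp_sigma_finite)

lemma measurable_reindex:
  "t \<in> I \<rightarrow> K \<Longrightarrow> (\<lambda>y. \<lambda>k\<in>I. y (t k)) \<in> measurable (PiM K (\<lambda>_. \<mu>)) (PiM I (\<lambda>_. \<mu>))"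
  by (intro measurable_restrict measurable_component_singleton) auto

lemma nn_integral_PiM_reindex:
  assumes "prob_space \<mu>" "inj_on t I" "t \<in> I \<rightarrow> K" "G \<in> borel_measurable (PiM I (\<lambda>_. \<mu>))"
  shows "(\<integral>\<^sup>+y. G (\<lambda>k\<in>I. y (t k)) \<partial>PiM K (\<lambda>_. \<mu>)) = (\<integral>\<^sup>+u. G u \<partial>PiM I (\<lambda>_. \<mu>))"
proof -
  have "distr (PiM K (\<lambda>_. \<mu>)) (PiM I (\<lambda>_. \<mu>)) (\<lambda>y. \<lambda>k\<in>I. y (t k)) = PiM I (\<lambda>_. \<mu>)"
    using distr_PiM_reindex[of K "\<lambda>_. \<mu>" t I] assms by simp
  then show ?thesis
    using nn_integral_distr[OF measurable_reindex[OF assms(3)], of G] assms(4) by metis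
qed

lemma merge_measurable_swap:
  assumes "D \<subseteq> I"
  shows "(\<lambda>(x, u). merge D (I - D) (u, x))
    \<in> measurable (PiM I (\<lambda>_. \<mu>) \<Otimes>\<^sub>M PiM D (\<lambda>_. \<mu>)) (PiM I (\<lambda>_. \<mu>))"
proof -
  have eq: "(\<lambda>(x, u). merge D (I - D) (u, x)) = (\<lambda>(x, u). \<lambda>k\<in>I. if k \<in> D then u k else x k)"
    using assms by (auto simp: merge_def fun_eq_iff)
  have "(\<lambda>p. if k \<in> D then snd p k else fst p k)
      \<in> measurable (PiM I (\<lambda>_. \<mu>) \<Otimes>\<^sub>M PiM D (\<lambda>_. \<mu>)) \<mu>" if "k \<in> I" for k
    using that by (cases "k \<in> D") auto
  then show ?thesis unfolding eq split_beta by (intro measurable_restrict) auto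
qed

lemma partial_integral_measurable:
  assumes "prob_space \<mu>" "D \<subseteq> I" "f \<in> borel_measurable (PiM I (\<lambda>_. \<mu>))"
  shows "(\<lambda>x. \<integral>\<^sup>+u. f (merge D (I - D) (u, x)) \<partial>PiM D (\<lambda>_. \<mu>)) \<in> borel_measurable (PiM I (\<lambda>_. \<mu>))"
proof -
  interpret D: prob_space "PiM D (\<lambda>_. \<mu>)" using assms by (intro prob_space_PiM)
  show ?thesis
    using measurable_compose[OF merge_measurable_swap[OF assms(2)] assms(3)]
    by (intro D.borel_measurable_nn_integral) (simp add: split_beta')
qed

lemma section_measurable:
  assumes "prob_space \<mu>" "D \<subseteq> I" "f \<in> borel_measurable (PiM I (\<lambda>_. \<mu>))" "x \<in> space (PiM I (\<lambda>_. \<mu>))"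
  shows "(\<lambda>u. f (merge D (I - D) (u, x))) \<in> borel_measurable (PiM D (\<lambda>_. \<mu>))"
proof -
  have "(\<lambda>u. (case (x, u) of (x, u) \<Rightarrow> merge D (I - D) (u, x))) \<in> measurable (PiM D (\<lambda>_. \<mu>)) (PiM I (\<lambda>_. \<mu>))"
    by (rule measurable_compose[OF measurable_Pair1'[OF assms(4)] merge_measurable_swap[OF assms(2)]])
  from measurable_compose[OF this assms(3)] show ?thesis by simp
qed

text \<open>
  The two tuples share the variables \<open>(k, i k)\<close> with \<open>k \<notin> D\<close>, and the remaining variables
  \<open>(k, j k)\<close>, \<open>k \<in> D\<close>, of the second one are independent of the first tuple.
\<close>

lemma nn_integral_product_of_samples:
  fixes f :: "('k \<Rightarrow> 'a) \<Rightarrow> ennreal" and N :: "'n set"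
  assumes \<mu>: "prob_space \<mu>" and fin: "finite I" "finite N"
    and f: "f \<in> borel_measurable (PiM I (\<lambda>_. \<mu>))"
    and i: "i \<in> I \<rightarrow>\<^sub>E N" and j: "j \<in> I \<rightarrow>\<^sub>E N" and D: "D = {k\<in>I. i k \<noteq> j k}"
  shows "(\<integral>\<^sup>+y. f (\<lambda>k\<in>I. y (k, i k)) * f (\<lambda>k\<in>I. y (k, j k)) \<partial>PiM (I \<times> N) (\<lambda>_. \<mu>))
    = (\<integral>\<^sup>+x. f x * (\<integral>\<^sup>+u. f (merge D (I - D) (u, x)) \<partial>PiM D (\<lambda>_. \<mu>)) \<partial>PiM I (\<lambda>_. \<mu>))"
proof -
  interpret product_sigma_finite "\<lambda>_ :: 'k \<times> 'n. \<mu>" by (rule product_sigma_finite_const[OF \<mu>])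
  define \<Phi> where "\<Phi> x = f x * (\<integral>\<^sup>+u. f (merge D (I - D) (u, x)) \<partial>PiM D (\<lambda>_. \<mu>))" for x
  define K1 where "K1 = (\<lambda>k. (k, i k)) ` I"
  define K2 where "K2 = I \<times> N - K1"
  have K: "I \<times> N = K1 \<union> K2" "K1 \<inter> K2 = {}" "finite K1" "finite K2"
    using fin i by (auto simp: K1_def K2_def)
  have D_sub: "D \<subseteq> I" using D by auto
  have t: "(\<lambda>k. (k, i k)) \<in> I \<rightarrow> I \<times> N" "(\<lambda>k. (k, j k)) \<in> I \<rightarrow> I \<times> N" using i j by auto
  have [measurable]: "\<Phi> \<in> borel_measurable (PiM I (\<lambda>_. \<mu>))"
    unfolding \<Phi>_def using f partial_integral_measurable[OF \<mu> D_sub f] by measurable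
  let ?F = "\<lambda>y. f (\<lambda>k\<in>I. y (k, i k)) * f (\<lambda>k\<in>I. y (k, j k))"
  have F: "?F \<in> borel_measurable (PiM (I \<times> N) (\<lambda>_. \<mu>))"
    by (intro borel_measurable_times_ennreal measurable_compose[OF measurable_reindex f] t)
  have "(\<integral>\<^sup>+y. ?F y \<partial>PiM (I \<times> N) (\<lambda>_. \<mu>))
    = (\<integral>\<^sup>+x1. (\<integral>\<^sup>+x2. ?F (merge K1 K2 (x1, x2)) \<partial>PiM K2 (\<lambda>_. \<mu>)) \<partial>PiM K1 (\<lambda>_. \<mu>))"
    using F unfolding K(1) by (rule product_nn_integral_fold[OF K(2-4)])
  also have "\<dots> = (\<integral>\<^sup>+x1. \<Phi> (\<lambda>k\<in>I. x1 (k, i k)) \<partial>PiM K1 (\<lambda>_. \<mu>))"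
  proof (rule nn_integral_cong)
    fix x1 assume x1: "x1 \<in> space (PiM K1 (\<lambda>_. \<mu>))"
    define a where "a = (\<lambda>k\<in>I. x1 (k, i k))"
    have a: "a \<in> space (PiM I (\<lambda>_. \<mu>))"
      using x1 by (auto simp: a_def space_PiM K1_def)
    define g where "g u = f (merge D (I - D) (u, a))" for u
    have g: "g \<in> borel_measurable (PiM D (\<lambda>_. \<mu>))"
      unfolding g_def by (rule section_measurable[OF \<mu> D_sub f a])
    have tj: "(\<lambda>k. (k, j k)) \<in> D \<rightarrow> K2" using j D by (auto simp: K2_def K1_def)
    have "?F (merge K1 K2 (x1, x2)) = f a * g (\<lambda>k\<in>D. x2 (k, j k))" for x2
    proof -
      have "(\<lambda>k\<in>I. merge K1 K2 (x1, x2) (k, i k)) = a"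
        unfolding a_def by (intro restrict_ext) (simp add: merge_def K1_def)
      moreover have "(\<lambda>k\<in>I. merge K1 K2 (x1, x2) (k, j k)) = merge D (I - D) (\<lambda>k\<in>D. x2 (k, j k), a)"
      proof
        fix k
        consider "k \<in> D" | "k \<in> I - D" | "k \<notin> I" using D_sub by auto
        then show "(\<lambda>k\<in>I. merge K1 K2 (x1, x2) (k, j k)) k = merge D (I - D) (\<lambda>k\<in>D. x2 (k, j k), a) k"
        proof cases
          case 1
          then have "(k, j k) \<in> K2" using tj by auto
          then show ?thesis using 1 D_sub K(2) by (auto simp: merge_def)
        next
          case 2
          then have "j k = i k" "(k, i k) \<in> K1" by (auto simp: D K1_def)
          then show ?thesis using 2 by (auto simp: merge_def a_def)
        next
          case 3
          then show ?thesis using D_sub by (auto simp: merge_def)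
        qed
      qed
      ultimately show ?thesis by (simp add: g_def)
    qed
    then have "(\<integral>\<^sup>+x2. ?F (merge K1 K2 (x1, x2)) \<partial>PiM K2 (\<lambda>_. \<mu>))
      = (\<integral>\<^sup>+x2. f a * g (\<lambda>k\<in>D. x2 (k, j k)) \<partial>PiM K2 (\<lambda>_. \<mu>))" by simp
    also have "\<dots> = f a * (\<integral>\<^sup>+x2. g (\<lambda>k\<in>D. x2 (k, j k)) \<partial>PiM K2 (\<lambda>_. \<mu>))"
      by (rule nn_integral_cmult) (rule measurable_compose[OF measurable_reindex[OF tj] g])
    also have "(\<integral>\<^sup>+x2. g (\<lambda>k\<in>D. x2 (k, j k)) \<partial>PiM K2 (\<lambda>_. \<mu>)) = (\<integral>\<^sup>+u. g u \<partial>PiM D (\<lambda>_. \<mu>))"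
      by (rule nn_integral_PiM_reindex[OF \<mu> _ tj g]) (simp add: inj_on_def)
    finally show "(\<integral>\<^sup>+x2. ?F (merge K1 K2 (x1, x2)) \<partial>PiM K2 (\<lambda>_. \<mu>)) = \<Phi> (\<lambda>k\<in>I. x1 (k, i k))"
      unfolding \<Phi>_def g_def a_def .
  qed
  also have "\<dots> = (\<integral>\<^sup>+x. \<Phi> x \<partial>PiM I (\<lambda>_. \<mu>))"
    by (rule nn_integral_PiM_reindex[OF \<mu>]) (auto simp: inj_on_def K1_def)
  finally show ?thesis unfolding \<Phi>_def .
qed

definition sample_sum :: "'k set \<Rightarrow> nat \<Rightarrow> (('k \<Rightarrow> 'a) \<Rightarrow> ennreal) \<Rightarrow> ('k \<times> nat \<Rightarrow> 'a) \<Rightarrow> ennreal" where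
  "sample_sum I n f y = (\<Sum>i\<in>I \<rightarrow>\<^sub>E {1..n}. f (\<lambda>k\<in>I. y (k, i k)))"

lemma sample_measurable:
  assumes "i \<in> I \<rightarrow>\<^sub>E N"
  shows "(\<lambda>y. \<lambda>k\<in>I. y (k, i k)) \<in> measurable (PiM (I \<times> N) (\<lambda>_. \<mu>)) (PiM I (\<lambda>_. \<mu>))"
  using assms by (intro measurable_reindex) auto

lemma sample_sum_measurable:
  assumes "f \<in> borel_measurable (PiM I (\<lambda>_. \<mu>))"
  shows "sample_sum I n f \<in> borel_measurable (PiM (I \<times> {1..n}) (\<lambda>_. \<mu>))"
  unfolding sample_sum_def
  by (intro borel_measurable_sum measurable_compose[OF sample_measurable assms]) auto

lemma card_agreement_classes:
  assumes "finite I" "D \<subseteq> I"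
  shows "card {j \<in> I \<rightarrow>\<^sub>E {1..n::nat}. {k\<in>I. i k \<noteq> j k} = D} \<le> n ^ card D"
proof -
  have "card {j \<in> I \<rightarrow>\<^sub>E {1..n}. {k\<in>I. i k \<noteq> j k} = D} \<le> card (D \<rightarrow>\<^sub>E {1..n})"
  proof (rule card_inj_on_le)
    show "inj_on (\<lambda>j. restrict j D) {j \<in> I \<rightarrow>\<^sub>E {1..n}. {k\<in>I. i k \<noteq> j k} = D}"
    proof (rule inj_onI)
      fix j j' assume *: "j \<in> {j \<in> I \<rightarrow>\<^sub>E {1..n}. {k\<in>I. i k \<noteq> j k} = D}"
        "j' \<in> {j \<in> I \<rightarrow>\<^sub>E {1..n}. {k\<in>I. i k \<noteq> j k} = D}" "restrict j D = restrict j' D"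
      show "j = j'"
      proof (rule PiE_ext[of _ I])
        show "j \<in> I \<rightarrow>\<^sub>E {1..n}" "j' \<in> I \<rightarrow>\<^sub>E {1..n}" using * by auto
        fix k assume "k \<in> I"
        then show "j k = j' k"
          using * by (cases "k \<in> D") (auto dest!: fun_cong[of _ _ k])
      qed
    qed
    show "(\<lambda>j. restrict j D) ` {j \<in> I \<rightarrow>\<^sub>E {1..n}. {k\<in>I. i k \<noteq> j k} = D} \<subseteq> D \<rightarrow>\<^sub>E {1..n}"
      using assms by (auto simp: PiE_iff)
    show "finite (D \<rightarrow>\<^sub>E {1..n})" using assms by (intro finite_PiE) (auto intro: finite_subset)
  qed
  also have "\<dots> = n ^ card D" using assms finite_subset[of D I] by (simp add: card_PiE)
  finally show ?thesis .
qed

lemma sample_sum_first_moment: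
  assumes \<mu>: "prob_space \<mu>" and fin: "finite I" and f: "f \<in> borel_measurable (PiM I (\<lambda>_. \<mu>))"
  shows "(\<integral>\<^sup>+y. sample_sum I n f y \<partial>PiM (I \<times> {1..n}) (\<lambda>_. \<mu>)) = of_nat (n ^ card I) * (\<integral>\<^sup>+x. f x \<partial>PiM I (\<lambda>_. \<mu>))"
proof -
  have "(\<integral>\<^sup>+y. sample_sum I n f y \<partial>PiM (I \<times> {1..n}) (\<lambda>_. \<mu>))
    = (\<Sum>i\<in>I \<rightarrow>\<^sub>E {1..n}. \<integral>\<^sup>+y. f (\<lambda>k\<in>I. y (k, i k)) \<partial>PiM (I \<times> {1..n}) (\<lambda>_. \<mu>))"
    unfolding sample_sum_def
    by (intro nn_integral_sum measurable_compose[OF sample_measurable f]) auto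
  also have "\<dots> = (\<Sum>i\<in>I \<rightarrow>\<^sub>E {1..n}. \<integral>\<^sup>+x. f x \<partial>PiM I (\<lambda>_. \<mu>))"
    by (intro sum.cong refl nn_integral_PiM_reindex[OF \<mu> _ _ f]) (auto simp: inj_on_def)
  finally show ?thesis using fin by (simp add: card_PiE)
qed

text \<open>
  Sort the pairs of multiindices by the set \<open>D\<close> of coordinates in which they differ. For
  \<open>D = I\<close> the tuples are independent, which gives \<open>m\<^sup>2\<close>; for each of the other sets the
  bound on the partial integrals leaves \<open>a * m\<close>.
\<close>

lemma sample_sum_second_moment:
  assumes \<mu>: "prob_space \<mu>" and fin: "finite I" and f: "f \<in> borel_measurable (PiM I (\<lambda>_. \<mu>))"
    and bound: "\<And>D x. D \<subset> I \<Longrightarrow> x \<in> space (PiM I (\<lambda>_. \<mu>)) \<Longrightarrow> f x \<noteq> 0 \<Longrightarrow>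
      of_nat (n ^ card D) * (\<integral>\<^sup>+u. f (merge D (I - D) (u, x)) \<partial>PiM D (\<lambda>_. \<mu>)) \<le> a"
    and m: "m = of_nat (n ^ card I) * (\<integral>\<^sup>+x. f x \<partial>PiM I (\<lambda>_. \<mu>))"
  shows "(\<integral>\<^sup>+y. (sample_sum I n f y)\<^sup>2 \<partial>PiM (I \<times> {1..n}) (\<lambda>_. \<mu>)) \<le> m\<^sup>2 + of_nat (2 ^ card I) * (a * m)"
proof -
  let ?C = "I \<rightarrow>\<^sub>E {1..n}"
  let ?P = "PiM (I \<times> {1..n}) (\<lambda>_. \<mu>)"
  let ?Q = "PiM I (\<lambda>_. \<mu>)"
  define q where "q D = (\<integral>\<^sup>+x. f x * (\<integral>\<^sup>+u. f (merge D (I - D) (u, x)) \<partial>PiM D (\<lambda>_. \<mu>)) \<partial>?Q)" for D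
  define m1 where "m1 = (\<integral>\<^sup>+x. f x \<partial>?Q)"
  have C: "finite ?C" using fin by (intro finite_PiE) auto
  note part = partial_integral_measurable[OF \<mu> _ f]
  \<comment> \<open>Sets \<open>D\<close> smaller than \<open>I\<close>: the partial integral is at most \<open>a\<close> wherever \<open>f\<close> does not vanish.\<close>
  have q_proper: "of_nat (n ^ card D) * q D \<le> a * m1" if D: "D \<subset> I" for D
  proof -
    have "of_nat (n ^ card D) * q D = (\<integral>\<^sup>+x. of_nat (n ^ card D) *
        (f x * (\<integral>\<^sup>+u. f (merge D (I - D) (u, x)) \<partial>PiM D (\<lambda>_. \<mu>))) \<partial>?Q)"
      unfolding q_def using f part[of D] D by (intro nn_integral_cmult[symmetric] borel_measurable_times_ennreal) auto
    also have "\<dots> \<le> (\<integral>\<^sup>+x. a * f x \<partial>?Q)"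
    proof (rule nn_integral_mono)
      fix x assume x: "x \<in> space ?Q"
      show "of_nat (n ^ card D) * (f x * (\<integral>\<^sup>+u. f (merge D (I - D) (u, x)) \<partial>PiM D (\<lambda>_. \<mu>))) \<le> a * f x"
      proof (cases "f x = 0")
        case False
        have "of_nat (n ^ card D) * (f x * (\<integral>\<^sup>+u. f (merge D (I - D) (u, x)) \<partial>PiM D (\<lambda>_. \<mu>)))
          = f x * (of_nat (n ^ card D) * (\<integral>\<^sup>+u. f (merge D (I - D) (u, x)) \<partial>PiM D (\<lambda>_. \<mu>)))"
          by (simp only: mult_ac)
        also have "\<dots> \<le> f x * a" using bound[OF D x False] by (intro mult_left_mono) auto
        finally show ?thesis by (simp add: mult.commute)
      qed simp
    qed
    also have "\<dots> = a * m1" unfolding m1_def by (rule nn_integral_cmult[OF f])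
    finally show ?thesis .
  qed
  have q_full: "q I = m1\<^sup>2"
  proof -
    have "q I = (\<integral>\<^sup>+x. f x * m1 \<partial>?Q)"
      unfolding q_def
    proof (intro nn_integral_cong)
      fix x
      have "(\<integral>\<^sup>+u. f (merge I (I - I) (u, x)) \<partial>?Q) = m1"
        unfolding m1_def
        by (intro nn_integral_cong arg_cong[where f = f]) (auto simp: merge_def space_PiM PiE_def extensional_def fun_eq_iff)
      then show "f x * (\<integral>\<^sup>+u. f (merge I (I - I) (u, x)) \<partial>?Q) = f x * m1" by simp
    qed
    also have "\<dots> = m1 * m1" unfolding m1_def[symmetric]
      using nn_integral_multc[OF f, of m1] by (simp add: m1_def)
    finally show ?thesis by (simp add: power2_eq_square)
  qed
  have "(\<integral>\<^sup>+y. (sample_sum I n f y)\<^sup>2 \<partial>?P)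
    = (\<integral>\<^sup>+y. (\<Sum>i\<in>?C. \<Sum>j\<in>?C. f (\<lambda>k\<in>I. y (k, i k)) * f (\<lambda>k\<in>I. y (k, j k))) \<partial>?P)"
    by (simp add: sample_sum_def power2_eq_square sum_product)
  also have "\<dots> = (\<Sum>i\<in>?C. \<Sum>j\<in>?C. \<integral>\<^sup>+y. f (\<lambda>k\<in>I. y (k, i k)) * f (\<lambda>k\<in>I. y (k, j k)) \<partial>?P)"
  proof -
    have meas: "(\<lambda>y. f (\<lambda>k\<in>I. y (k, i k)) * f (\<lambda>k\<in>I. y (k, j k))) \<in> borel_measurable ?P"
      if "i \<in> ?C" "j \<in> ?C" for i j
      using that by (intro borel_measurable_times_ennreal measurable_compose[OF sample_measurable f])
    have "(\<integral>\<^sup>+y. (\<Sum>i\<in>?C. \<Sum>j\<in>?C. f (\<lambda>k\<in>I. y (k, i k)) * f (\<lambda>k\<in>I. y (k, j k))) \<partial>?P)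
      = (\<Sum>i\<in>?C. \<integral>\<^sup>+y. (\<Sum>j\<in>?C. f (\<lambda>k\<in>I. y (k, i k)) * f (\<lambda>k\<in>I. y (k, j k))) \<partial>?P)"
      by (intro nn_integral_sum borel_measurable_sum meas)
    also have "\<dots> = (\<Sum>i\<in>?C. \<Sum>j\<in>?C. \<integral>\<^sup>+y. f (\<lambda>k\<in>I. y (k, i k)) * f (\<lambda>k\<in>I. y (k, j k)) \<partial>?P)"
      by (intro sum.cong refl nn_integral_sum meas)
    finally show ?thesis .
  qed
  also have "\<dots> = (\<Sum>i\<in>?C. \<Sum>j\<in>?C. q {k\<in>I. i k \<noteq> j k})"
    unfolding q_def
    by (intro sum.cong refl nn_integral_product_of_samples[OF \<mu> fin _ f]) auto
  also have "\<dots> \<le> (\<Sum>i\<in>?C. \<Sum>D\<in>Pow I. of_nat (n ^ card D) * q D)"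
  proof (intro sum_mono)
    fix i assume "i \<in> ?C"
    have "(\<Sum>j\<in>?C. q {k\<in>I. i k \<noteq> j k})
      = (\<Sum>D\<in>Pow I. \<Sum>j\<in>{j\<in>?C. {k\<in>I. i k \<noteq> j k} = D}. q {k\<in>I. i k \<noteq> j k})"
      by (rule sum.group[symmetric]) (use C fin in auto)
    also have "\<dots> = (\<Sum>D\<in>Pow I. of_nat (card {j\<in>?C. {k\<in>I. i k \<noteq> j k} = D}) * q D)"
      by (intro sum.cong refl) simp
    also have "\<dots> \<le> (\<Sum>D\<in>Pow I. of_nat (n ^ card D) * q D)"
      using fin by (intro sum_mono mult_right_mono of_nat_mono card_agreement_classes) auto
    finally show "(\<Sum>j\<in>?C. q {k\<in>I. i k \<noteq> j k}) \<le> (\<Sum>D\<in>Pow I. of_nat (n ^ card D) * q D)" .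
  qed
  also have "\<dots> \<le> (\<Sum>i\<in>?C. of_nat (n ^ card I) * m1\<^sup>2 + of_nat (2 ^ card I) * (a * m1))"
  proof (intro sum_mono)
    fix i
    have "(\<Sum>D\<in>Pow I. of_nat (n ^ card D) * q D)
      = of_nat (n ^ card I) * q I + (\<Sum>D\<in>Pow I - {I}. of_nat (n ^ card D) * q D)"
      using fin by (intro sum.remove) auto
    also have "\<dots> \<le> of_nat (n ^ card I) * m1\<^sup>2 + (\<Sum>D\<in>Pow I - {I}. a * m1)"
      unfolding q_full by (intro add_left_mono sum_mono q_proper) auto
    also have "\<dots> \<le> of_nat (n ^ card I) * m1\<^sup>2 + (\<Sum>D\<in>Pow I. a * m1)"
      using fin by (intro add_left_mono sum_mono2) auto
    finally show "(\<Sum>D\<in>Pow I. of_nat (n ^ card D) * q D)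
      \<le> of_nat (n ^ card I) * m1\<^sup>2 + of_nat (2 ^ card I) * (a * m1)"
      using fin by (simp add: card_Pow)
  qed
  also have "\<dots> = m\<^sup>2 + of_nat (2 ^ card I) * (a * m)"
    using fin by (simp add: card_PiE m m1_def[symmetric] power2_eq_square distrib_left mult_ac)
  finally show ?thesis .
qed

text \<open>
  The usual argument: the part of the mean where \<open>S\<close> is below \<open>m / 2\<close> is at most \<open>m / 2\<close>, and
  Cauchy-Schwarz bounds the rest.
\<close>

lemma Paley_Zygmund_nn_integral:
  assumes "prob_space N" and S[measurable]: "S \<in> borel_measurable N"
    and m: "(\<integral>\<^sup>+y. S y \<partial>N) = m" "m \<noteq> \<infinity>"
    and b: "(\<integral>\<^sup>+y. (S y)\<^sup>2 \<partial>N) \<le> b"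
  shows "m\<^sup>2 \<le> 4 * (b * emeasure N {y\<in>space N. m < 2 * S y})"
proof -
  interpret prob_space N by fact
  let ?G = "{y\<in>space N. m < 2 * S y}"
  have "2 * m = (\<integral>\<^sup>+y. 2 * S y \<partial>N)" using m by (simp add: nn_integral_cmult)
  also have "\<dots> \<le> (\<integral>\<^sup>+y. m + 2 * (S y * indicator ?G y) \<partial>N)"
    by (intro nn_integral_mono) (auto simp: indicator_def not_less)
  also have "\<dots> = m + 2 * (\<integral>\<^sup>+y. S y * indicator ?G y \<partial>N)"
    by (simp add: nn_integral_add nn_integral_cmult emeasure_space_1)
  finally have "m + m \<le> m + 2 * (\<integral>\<^sup>+y. S y * indicator ?G y \<partial>N)" by (simp add: mult_2)
  then have "m \<le> 2 * (\<integral>\<^sup>+y. S y * indicator ?G y \<partial>N)"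
    using m(2) by (simp add: ennreal_add_left_cancel_le)
  then have "m\<^sup>2 \<le> (2 * (\<integral>\<^sup>+y. S y * indicator ?G y \<partial>N))\<^sup>2" by (intro power_mono) auto
  also have "\<dots> = 4 * (\<integral>\<^sup>+y. S y * indicator ?G y \<partial>N)\<^sup>2" by (simp add: power_mult_distrib)
  also have "\<dots> \<le> 4 * ((\<integral>\<^sup>+y. (S y)\<^sup>2 \<partial>N) * (\<integral>\<^sup>+y. (indicator ?G y)\<^sup>2 \<partial>N))"
    by (intro mult_left_mono Cauchy_Schwarz_nn_integral) auto
  also have "(\<integral>\<^sup>+y. (indicator ?G y)\<^sup>2 \<partial>N) = (\<integral>\<^sup>+y. indicator ?G y \<partial>N)"
    by (intro nn_integral_cong) (auto simp: indicator_def)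
  also have "\<dots> = emeasure N ?G" by simp
  also have "4 * ((\<integral>\<^sup>+y. (S y)\<^sup>2 \<partial>N) * emeasure N ?G) \<le> 4 * (b * emeasure N ?G)"
    by (intro mult_left_mono mult_right_mono b) auto
  finally show ?thesis .
qed

section \<open>The truncation sets\<close>

lemma partial_expectation_merge:
  assumes "D \<subseteq> I" "I \<subseteq> {1..d}"
  shows "(\<integral>\<^sup>+v. g (merge I ({1..d} - I) (merge D (I - D) (v, u), x)) \<partial>PiM D (\<lambda>_. \<mu>))
    = partial_expectation d \<mu> D g (merge I ({1..d} - I) (u, x))"
  unfolding partial_expectation_def
  using assms by (intro nn_integral_cong arg_cong[where f = g]) (auto simp: merge_def fun_eq_iff)

lemma partial_expectation_measurable:
  assumes "prob_space \<mu>" "I \<subseteq> {1..d}" "g \<in> borel_measurable (PiM {1..d} (\<lambda>_. \<mu>))"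
  shows "partial_expectation d \<mu> I g \<in> borel_measurable (PiM {1..d} (\<lambda>_. \<mu>))"
  unfolding partial_expectation_def by (rule partial_integral_measurable[OF assms])

text \<open>
  The one-variable law and the kernel suffice to speak of the truncation sets and of decoupled
  samples; \<open>Q\<close> below is the law of one tuple and \<open>S n\<close> that of the array of \<open>d\<close> rows of length \<open>n\<close>.
\<close>

locale truncation =
  fixes d :: nat and \<mu> :: "'a measure" and h :: "(nat \<Rightarrow> 'a) \<Rightarrow> real" and \<gamma> :: "nat \<Rightarrow> real"
  assumes prob_\<mu>: "prob_space \<mu>"
    and h[measurable]: "h \<in> borel_measurable (PiM {1..d} (\<lambda>_. \<mu>))"
    and d: "d \<ge> 1"
    and \<gamma>_pos: "n \<ge> 1 \<Longrightarrow> \<gamma> n > 0"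
begin

abbreviation "A k l \<equiv> trunc_set d \<mu> h \<gamma> k l"
abbreviation "Q \<equiv> PiM {1..d} (\<lambda>_. \<mu>)"
abbreviation "S n \<equiv> PiM ({1..d} \<times> {1..n}) (\<lambda>_. \<mu>)"

definition level :: "nat \<Rightarrow> ennreal" where "level k = ennreal ((\<gamma> (2 ^ k))\<^sup>2)"
definition g :: "nat \<Rightarrow> nat \<Rightarrow> (nat \<Rightarrow> 'a) \<Rightarrow> ennreal" where
  "g k l z = ennreal ((h z)\<^sup>2) * indicator (A k l) z"

lemma level: "0 < level k" "level k < \<infinity>"
  using \<gamma>_pos[of "2 ^ k"] by (auto simp: level_def)

lemma trunc_set_Suc_Suc:
  "A k (Suc (Suc l)) = {x \<in> A k (Suc l). \<forall>I. I \<subseteq> {1..d} \<and> card I = Suc l \<longrightarrow>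
     2 ^ (k * Suc l) * partial_expectation d \<mu> I (g k (Suc l)) x \<le> level k}"
  by (simp add: level_def g_def[abs_def])

lemma trunc_set_measurable[measurable]: "A k l \<in> sets Q"
proof (induction l rule: nat_less_induct)
  case (1 l)
  consider "l = 0" | "l = Suc 0" | l' where "l = Suc (Suc l')"
    by (metis not0_implies_Suc)
  then show ?case
  proof cases
    case 3
    have [measurable]: "A k (Suc l') \<in> sets Q" using 1 3 by auto
    have g: "g k (Suc l') \<in> borel_measurable Q" unfolding g_def by measurable
    have eq: "A k l = A k (Suc l') \<inter> (\<Inter>I\<in>{I. I \<subseteq> {1..d} \<and> card I = Suc l'}.
       {x\<in>space Q. 2 ^ (k * Suc l') * partial_expectation d \<mu> I (g k (Suc l')) x \<le> level k}) \<inter> space Q"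
      unfolding 3 trunc_set_Suc_Suc
      using sets.sets_into_space[OF \<open>A k (Suc l') \<in> sets Q\<close>] by auto
    have fin: "finite {I. I \<subseteq> {1..d} \<and> card I = Suc l'}" by (rule finite_subset[of _ "Pow {1..d}"]) auto
    have each: "{x\<in>space Q. 2 ^ (k * Suc l') * partial_expectation d \<mu> I (g k (Suc l')) x \<le> level k} \<in> sets Q"
      if "I \<subseteq> {1..d}" for I
    proof -
      note [measurable] = partial_expectation_measurable[OF prob_\<mu> that g]
      show ?thesis by measurable
    qed
    show ?thesis
    proof (cases "{I. I \<subseteq> {1..d} \<and> card I = Suc l'} = {}")
      case True
      show ?thesis unfolding eq True image_empty Inf_empty Int_UNIV_right
        by (intro sets.Int sets.top) fact
    next
      case False
      show ?thesis unfolding eq using False fin each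
        by (intro sets.Int sets.finite_INT sets.top \<open>A k (Suc l') \<in> sets Q\<close>) blast+
    qed
  next
    case 2
    have "{x\<in>space Q. (h x)\<^sup>2 \<le> (\<gamma> (2 ^ k))\<^sup>2} \<in> sets Q" by measurable
    then show ?thesis by (simp add: 2)
  qed simp
qed

lemma g_measurable[measurable]: "g k l \<in> borel_measurable Q"
  unfolding g_def by measurable

lemma trunc_set_antimono:
  assumes "1 \<le> l" "l \<le> l'" shows "A k l' \<subseteq> A k l"
  using assms(2,1)
proof (induction rule: dec_induct)
  case (step n)
  then obtain m where "n = Suc m" by (cases n) auto
  then show ?case using step by (auto simp del: trunc_set.simps(3) simp: trunc_set_Suc_Suc)
qed simp

lemma g_mono: "1 \<le> l \<Longrightarrow> l \<le> l' \<Longrightarrow> g k l' x \<le> g k l x"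
  using trunc_set_antimono[of l l' k] by (auto simp: g_def indicator_def)

lemma g_le: "l \<ge> 1 \<Longrightarrow> g k l x \<le> level k"
  using trunc_set_antimono[of 1 l k] by (auto simp: g_def level_def indicator_def intro!: ennreal_leI)

text \<open>
  For \<open>card D \<ge> 1\<close> this is the condition that defines \<open>A k (card D + 1)\<close>, and for \<open>D = {}\<close> it is the
  bound on \<open>h\<^sup>2\<close> that defines \<open>A k 1\<close>.
\<close>

lemma partial_expectation_bound:
  assumes x: "x \<in> A k l" and l: "1 \<le> l" and D: "D \<subseteq> {1..d}" "card D < l"
    and f: "\<And>x. f x \<le> g k l x"
  shows "of_nat ((2 ^ k) ^ card D) * partial_expectation d \<mu> D f x \<le> level k"
proof (cases "card D")
  case 0
  then have D0: "D = {}" using D finite_subset[OF D(1)] by simp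
  interpret D: prob_space "PiM D (\<lambda>_. \<mu>)" by (intro prob_space_PiM prob_\<mu>)
  have "partial_expectation d \<mu> D f x \<le> (\<integral>\<^sup>+u. level k \<partial>PiM D (\<lambda>_. \<mu>))"
    unfolding partial_expectation_def
    by (intro nn_integral_mono) (meson f g_le l order_trans)
  then show ?thesis using 0 D.emeasure_space_1 by simp
next
  case (Suc c)
  have "x \<in> A k (Suc (Suc c))" using x trunc_set_antimono[of "Suc (Suc c)" l k] D Suc by auto
  then have *: "2 ^ (k * Suc c) * partial_expectation d \<mu> D (g k (Suc c)) x \<le> level k"
    unfolding trunc_set_Suc_Suc using D Suc by auto
  have "partial_expectation d \<mu> D f x \<le> partial_expectation d \<mu> D (g k (Suc c)) x"
    unfolding partial_expectation_def
  proof (intro nn_integral_mono)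
    fix u
    let ?z = "merge D ({1..d} - D) (u, x)"
    have "f ?z \<le> g k l ?z" by (rule f)
    also have "\<dots> \<le> g k (Suc c) ?z" using D Suc by (intro g_mono) auto
    finally show "f ?z \<le> g k (Suc c) ?z" .
  qed
  then have "2 ^ (k * Suc c) * partial_expectation d \<mu> D f x \<le> 2 ^ (k * Suc c) * partial_expectation d \<mu> D (g k (Suc c)) x"
    by (intro mult_left_mono) auto
  also note *
  finally have **: "2 ^ (k * Suc c) * partial_expectation d \<mu> D f x \<le> level k" .
  have "(2 :: ennreal) ^ (k * Suc c) = of_nat ((2 ^ k) ^ Suc c)"
    by (simp only: of_nat_power of_nat_numeral power_mult)
  then show ?thesis using ** unfolding Suc by simp
qed

text \<open>
  Freeze the coordinates outside \<open>I\<close>. A partial integral of the section is a partial expectation of \<open>f\<close>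
  at a point that lies in \<open>A k (card I)\<close> unless the section vanishes, so the bounds needed for the
  second moment come from the truncation.
\<close>

lemma section_second_moment:
  assumes I: "I \<subseteq> {1..d}" "I \<noteq> {}" and x: "x \<in> space Q"
    and f: "f \<in> borel_measurable Q" "\<And>z. f z \<le> g k (card I) z"
    and m: "m = of_nat ((2 ^ k) ^ card I) * partial_expectation d \<mu> I f x"
  defines "fx \<equiv> \<lambda>u. f (merge I ({1..d} - I) (u, x))"
  shows "fx \<in> borel_measurable (PiM I (\<lambda>_. \<mu>))"
    and "(\<integral>\<^sup>+y. sample_sum I (2 ^ k) fx y \<partial>PiM (I \<times> {1..2 ^ k}) (\<lambda>_. \<mu>)) = m"
    and "(\<integral>\<^sup>+y. (sample_sum I (2 ^ k) fx y)\<^sup>2 \<partial>PiM (I \<times> {1..2 ^ k}) (\<lambda>_. \<mu>))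
      \<le> m\<^sup>2 + of_nat (2 ^ card I) * (level k * m)"
    and "m \<noteq> \<infinity>"
proof -
  have fin: "finite I" using I finite_subset by auto
  then have cI: "card I \<ge> 1" using I by (simp add: Suc_leI card_gt_0_iff)
  interpret I: prob_space "PiM I (\<lambda>_. \<mu>)" by (intro prob_space_PiM prob_\<mu>)
  show fx: "fx \<in> borel_measurable (PiM I (\<lambda>_. \<mu>))"
    unfolding fx_def by (rule section_measurable[OF prob_\<mu> I(1) f(1) x])
  have int: "(\<integral>\<^sup>+u. fx u \<partial>PiM I (\<lambda>_. \<mu>)) = partial_expectation d \<mu> I f x"
    by (simp add: fx_def partial_expectation_def)
  show "(\<integral>\<^sup>+y. sample_sum I (2 ^ k) fx y \<partial>PiM (I \<times> {1..2 ^ k}) (\<lambda>_. \<mu>)) = m"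
    unfolding m int[symmetric] by (rule sample_sum_first_moment[OF prob_\<mu> fin fx])
  have "fx u \<le> level k" for u
    unfolding fx_def using f(2) g_le[OF cI] by (meson order_trans)
  then have "(\<integral>\<^sup>+u. fx u \<partial>PiM I (\<lambda>_. \<mu>)) \<le> (\<integral>\<^sup>+u. level k \<partial>PiM I (\<lambda>_. \<mu>))"
    by (intro nn_integral_mono) auto
  then have "partial_expectation d \<mu> I f x \<le> level k" using int I.emeasure_space_1 by simp
  then have "partial_expectation d \<mu> I f x < \<infinity>" using level(2) le_less_trans by blast
  then show "m \<noteq> \<infinity>"
    using of_nat_less_top[of "(2 ^ k) ^ card I"] unfolding m infinity_ennreal_def
    by (metis ennreal_mult_eq_top_iff less_top)
  show "(\<integral>\<^sup>+y. (sample_sum I (2 ^ k) fx y)\<^sup>2 \<partial>PiM (I \<times> {1..2 ^ k}) (\<lambda>_. \<mu>))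
      \<le> m\<^sup>2 + of_nat (2 ^ card I) * (level k * m)"
  proof (rule sample_sum_second_moment[OF prob_\<mu> fin fx])
    show "m = of_nat ((2 ^ k) ^ card I) * (\<integral>\<^sup>+u. fx u \<partial>PiM I (\<lambda>_. \<mu>))" by (simp add: m int)
    fix D u assume D: "D \<subset> I" and u: "u \<in> space (PiM I (\<lambda>_. \<mu>))" and nz: "fx u \<noteq> 0"
    have "g k (card I) (merge I ({1..d} - I) (u, x)) \<noteq> 0"
      using nz f(2)[of "merge I ({1..d} - I) (u, x)"] by (auto simp: fx_def)
    then have z: "merge I ({1..d} - I) (u, x) \<in> A k (card I)" by (auto simp: g_def indicator_def)
    have "(\<integral>\<^sup>+v. fx (merge D (I - D) (v, u)) \<partial>PiM D (\<lambda>_. \<mu>))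
      = partial_expectation d \<mu> D f (merge I ({1..d} - I) (u, x))"
      unfolding fx_def using D I by (intro partial_expectation_merge) auto
    then show "of_nat ((2 ^ k) ^ card D) * (\<integral>\<^sup>+v. fx (merge D (I - D) (v, u)) \<partial>PiM D (\<lambda>_. \<mu>)) \<le> level k"
      using partial_expectation_bound[OF z cI _ _ f(2), of D] D I psubset_card_mono[OF fin D] by auto
  qed
qed

end

text \<open>
  Once \<open>m\<close> exceeds the truncation level, the term that is linear in \<open>m\<close> is dominated by \<open>m\<^sup>2\<close>.
\<close>

lemma Paley_Zygmund_cancel:
  fixes m a c P :: ennreal
  assumes "m\<^sup>2 \<le> 4 * ((m\<^sup>2 + c * (a * m)) * P)" "a < m" "m \<noteq> \<infinity>"
  shows "1 \<le> 4 * (1 + c) * P"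
proof -
  have "a * m \<le> m\<^sup>2" unfolding power2_eq_square using assms(2) by (intro mult_right_mono) auto
  then have "4 * ((m\<^sup>2 + c * (a * m)) * P) \<le> 4 * ((m\<^sup>2 + c * m\<^sup>2) * P)"
    by (intro mult_left_mono mult_right_mono add_left_mono) auto
  with assms(1) have "m\<^sup>2 * 1 \<le> 4 * ((m\<^sup>2 + c * m\<^sup>2) * P)" by simp
  also have "\<dots> = m\<^sup>2 * (4 * (1 + c) * P)" by (simp add: distrib_left distrib_right mult_ac)
  finally show ?thesis
    by (subst (asm) ennreal_mult_le_mult_iff) (use assms in \<open>auto simp: power_eq_top_ennreal\<close>)
qed

lemma emeasure_PiM_reindex:
  assumes "prob_space \<mu>" "inj_on t I" "t \<in> I \<rightarrow> K" "E \<in> sets (PiM I (\<lambda>_. \<mu>))"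
  shows "emeasure (PiM K (\<lambda>_. \<mu>)) {y\<in>space (PiM K (\<lambda>_. \<mu>)). (\<lambda>k\<in>I. y (t k)) \<in> E} = emeasure (PiM I (\<lambda>_. \<mu>)) E"
proof -
  have "distr (PiM K (\<lambda>_. \<mu>)) (PiM I (\<lambda>_. \<mu>)) (\<lambda>y. \<lambda>k\<in>I. y (t k)) = PiM I (\<lambda>_. \<mu>)"
    using distr_PiM_reindex[of K "\<lambda>_. \<mu>" t I] assms by simp
  then have "emeasure (PiM I (\<lambda>_. \<mu>)) E = emeasure (PiM K (\<lambda>_. \<mu>)) ((\<lambda>y. \<lambda>k\<in>I. y (t k)) -` E \<inter> space (PiM K (\<lambda>_. \<mu>)))"
    using emeasure_distr[OF measurable_reindex[OF assms(3)] assms(4)] by metis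
  also have "(\<lambda>y. \<lambda>k\<in>I. y (t k)) -` E \<inter> space (PiM K (\<lambda>_. \<mu>)) = {y\<in>space (PiM K (\<lambda>_. \<mu>)). (\<lambda>k\<in>I. y (t k)) \<in> E}" by auto
  finally show ?thesis by simp
qed

context truncation begin

definition sample :: "(nat \<times> nat \<Rightarrow> 'a) \<Rightarrow> (nat \<Rightarrow> nat) \<Rightarrow> nat \<Rightarrow> 'a" where
  "sample y i = (\<lambda>\<kappa>\<in>{1..d}. y (\<kappa>, i \<kappa>))"

definition escapes :: "nat \<Rightarrow> (nat \<Rightarrow> 'a) set \<Rightarrow> (nat \<times> nat \<Rightarrow> 'a) set" where
  "escapes n B = {y\<in>space (S n). \<exists>i\<in>index_cube d n. sample y i \<notin> B}"

definition square_sum :: "nat \<Rightarrow> (nat \<times> nat \<Rightarrow> 'a) \<Rightarrow> real" where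
  "square_sum n y = (\<Sum>i\<in>index_cube d n. (h (sample y i))\<^sup>2)"

lemma finite_index_cube: "finite (index_cube d n)"
  unfolding index_cube_def by (intro finite_PiE) auto

lemma sample_tuple_measurable: "i \<in> index_cube d n \<Longrightarrow> (\<lambda>y. sample y i) \<in> measurable (S n) Q"
  unfolding sample_def index_cube_def by (rule sample_measurable)

lemma sample_space: "i \<in> index_cube d n \<Longrightarrow> y \<in> space (S n) \<Longrightarrow> sample y i \<in> space Q"
  using measurable_space[OF sample_tuple_measurable] by blast

lemma escapes_measurable[measurable]:
  assumes "B \<in> sets Q" shows "escapes n B \<in> sets (S n)"
proof -
  have "escapes n B = (\<Union>i\<in>index_cube d n. (\<lambda>y. sample y i) -` (space Q - B) \<inter> space (S n))"
    using sample_space by (auto simp: escapes_def)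
  also have "\<dots> \<in> sets (S n)"
    using assms by (intro sets.finite_UN finite_index_cube measurable_sets[OF sample_tuple_measurable]) auto
  finally show ?thesis .
qed

lemma square_sum_measurable[measurable]: "square_sum n \<in> borel_measurable (S n)"
  unfolding square_sum_def
  by (intro borel_measurable_sum borel_measurable_power measurable_compose[OF sample_tuple_measurable h])

lemma square_sum_nonneg: "square_sum n y \<ge> 0"
  by (simp add: square_sum_def sum_nonneg)

lemma square_sum_ennreal:
  "ennreal (square_sum n y) = (\<Sum>i\<in>index_cube d n. ennreal ((h (sample y i))\<^sup>2))"
  by (simp add: square_sum_def sum_ennreal)

lemma prob_S: "prob_space (S n)" and prob_Q: "prob_space Q"
  by (intro prob_space_PiM prob_\<mu>)+

text \<open>
  Look at the first level \<open>l + 1\<close> at which \<open>x\<close> is rejected.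
\<close>

lemma not_in_trunc_set:
  assumes x: "x \<in> space Q" "x \<notin> A k l" and l: "l \<ge> 1"
  shows "level k < ennreal ((h x)\<^sup>2) \<or> (\<exists>I\<subseteq>{1..d}. I \<noteq> {} \<and>
    level k < of_nat ((2 ^ k) ^ card I) * partial_expectation d \<mu> I (g k (card I)) x)"
  using l x(2)
proof (induction rule: dec_induct)
  case base
  then have "(\<gamma> (2 ^ k))\<^sup>2 < (h x)\<^sup>2" using x by auto
  then show ?case by (simp add: level_def ennreal_less_iff)
next
  case (step n)
  then obtain m where n: "n = Suc m" by (cases n) auto
  show ?case
  proof (cases "x \<in> A k n")
    case True
    then obtain I where I: "I \<subseteq> {1..d}" "card I = n"
      "\<not> 2 ^ (k * n) * partial_expectation d \<mu> I (g k n) x \<le> level k"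
      using step.prems unfolding n trunc_set_Suc_Suc by auto
    have "(2 :: ennreal) ^ (k * n) = of_nat ((2 ^ k) ^ n)"
      by (simp only: of_nat_power of_nat_numeral power_mult)
    then have "level k < of_nat ((2 ^ k) ^ card I) * partial_expectation d \<mu> I (g k (card I)) x"
      using I by (simp add: not_le)
    moreover have "I \<noteq> {}" using I n by auto
    ultimately show ?thesis using I by blast
  qed (use step in auto)
qed

text \<open>
  The tuple indexed by \<open>i\<close> has a section with large mean. With the rows outside \<open>I\<close> frozen,
  resampling the rows in \<open>I\<close> produces a decoupled sum over that section; it is part of the sum of
  squares, and by Paley-Zygmund it exceeds half of its mean with probability bounded below.
\<close>

lemma heavy_section_forces_large_square_sum:
  assumes I: "I \<subseteq> {1..d}" "I \<noteq> {}"
  defines "J \<equiv> {1..d} - I"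
  assumes y2: "y2 \<in> space (PiM (J \<times> {1..2 ^ k}) (\<lambda>_. \<mu>))"
    and y1: "y1 \<in> space (PiM (I \<times> {1..2 ^ k}) (\<lambda>_. \<mu>))"
    and i: "i \<in> index_cube d (2 ^ k)"
  defines "x \<equiv> sample (merge (J \<times> {1..2 ^ k}) (I \<times> {1..2 ^ k}) (y2, y1)) i"
  assumes heavy: "level k < of_nat ((2 ^ k) ^ card I) * partial_expectation d \<mu> I (g k (card I)) x"
  shows "1 \<le> 4 * (1 + of_nat (2 ^ card I)) * emeasure (PiM (I \<times> {1..2 ^ k}) (\<lambda>_. \<mu>))
    {u\<in>space (PiM (I \<times> {1..2 ^ k}) (\<lambda>_. \<mu>)).
      level k < 2 * ennreal (square_sum (2 ^ k) (merge (J \<times> {1..2 ^ k}) (I \<times> {1..2 ^ k}) (y2, u)))}"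
proof -
  let ?n = "2 ^ k :: nat"
  let ?P = "PiM (I \<times> {1..?n}) (\<lambda>_. \<mu>)"
  let ?mg = "\<lambda>u. merge (J \<times> {1..?n}) (I \<times> {1..?n}) (y2, u)"
  have un: "J \<times> {1..?n} \<union> I \<times> {1..?n} = {1..d} \<times> {1..?n}" using I by (auto simp: J_def)
  have disj: "(J \<times> {1..?n}) \<inter> (I \<times> {1..?n}) = {}" by (auto simp: J_def)
  have mg_space: "?mg u \<in> space (S ?n)" if "u \<in> space ?P" for u
    using that y2 unfolding un[symmetric] by (auto simp: space_PiM PiE_iff merge_def extensional_def)
  have x: "x \<in> space Q" unfolding x_def by (rule sample_space[OF i mg_space[OF y1]])
  define m where "m = of_nat (?n ^ card I) * partial_expectation d \<mu> I (g k (card I)) x"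
  define fx where "fx u = g k (card I) (merge I J (u, x))" for u
  note sec = section_second_moment[OF I x g_measurable order_refl m_def, folded J_def, folded fx_def]
  have PZ: "m\<^sup>2 \<le> 4 * ((m\<^sup>2 + of_nat (2 ^ card I) * (level k * m)) * emeasure ?P {u\<in>space ?P. m < 2 * sample_sum I ?n fx u})"
  proof (rule Paley_Zygmund_nn_integral[OF _ _ sec(2,4,3)])
    show "prob_space ?P" by (intro prob_space_PiM prob_\<mu>)
    show "sample_sum I ?n fx \<in> borel_measurable ?P" by (rule sample_sum_measurable[OF sec(1)])
  qed
  have 1: "1 \<le> 4 * (1 + of_nat (2 ^ card I)) * emeasure ?P {u\<in>space ?P. m < 2 * sample_sum I ?n fx u}"
    by (rule Paley_Zygmund_cancel[OF PZ _ sec(4)]) (use heavy m_def in simp)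
  have le: "sample_sum I ?n fx u \<le> ennreal (square_sum ?n (?mg u))" for u
  proof -
    \<comment> \<open>Multiindices of the section, completed by the frozen entries of \<open>i\<close>.\<close>
    define \<iota> where "\<iota> j = merge I J (j, i)" for j :: "nat \<Rightarrow> nat"
    have inj: "inj_on \<iota> (I \<rightarrow>\<^sub>E {1..?n})"
    proof (rule inj_onI)
      fix j j' assume *: "j \<in> I \<rightarrow>\<^sub>E {1..?n}" "j' \<in> I \<rightarrow>\<^sub>E {1..?n}" "\<iota> j = \<iota> j'"
      show "j = j'"
      proof (rule PiE_ext[OF *(1,2)])
        fix \<kappa> assume "\<kappa> \<in> I"
        then show "j \<kappa> = j' \<kappa>" using fun_cong[OF *(3), of \<kappa>] by (simp add: \<iota>_def merge_def)
      qed
    qed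
    have img: "\<iota> ` (I \<rightarrow>\<^sub>E {1..?n}) \<subseteq> index_cube d ?n"
    proof safe
      fix j assume j: "j \<in> I \<rightarrow>\<^sub>E {1..?n}"
      show "\<iota> j \<in> index_cube d ?n"
        unfolding index_cube_def
      proof (rule PiE_I)
        fix \<kappa> assume "\<kappa> \<in> {1..d}"
        then show "\<iota> j \<kappa> \<in> {1..?n}"
          using PiE_mem[OF j, of \<kappa>] PiE_mem[OF i[unfolded index_cube_def], of \<kappa>]
          by (cases "\<kappa> \<in> I") (simp_all add: \<iota>_def merge_def J_def)
      next
        fix \<kappa> assume "\<kappa> \<notin> {1..d}"
        then have "\<kappa> \<notin> I" "\<kappa> \<notin> J" using I by (auto simp: J_def)
        then show "\<iota> j \<kappa> = undefined" by (simp add: \<iota>_def merge_def)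
      qed
    qed
    have smp: "merge I J (\<lambda>\<kappa>\<in>I. u (\<kappa>, j \<kappa>), x) = sample (?mg u) (\<iota> j)" if "j \<in> I \<rightarrow>\<^sub>E {1..?n}" for j
    proof
      fix \<kappa>
      consider "\<kappa> \<in> I" | "\<kappa> \<in> J" | "\<kappa> \<notin> {1..d}" unfolding J_def by auto
      then show "merge I J (\<lambda>\<kappa>\<in>I. u (\<kappa>, j \<kappa>), x) \<kappa> = sample (?mg u) (\<iota> j) \<kappa>"
      proof cases
        case 1
        then have "j \<kappa> \<in> {1..?n}" "\<kappa> \<in> {1..d}" "\<kappa> \<notin> J" using that I by (auto simp: J_def)
        then show ?thesis using 1 by (auto simp: merge_def sample_def \<iota>_def)
      next
        case 2
        then have "i \<kappa> \<in> {1..?n}" "\<kappa> \<in> {1..d}" "\<kappa> \<notin> I" using i by (auto simp: J_def index_cube_def)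
        then show ?thesis using 2 by (auto simp: merge_def sample_def \<iota>_def x_def)
      next
        case 3
        then have "\<kappa> \<notin> I" "\<kappa> \<notin> J" using I by (auto simp: J_def)
        then show ?thesis using 3 by (simp add: merge_def sample_def)
      qed
    qed
    have "sample_sum I ?n fx u = (\<Sum>j\<in>I \<rightarrow>\<^sub>E {1..?n}. fx (\<lambda>\<kappa>\<in>I. u (\<kappa>, j \<kappa>)))" by (simp add: sample_sum_def)
    also have "\<dots> \<le> (\<Sum>j\<in>I \<rightarrow>\<^sub>E {1..?n}. ennreal ((h (sample (?mg u) (\<iota> j)))\<^sup>2))"
    proof (rule sum_mono)
      fix j assume "j \<in> I \<rightarrow>\<^sub>E {1..?n}"
      show "fx (\<lambda>\<kappa>\<in>I. u (\<kappa>, j \<kappa>)) \<le> ennreal ((h (sample (?mg u) (\<iota> j)))\<^sup>2)"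
        unfolding fx_def smp[OF \<open>j \<in> I \<rightarrow>\<^sub>E {1..?n}\<close>] g_def by (simp add: indicator_def)
    qed
    also have "\<dots> = (\<Sum>i\<in>\<iota> ` (I \<rightarrow>\<^sub>E {1..?n}). ennreal ((h (sample (?mg u) i))\<^sup>2))"
      by (rule sum.reindex[OF inj, unfolded o_def, symmetric])
    also have "\<dots> \<le> (\<Sum>i\<in>index_cube d ?n. ennreal ((h (sample (?mg u) i))\<^sup>2))"
      by (rule sum_mono2[OF finite_index_cube img]) simp
    finally show ?thesis by (simp add: square_sum_ennreal)
  qed
  have mg_meas: "(\<lambda>u. ?mg u) \<in> measurable ?P (S ?n)"
    unfolding un[symmetric] by (rule measurable_compose[OF measurable_Pair1'[OF y2] measurable_merge])
  show ?thesis
  proof (rule order_trans[OF 1], intro mult_left_mono emeasure_mono subsetI CollectI conjI)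
    fix u assume u: "u \<in> {u\<in>space ?P. m < 2 * sample_sum I ?n fx u}"
    have "level k < m" using heavy m_def by simp
    also have "m < 2 * sample_sum I ?n fx u" using u by simp
    also have "\<dots> \<le> 2 * ennreal (square_sum ?n (?mg u))" by (intro mult_left_mono le) auto
    finally show "level k < 2 * ennreal (square_sum ?n (?mg u))" .
    show "u \<in> space ?P" using u by simp
  next
    have [measurable]: "(\<lambda>u. square_sum ?n (?mg u)) \<in> borel_measurable ?P"
      by (rule measurable_compose[OF mg_meas square_sum_measurable])
    show "{u\<in>space ?P. level k < 2 * ennreal (square_sum ?n (?mg u))} \<in> sets ?P" by measurable
  qed simp
qed

end

context truncation begin

text \<open>
  Whether some section over \<open>I\<close> is heavy depends on the rows outside \<open>I\<close> only; integrate the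
  previous bound over these rows.
\<close>

lemma heavy_section_probability:
  fixes k :: nat
  assumes I: "I \<subseteq> {1..d}" "I \<noteq> {}"
  defines "H \<equiv> {x\<in>space Q. level k < of_nat ((2 ^ k) ^ card I) * partial_expectation d \<mu> I (g k (card I)) x}"
  shows "emeasure (S (2 ^ k)) (escapes (2 ^ k) (space Q - H))
    \<le> 4 * (1 + of_nat (2 ^ d)) * emeasure (S (2 ^ k)) {y\<in>space (S (2 ^ k)). level k < 2 * ennreal (square_sum (2 ^ k) y)}"
proof -
  interpret product_sigma_finite "\<lambda>_ :: nat \<times> nat. \<mu>" by (rule product_sigma_finite_const[OF prob_\<mu>])
  let ?n = "2 ^ k :: nat"
  define J where "J = {1..d} - I"
  define JN where "JN = J \<times> {1..?n}"
  define IN where "IN = I \<times> {1..?n}"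
  let ?R = "{y\<in>space (S ?n). level k < 2 * ennreal (square_sum ?n y)}"
  let ?L = "escapes ?n (space Q - H)"
  let ?c = "4 * (1 + of_nat (2 ^ d)) :: ennreal"
  have un: "{1..d} \<times> {1..?n} = JN \<union> IN" using I by (auto simp: J_def JN_def IN_def)
  have disj: "JN \<inter> IN = {}" by (auto simp: J_def JN_def IN_def)
  have fin: "finite JN" "finite IN" using I finite_subset by (auto simp: J_def JN_def IN_def)
  interpret IN: prob_space "PiM IN (\<lambda>_. \<mu>)" by (intro prob_space_PiM prob_\<mu>)
  have H[measurable]: "H \<in> sets Q"
  proof -
    note [measurable] = partial_expectation_measurable[OF prob_\<mu> I(1) g_measurable]
    show ?thesis unfolding H_def by measurable
  qed
  have L[measurable]: "?L \<in> sets (S ?n)" by (rule escapes_measurable[OF sets.compl_sets[OF H]])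
  have R[measurable]: "?R \<in> sets (S ?n)" by measurable
  have mg: "(\<lambda>u. merge JN IN (y2, u)) \<in> measurable (PiM IN (\<lambda>_. \<mu>)) (S ?n)"
    if "y2 \<in> space (PiM JN (\<lambda>_. \<mu>))" for y2
    unfolding un by (rule measurable_compose[OF measurable_Pair1'[OF that] measurable_merge])
  have fold: "emeasure (S ?n) B = (\<integral>\<^sup>+y2. emeasure (PiM IN (\<lambda>_. \<mu>)) {u\<in>space (PiM IN (\<lambda>_. \<mu>)). merge JN IN (y2, u) \<in> B} \<partial>(PiM JN (\<lambda>_. \<mu>)))"
    if B: "B \<in> sets (S ?n)" for B
  proof -
    have "emeasure (S ?n) B = (\<integral>\<^sup>+y. indicator B y \<partial>S ?n)" using B by simp
    also have "\<dots> = (\<integral>\<^sup>+y2. (\<integral>\<^sup>+u. indicator B (merge JN IN (y2, u)) \<partial>(PiM IN (\<lambda>_. \<mu>))) \<partial>(PiM JN (\<lambda>_. \<mu>)))"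
      unfolding un by (rule product_nn_integral_fold[OF disj fin]) (use B un in simp)
    also have "\<dots> = (\<integral>\<^sup>+y2. emeasure (PiM IN (\<lambda>_. \<mu>)) {u\<in>space (PiM IN (\<lambda>_. \<mu>)). merge JN IN (y2, u) \<in> B} \<partial>(PiM JN (\<lambda>_. \<mu>)))"
    proof (intro nn_integral_cong)
      fix y2 assume y2: "y2 \<in> space (PiM JN (\<lambda>_. \<mu>))"
      have "{u\<in>space (PiM IN (\<lambda>_. \<mu>)). merge JN IN (y2, u) \<in> B} = (\<lambda>u. merge JN IN (y2, u)) -` B \<inter> space (PiM IN (\<lambda>_. \<mu>))" by auto
      then have m: "{u\<in>space (PiM IN (\<lambda>_. \<mu>)). merge JN IN (y2, u) \<in> B} \<in> sets (PiM IN (\<lambda>_. \<mu>))"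
        using measurable_sets[OF mg[OF y2] B] by simp
      have "(\<integral>\<^sup>+u. indicator B (merge JN IN (y2, u)) \<partial>(PiM IN (\<lambda>_. \<mu>)))
        = (\<integral>\<^sup>+u. indicator {u\<in>space (PiM IN (\<lambda>_. \<mu>)). merge JN IN (y2, u) \<in> B} u \<partial>(PiM IN (\<lambda>_. \<mu>)))"
        by (intro nn_integral_cong) (simp add: indicator_def)
      then show "(\<integral>\<^sup>+u. indicator B (merge JN IN (y2, u)) \<partial>(PiM IN (\<lambda>_. \<mu>)))
        = emeasure (PiM IN (\<lambda>_. \<mu>)) {u\<in>space (PiM IN (\<lambda>_. \<mu>)). merge JN IN (y2, u) \<in> B}"
        using m by simp
    qed
    finally show ?thesis .
  qed
  have meas_fold: "(\<lambda>y2. emeasure (PiM IN (\<lambda>_. \<mu>)) {u\<in>space (PiM IN (\<lambda>_. \<mu>)). merge JN IN (y2, u) \<in> ?R}) \<in> borel_measurable (PiM JN (\<lambda>_. \<mu>))"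
  proof -
    have mrg: "merge JN IN \<in> measurable ((PiM JN (\<lambda>_. \<mu>)) \<Otimes>\<^sub>M (PiM IN (\<lambda>_. \<mu>))) (S ?n)"
      unfolding un by (rule measurable_merge)
    have "merge JN IN -` ?R \<inter> space ((PiM JN (\<lambda>_. \<mu>)) \<Otimes>\<^sub>M (PiM IN (\<lambda>_. \<mu>))) \<in> sets ((PiM JN (\<lambda>_. \<mu>)) \<Otimes>\<^sub>M (PiM IN (\<lambda>_. \<mu>)))"
      by (rule measurable_sets[OF mrg R])
    from IN.measurable_emeasure_Pair[OF this]
    show ?thesis
      by (rule measurable_cong[THEN iffD1, rotated]) (auto intro!: arg_cong2[where f = emeasure] simp: space_pair_measure)
  qed
  have "emeasure (S ?n) ?L \<le> (\<integral>\<^sup>+y2. ?c * emeasure (PiM IN (\<lambda>_. \<mu>)) {u\<in>space (PiM IN (\<lambda>_. \<mu>)). merge JN IN (y2, u) \<in> ?R} \<partial>(PiM JN (\<lambda>_. \<mu>)))"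
    unfolding fold[OF L]
  proof (intro nn_integral_mono)
    fix y2 assume y2: "y2 \<in> space (PiM JN (\<lambda>_. \<mu>))"
    show "emeasure (PiM IN (\<lambda>_. \<mu>)) {u\<in>space (PiM IN (\<lambda>_. \<mu>)). merge JN IN (y2, u) \<in> ?L}
      \<le> ?c * emeasure (PiM IN (\<lambda>_. \<mu>)) {u\<in>space (PiM IN (\<lambda>_. \<mu>)). merge JN IN (y2, u) \<in> ?R}"
    proof (cases "\<exists>y1\<in>space (PiM IN (\<lambda>_. \<mu>)). merge JN IN (y2, y1) \<in> ?L")
      case False
      then have empty: "{u\<in>space (PiM IN (\<lambda>_. \<mu>)). merge JN IN (y2, u) \<in> ?L} = {}" by auto
      show ?thesis unfolding empty by simp
    next
      case True
      then obtain y1 i where y1: "y1 \<in> space (PiM IN (\<lambda>_. \<mu>))" and i: "i \<in> index_cube d ?n"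
        and nH: "merge JN IN (y2, y1) \<in> space (S ?n)" "sample (merge JN IN (y2, y1)) i \<notin> space Q - H"
        unfolding escapes_def by blast
      then have heavy: "level k < of_nat (?n ^ card I) * partial_expectation d \<mu> I (g k (card I)) (sample (merge JN IN (y2, y1)) i)"
        using sample_space[OF i nH(1)] by (simp add: H_def)
      have R_eq: "{u\<in>space (PiM IN (\<lambda>_. \<mu>)). merge JN IN (y2, u) \<in> ?R}
        = {u\<in>space (PiM IN (\<lambda>_. \<mu>)). level k < 2 * ennreal (square_sum ?n (merge JN IN (y2, u)))}"
        using measurable_space[OF mg[OF y2]] by auto
      have "emeasure (PiM IN (\<lambda>_. \<mu>)) {u\<in>space (PiM IN (\<lambda>_. \<mu>)). merge JN IN (y2, u) \<in> ?L} \<le> 1"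
        by (rule IN.emeasure_le_1)
      also have "1 \<le> 4 * (1 + of_nat (2 ^ card I)) * emeasure (PiM IN (\<lambda>_. \<mu>)) {u\<in>space (PiM IN (\<lambda>_. \<mu>)). merge JN IN (y2, u) \<in> ?R}"
        unfolding R_eq
        using heavy_section_forces_large_square_sum[OF I, folded J_def, of y2 k y1 i] y2 y1 i heavy
        by (simp only: JN_def IN_def)
      also have "\<dots> \<le> ?c * emeasure (PiM IN (\<lambda>_. \<mu>)) {u\<in>space (PiM IN (\<lambda>_. \<mu>)). merge JN IN (y2, u) \<in> ?R}"
      proof (intro mult_right_mono mult_left_mono add_left_mono of_nat_mono power_increasing)
        show "card I \<le> d" using card_mono[OF _ I(1)] by simp
      qed auto
      finally show ?thesis .
    qed
  qed
  also have "\<dots> = ?c * emeasure (S ?n) ?R"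
    unfolding fold[OF R] by (rule nn_integral_cmult[OF meas_fold])
  finally show ?thesis .
qed

text \<open>
  A tuple outside \<open>A k d\<close> has a value of \<open>h\<^sup>2\<close> above the level or one of at most \<open>2 ^ d\<close> kinds of heavy
  sections.
\<close>

lemma escape_forces_large_square_sum:
  "measure (S (2 ^ k)) (escapes (2 ^ k) (A k d))
    \<le> (1 + 2 ^ d * (4 * (1 + 2 ^ d))) * measure (S (2 ^ k)) {y\<in>space (S (2 ^ k)). (\<gamma> (2 ^ k))\<^sup>2 / 2 < square_sum (2 ^ k) y}"
proof -
  let ?n = "2 ^ k :: nat"
  interpret S: prob_space "S ?n" by (rule prob_S)
  define H where "H I = {x\<in>space Q. level k < of_nat ((2 ^ k) ^ card I) * partial_expectation d \<mu> I (g k (card I)) x}" for I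
  define R where "R = {y\<in>space (S ?n). (\<gamma> ?n)\<^sup>2 / 2 < square_sum ?n y}"
  have R_eq: "{y\<in>space (S ?n). level k < 2 * ennreal (square_sum ?n y)} = R"
  proof -
    have "level k < 2 * ennreal (square_sum ?n y) \<longleftrightarrow> (\<gamma> ?n)\<^sup>2 / 2 < square_sum ?n y" for y
    proof -
      have "2 * ennreal (square_sum ?n y) = ennreal (2 * square_sum ?n y)"
        using square_sum_nonneg by (simp add: ennreal_mult)
      then show ?thesis by (auto simp: level_def ennreal_less_iff)
    qed
    then show ?thesis by (simp add: R_def)
  qed
  have R: "R \<in> sets (S ?n)" unfolding R_def by measurable
  have H[measurable]: "H I \<in> sets Q" if "I \<subseteq> {1..d}" for I
  proof -
    note [measurable] = partial_expectation_measurable[OF prob_\<mu> that g_measurable]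
    show ?thesis unfolding H_def by measurable
  qed
  let ?Is = "Pow {1..d} - {{}}"
  have esc: "escapes ?n (space Q - H I) \<in> sets (S ?n)" if "I \<in> ?Is" for I
    using that H[of I] by (intro escapes_measurable) auto
  have each: "S.prob (escapes ?n (space Q - H I)) \<le> 4 * (1 + 2 ^ d) * S.prob R" if "I \<in> ?Is" for I
  proof -
    have "ennreal (S.prob (escapes ?n (space Q - H I))) \<le> 4 * (1 + of_nat (2 ^ d)) * ennreal (S.prob R)"
      using heavy_section_probability[of I k, folded H_def] that unfolding R_eq S.emeasure_eq_measure by auto
    also have "(4 * (1 + of_nat (2 ^ d)) :: ennreal) = ennreal (4 * (1 + 2 ^ d))"
    proof -
      have "(4 * (1 + of_nat (2 ^ d)) :: ennreal) = of_nat (4 * (1 + 2 ^ d))" by simp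
      also have "\<dots> = ennreal (real (4 * (1 + 2 ^ d)))" by (rule ennreal_of_nat_eq_real_of_nat)
      finally show ?thesis by simp
    qed
    also have "\<dots> * ennreal (S.prob R) = ennreal (4 * (1 + 2 ^ d) * S.prob R)"
      by (rule ennreal_mult[symmetric]) auto
    finally show ?thesis by (subst (asm) ennreal_le_iff) auto
  qed
  have "escapes ?n (A k d) \<subseteq> R \<union> (\<Union>I\<in>?Is. escapes ?n (space Q - H I))"
  proof
    fix y assume y: "y \<in> escapes ?n (A k d)"
    then obtain i where i: "i \<in> index_cube d ?n" "sample y i \<notin> A k d" and ysp: "y \<in> space (S ?n)"
      by (auto simp: escapes_def)
    have x: "sample y i \<in> space Q" by (rule sample_space[OF i(1) ysp])
    from not_in_trunc_set[OF x i(2) d]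
    show "y \<in> R \<union> (\<Union>I\<in>?Is. escapes ?n (space Q - H I))"
    proof (elim disjE exE conjE)
      assume "level k < ennreal ((h (sample y i))\<^sup>2)"
      then have "(\<gamma> ?n)\<^sup>2 < (h (sample y i))\<^sup>2" by (auto simp: level_def ennreal_less_iff)
      also have "\<dots> \<le> square_sum ?n y"
        unfolding square_sum_def by (rule member_le_sum[OF i(1)]) (auto simp: finite_index_cube)
      finally show ?thesis using ysp by (auto simp: R_def) (smt (verit) zero_le_power2 field_sum_of_halves)
    next
      fix I assume "I \<subseteq> {1..d}" "I \<noteq> {}"
        "level k < of_nat ((2 ^ k) ^ card I) * partial_expectation d \<mu> I (g k (card I)) (sample y i)"
      then have "y \<in> escapes ?n (space Q - H I)" using ysp i x by (auto simp: escapes_def H_def)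
      then show ?thesis using \<open>I \<subseteq> {1..d}\<close> \<open>I \<noteq> {}\<close> by blast
    qed
  qed
  then have "S.prob (escapes ?n (A k d)) \<le> S.prob (R \<union> (\<Union>I\<in>?Is. escapes ?n (space Q - H I)))"
    using esc R by (intro S.finite_measure_mono sets.Un sets.finite_UN) auto
  also have "\<dots> \<le> S.prob R + S.prob (\<Union>I\<in>?Is. escapes ?n (space Q - H I))"
    using esc R by (intro measure_Un_le sets.finite_UN) auto
  also have "S.prob (\<Union>I\<in>?Is. escapes ?n (space Q - H I)) \<le> (\<Sum>I\<in>?Is. S.prob (escapes ?n (space Q - H I)))"
    using esc by (intro S.finite_measure_subadditive_finite) auto
  also have "\<dots> \<le> (\<Sum>I\<in>?Is. 4 * (1 + 2 ^ d) * S.prob R)" by (intro sum_mono each)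
  also have "\<dots> \<le> (\<Sum>I\<in>Pow {1..d}. 4 * (1 + 2 ^ d) * S.prob R)" by (intro sum_mono2) auto
  also have "\<dots> = 2 ^ d * (4 * (1 + 2 ^ d)) * S.prob R" by (simp add: card_Pow)
  finally show ?thesis unfolding R_def by (simp add: distrib_right)
qed

text \<open>
  The cube of side \<open>q m\<close> splits into \<open>q ^ d\<close> translates of the cube of side \<open>m\<close>.
\<close>

lemma escapes_cover:
  assumes B: "B \<in> sets Q" and m: "m \<ge> 1"
  shows "measure (S (q * m)) (escapes (q * m) B) \<le> q ^ d * measure (S m) (escapes m B)"
proof -
  interpret S: prob_space "S (q * m)" by (rule prob_S)
  interpret Sm: prob_space "S m" by (rule prob_S)
  let ?b = "{1..d} \<rightarrow>\<^sub>E {..<q}"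
  define t where "t b = (\<lambda>(\<kappa>, j). (\<kappa>, b \<kappa> * m + j))" for b :: "nat \<Rightarrow> nat"
  define E where "E b = {y\<in>space (S (q * m)). (\<lambda>p\<in>{1..d} \<times> {1..m}. y (t b p)) \<in> escapes m B}" for b
  have t_in: "t b \<in> {1..d} \<times> {1..m} \<rightarrow> {1..d} \<times> {1..q * m}" if b: "b \<in> ?b" for b
  proof
    fix p assume "p \<in> {1..d} \<times> {1..m}"
    then obtain \<kappa> j where p: "p = (\<kappa>, j)" "\<kappa> \<in> {1..d}" "j \<in> {1..m}" by auto
    have "b \<kappa> + 1 \<le> q" using PiE_mem[OF b p(2)] by auto
    then have "(b \<kappa> + 1) * m \<le> q * m" by (rule mult_le_mono1)
    then show "t b p \<in> {1..d} \<times> {1..q * m}" using p by (auto simp: t_def)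
  qed
  have t_inj: "inj_on (t b) ({1..d} \<times> {1..m})" for b by (auto simp: t_def inj_on_def)
  have E: "E b \<in> sets (S (q * m))" and E_prob: "S.prob (E b) = Sm.prob (escapes m B)" if b: "b \<in> ?b" for b
  proof -
    have "E b = (\<lambda>y. \<lambda>p\<in>{1..d} \<times> {1..m}. y (t b p)) -` escapes m B \<inter> space (S (q * m))" by (auto simp: E_def)
    then show "E b \<in> sets (S (q * m))"
      using measurable_sets[OF measurable_reindex[OF t_in[OF b]] escapes_measurable[OF B]] by simp
    show "S.prob (E b) = Sm.prob (escapes m B)"
      unfolding E_def measure_def
      by (subst emeasure_PiM_reindex[OF prob_\<mu> t_inj t_in[OF b] escapes_measurable[OF B]]) simp
  qed
  have "escapes (q * m) B \<subseteq> (\<Union>b\<in>?b. E b)"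
  proof
    fix y assume y: "y \<in> escapes (q * m) B"
    then obtain i where i: "i \<in> index_cube d (q * m)" "sample y i \<notin> B" and ysp: "y \<in> space (S (q * m))"
      by (auto simp: escapes_def)
    \<comment> \<open>The translate that contains \<open>i\<close>, and the position of \<open>i\<close> in it.\<close>
    define b where "b = (\<lambda>\<kappa>\<in>{1..d}. (i \<kappa> - 1) div m)"
    define j where "j = (\<lambda>\<kappa>\<in>{1..d}. (i \<kappa> - 1) mod m + 1)"
    have ik: "1 \<le> i \<kappa>" "i \<kappa> \<le> q * m" if "\<kappa> \<in> {1..d}" for \<kappa>
      using PiE_mem[OF i(1)[unfolded index_cube_def] that] by auto
    have b: "b \<in> ?b"
    proof (rule PiE_I)
      fix \<kappa> assume "\<kappa> \<in> {1..d}"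
      then have "i \<kappa> - 1 < q * m" using ik[of \<kappa>] by linarith
      then show "b \<kappa> \<in> {..<q}" using \<open>\<kappa> \<in> {1..d}\<close> by (simp add: b_def less_mult_imp_div_less)
    qed (auto simp: b_def)
    have j: "j \<in> index_cube d m"
      unfolding index_cube_def j_def using m by (auto simp: Suc_leI)
    have "sample (\<lambda>p\<in>{1..d} \<times> {1..m}. y (t b p)) j = sample y i"
      unfolding sample_def
    proof (intro restrict_ext)
      fix \<kappa> assume k: "\<kappa> \<in> {1..d}"
      have "j \<kappa> \<in> {1..m}" using PiE_mem[OF j[unfolded index_cube_def] k] .
      moreover have "b \<kappa> * m + j \<kappa> = i \<kappa>" using k ik[OF k] by (simp add: b_def j_def)
      ultimately show "(\<lambda>p\<in>{1..d} \<times> {1..m}. y (t b p)) (\<kappa>, j \<kappa>) = y (\<kappa>, i \<kappa>)"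
        using k by (simp add: t_def)
    qed
    then have "(\<lambda>p\<in>{1..d} \<times> {1..m}. y (t b p)) \<in> escapes m B"
      using j i measurable_space[OF measurable_reindex[OF t_in[OF b]] ysp]
      by (auto simp: escapes_def intro!: bexI[of _ j])
    then show "y \<in> (\<Union>b\<in>?b. E b)" using b ysp by (auto simp: E_def)
  qed
  then have "S.prob (escapes (q * m) B) \<le> S.prob (\<Union>b\<in>?b. E b)"
    using E by (intro S.finite_measure_mono sets.finite_UN finite_PiE) auto
  also have "\<dots> \<le> (\<Sum>b\<in>?b. S.prob (E b))"
    using E by (intro S.finite_measure_subadditive_finite finite_PiE) auto
  also have "\<dots> = (\<Sum>b\<in>?b. Sm.prob (escapes m B))" by (intro sum.cong refl E_prob)
  also have "\<dots> = q ^ d * Sm.prob (escapes m B)" by (simp add: card_PiE)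
  finally show ?thesis by simp
qed

end

section \<open>Summability of the truncated second moments\<close>

lemma nn_integral_weighted_suminf:
  fixes c :: "nat \<Rightarrow> ennreal"
  assumes [measurable]: "\<And>k. f k \<in> borel_measurable N"
  shows "(\<integral>\<^sup>+x. (\<Sum>k. c k * f k x) \<partial>N) = (\<Sum>k. c k * (\<integral>\<^sup>+x. f k x \<partial>N))"
  by (simp add: nn_integral_suminf nn_integral_cmult)

context truncation begin

lemma integral_below_level_finite:
  assumes "\<And>z. f z \<le> level k" shows "(\<integral>\<^sup>+x. f x \<partial>Q) < \<top>"
proof -
  interpret Q: prob_space Q by (rule prob_Q)
  have "(\<integral>\<^sup>+x. f x \<partial>Q) \<le> (\<integral>\<^sup>+x. level k \<partial>Q)" by (intro nn_integral_mono assms)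
  also have "\<dots> = level k" by (simp only: nn_integral_const Q.emeasure_space_1 mult_1_right)
  also have "\<dots> < \<top>" using level(2) by simp
  finally show ?thesis .
qed

text \<open>
  Paley-Zygmund for all \<open>d\<close> coordinates at once. A positive sum means that some tuple lies
  outside \<open>B\<close>. If that has small probability \<open>p\<close> and \<open>a\<close> is the level, the inequality
  \<open>m\<^sup>2 \<le> 4 (m\<^sup>2 + 2 ^ d a m) p\<close> forces \<open>m\<close> itself to be at most of the order \<open>a p\<close>.
\<close>

lemma full_mass_bound:
  assumes f: "f \<in> borel_measurable Q" "\<And>z. f z \<le> g k d z"
    and B: "B \<in> sets Q" "\<And>z. z \<in> B \<Longrightarrow> f z = 0"
    and small: "measure (S (2 ^ k)) (escapes (2 ^ k) B) \<le> 1 / 8"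
  shows "of_nat ((2 ^ k) ^ d) * (\<integral>\<^sup>+x. f x \<partial>Q)
    \<le> level k * ennreal (8 * 2 ^ d * measure (S (2 ^ k)) (escapes (2 ^ k) B))"
proof -
  let ?n = "2 ^ k :: nat"
  interpret S: prob_space "S ?n" by (rule prob_S)
  interpret Q: prob_space Q by (rule prob_Q)
  define m where "m = of_nat (?n ^ d) * (\<integral>\<^sup>+x. f x \<partial>Q)"
  define s where "s = sample_sum {1..d} ?n f"
  have s_meas: "s \<in> borel_measurable (S ?n)" unfolding s_def by (rule sample_sum_measurable[OF f(1)])
  have first: "(\<integral>\<^sup>+y. s y \<partial>S ?n) = m"
    unfolding s_def m_def using sample_sum_first_moment[OF prob_\<mu> _ f(1)] by simp
  have fin_f: "(\<integral>\<^sup>+x. f x \<partial>Q) < \<top>"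
    by (rule integral_below_level_finite[OF order_trans[OF f(2) g_le[OF d]]])
  have m_fin: "m < \<top>"
    unfolding m_def using fin_f of_nat_less_top[of "?n ^ d"] by (simp only: ennreal_mult_less_top) simp
  have second: "(\<integral>\<^sup>+y. (s y)\<^sup>2 \<partial>S ?n) \<le> m\<^sup>2 + of_nat (2 ^ card {1..d}) * (level k * m)"
    unfolding s_def
  proof (rule sample_sum_second_moment[OF prob_\<mu> _ f(1)])
    fix D x assume D: "D \<subset> {1..d}" and nz: "f x \<noteq> 0"
    have "g k d x \<noteq> 0" using nz f(2)[of x] by auto
    then have "x \<in> A k d" by (auto simp: g_def indicator_def)
    from partial_expectation_bound[OF this d _ _ f(2), of D]
    show "of_nat (?n ^ card D) * (\<integral>\<^sup>+u. f (merge D ({1..d} - D) (u, x)) \<partial>PiM D (\<lambda>_. \<mu>)) \<le> level k"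
      using D psubset_card_mono[OF _ D] by (auto simp: partial_expectation_def)
  qed (simp_all add: m_def)
  have PZ: "m\<^sup>2 \<le> 4 * ((m\<^sup>2 + of_nat (2 ^ card {1..d}) * (level k * m)) * emeasure (S ?n) {y\<in>space (S ?n). m < 2 * s y})"
    by (rule Paley_Zygmund_nn_integral[OF prob_S s_meas first _ second]) (use m_fin in simp)
  have "{y\<in>space (S ?n). m < 2 * s y} \<subseteq> escapes ?n B"
  proof
    fix y assume y: "y \<in> {y\<in>space (S ?n). m < 2 * s y}"
    then have "s y \<noteq> 0" by auto
    then obtain i where i: "i \<in> {1..d} \<rightarrow>\<^sub>E {1..?n}" "f (\<lambda>k\<in>{1..d}. y (k, i k)) \<noteq> 0"
      unfolding s_def sample_sum_def by (meson sum.neutral)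
    then have "sample y i \<notin> B" using B(2) by (auto simp: sample_def)
    then show "y \<in> escapes ?n B" using y i by (auto simp: escapes_def index_cube_def)
  qed
  then have em: "emeasure (S ?n) {y\<in>space (S ?n). m < 2 * s y} \<le> ennreal (S.prob (escapes ?n B))"
    unfolding S.emeasure_eq_measure[symmetric] by (intro emeasure_mono escapes_measurable B)
  have card_d: "card {1..d} = d" by simp
  have PZ': "m\<^sup>2 \<le> 4 * ((m\<^sup>2 + of_nat (2 ^ d) * (level k * m)) * ennreal (S.prob (escapes ?n B)))"
    by (rule order_trans[OF PZ[unfolded card_d]], intro mult_left_mono em) simp_all
  define r where "r = enn2real m"
  define P where "P = S.prob (escapes ?n B)"
  define a where "a = (\<gamma> (2 ^ k))\<^sup>2"
  have mr: "m = ennreal r" "r \<ge> 0" using m_fin by (simp_all add: r_def)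
  have P: "P \<ge> 0" "P \<le> 1 / 8" using small by (simp_all add: P_def)
  have a: "a > 0" using \<gamma>_pos[of "2 ^ k"] by (simp add: a_def)
  have two: "(of_nat (2 ^ d) :: ennreal) = ennreal (2 ^ d)" by (simp add: ennreal_of_nat_eq_real_of_nat)
  have "ennreal (r\<^sup>2) \<le> ennreal (4 * ((r\<^sup>2 + 2 ^ d * (a * r)) * P))"
  proof -
    have "(4::ennreal) = ennreal 4" by simp
    then have "4 * ((m\<^sup>2 + of_nat (2 ^ d) * (level k * m)) * ennreal P) = ennreal (4 * ((r\<^sup>2 + 2 ^ d * (a * r)) * P))"
      unfolding mr(1) two level_def a_def[symmetric] ennreal_power[OF mr(2)]
      using mr(2) P a by (simp only: ennreal_mult[symmetric] ennreal_plus[symmetric] mult_nonneg_nonneg add_nonneg_nonneg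
          zero_le_power zero_le_power2 zero_le_numeral less_imp_le)
    then show ?thesis using PZ'[folded P_def] mr by (simp add: ennreal_power)
  qed
  then have "r\<^sup>2 \<le> 4 * ((r\<^sup>2 + 2 ^ d * (a * r)) * P)"
    by (subst (asm) ennreal_le_iff) (use mr(2) P a in auto)
  then have "r * r \<le> r * (4 * P * r + 4 * 2 ^ d * a * P)" by (simp add: power2_eq_square algebra_simps)
  then have "r \<le> 4 * P * r + 4 * 2 ^ d * a * P"
    using mr(2) P a by (cases "r = 0") (auto simp: mult_le_cancel_left_pos)
  moreover have "4 * P * r \<le> 4 * (1 / 8) * r" using P mr(2) by (intro mult_right_mono mult_left_mono) auto
  ultimately have "r \<le> 2 * (4 * 2 ^ d * a * P)" by linarith
  also have "\<dots> = a * (8 * 2 ^ d * P)" by simp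
  finally have "r \<le> a * (8 * 2 ^ d * P)" .
  then have "m \<le> ennreal (a * (8 * 2 ^ d * P))" unfolding mr(1) by (rule ennreal_leI)
  also have "\<dots> = level k * ennreal (8 * 2 ^ d * P)"
    unfolding level_def a_def[symmetric] using a by (simp add: ennreal_mult'[symmetric])
  finally show ?thesis by (simp add: m_def P_def)
qed

definition weight :: "nat \<Rightarrow> real" where
  "weight k = 2 ^ (d * k) / (\<gamma> (2 ^ k))\<^sup>2"

lemma weight_pos: "weight k > 0"
  using \<gamma>_pos[of "2 ^ k"] by (simp add: weight_def)

lemma weight_le:
  assumes "of_nat ((2 ^ k) ^ d) * I \<le> level k * ennreal c" "c \<ge> 0"
  shows "ennreal (weight k) * I \<le> ennreal c"
proof -
  define a where "a = (\<gamma> (2 ^ k))\<^sup>2"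
  have a: "a > 0" using \<gamma>_pos[of "2 ^ k"] by (simp add: a_def)
  have "(of_nat ((2 ^ k) ^ d) :: ennreal) = ennreal (2 ^ (d * k))"
    by (simp add: ennreal_of_nat_eq_real_of_nat power_mult[symmetric] mult.commute del: of_nat_power)
  then have "ennreal (weight k) * I = ennreal (1 / a) * (of_nat ((2 ^ k) ^ d) * I)"
    using a by (simp add: weight_def a_def[symmetric] ennreal_mult'[symmetric] mult.assoc[symmetric])
  also have "\<dots> \<le> ennreal (1 / a) * (level k * ennreal c)" by (intro mult_left_mono assms) auto
  also have "\<dots> = ennreal c"
    using a assms by (simp add: level_def a_def[symmetric] ennreal_mult'[symmetric])
  finally show ?thesis .
qed

text \<open>
  Let \<open>B k\<close> be the set of points that enter the truncation sets for the first time at level \<open>Suc k\<close>.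
  A point that enters at level \<open>l\<close> contributes to the series for levels \<open>k \<ge> l\<close> only, and by the
  regularity of the weights these sum up to a multiple of the term at \<open>l\<close>. The points of \<open>B (Suc k)\<close>
  lie outside \<open>A (Suc k) d\<close>, so their share is controlled by escapes from a set of the preceding level.
\<close>

lemma summable_energy:
  fixes C :: real
  assumes C: "\<And>l. l \<ge> 1 \<Longrightarrow> summable (\<lambda>k. weight (l + k)) \<and> (\<Sum>k. weight (l + k)) \<le> C * weight l"
    and esc: "summable (\<lambda>k. measure (S (2 ^ Suc k)) (escapes (2 ^ Suc k) (A (Suc k) d)))"
  shows "(\<Sum>k. ennreal (weight (Suc k)) * (\<integral>\<^sup>+x. g (Suc k) d x \<partial>Q)) < \<infinity>"
proof -
  interpret Q: prob_space Q by (rule prob_Q)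
  define B where "B k = A (Suc k) d - (\<Union>j<k. A (Suc j) d)" for k
  have B[measurable]: "B k \<in> sets Q" for k unfolding B_def by (intro sets.Diff sets.finite_UN trunc_set_measurable) auto
  define f where "f k x = ennreal ((h x)\<^sup>2) * indicator (B k) x" for k x
  have f[measurable]: "f k \<in> borel_measurable Q" for k unfolding f_def by measurable
  have f_le: "f k x \<le> g (Suc k) d x" for k x by (auto simp: f_def g_def B_def indicator_def)
  have C0: "C \<ge> 0"
  proof -
    have "0 \<le> (\<Sum>k. weight (1 + k))" using C[of 1] weight_pos by (intro suminf_nonneg) (auto intro: less_imp_le)
    also have "\<dots> \<le> C * weight 1" using C[of 1] by simp
    finally show ?thesis using weight_pos[of 1] by (simp add: zero_le_mult_iff)
  qed
  have pointwise: "(\<Sum>k. ennreal (weight (Suc k)) * g (Suc k) d x)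
      \<le> ennreal C * (\<Sum>k. ennreal (weight (Suc k)) * f k x)" for x
  proof (cases "\<exists>k. x \<in> A (Suc k) d")
    case False
    then show ?thesis by (simp add: g_def)
  next
    case True
    define t where "t = (LEAST k. x \<in> A (Suc k) d)"
    have t: "x \<in> A (Suc t) d" unfolding t_def by (rule LeastI_ex[OF True])
    have t': "x \<notin> A (Suc k) d" if "k < t" for k using not_less_Least[OF that[unfolded t_def]] .
    have "x \<in> B t" using t t' by (auto simp: B_def)
    then have ft: "f t x = ennreal ((h x)\<^sup>2)" by (simp add: f_def)
    have "(\<Sum>k. ennreal (weight (Suc k)) * g (Suc k) d x) \<le> ennreal (C * weight (Suc t)) * ennreal ((h x)\<^sup>2)"
    proof (rule suminf_le_const)
      fix n
      have "(\<Sum>k<n. ennreal (weight (Suc k)) * g (Suc k) d x)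
        \<le> (\<Sum>k<n + t. ennreal (weight (Suc k)) * g (Suc k) d x)"
        by (intro sum_mono2) auto
      also have "\<dots> = (\<Sum>k\<in>{t..<n + t}. ennreal (weight (Suc k)) * g (Suc k) d x)"
        using t' by (intro sum.mono_neutral_right) (auto simp: g_def)
      also have "\<dots> \<le> (\<Sum>k\<in>{t..<n + t}. ennreal (weight (Suc k)) * ennreal ((h x)\<^sup>2))"
        by (intro sum_mono mult_left_mono) (auto simp: g_def indicator_def)
      also have "\<dots> = (\<Sum>k<n. ennreal (weight (Suc t + k))) * ennreal ((h x)\<^sup>2)"
        using sum.shift_bounds_nat_ivl[of "\<lambda>k. ennreal (weight (Suc k))" 0 t n]
        by (simp add: sum_distrib_right[symmetric] lessThan_atLeast0 add.commute)
      also have "(\<Sum>k<n. ennreal (weight (Suc t + k))) = ennreal (\<Sum>k<n. weight (Suc t + k))"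
        using weight_pos by (intro sum_ennreal) (auto intro: less_imp_le)
      also have "\<dots> \<le> ennreal (C * weight (Suc t))"
      proof (rule ennreal_leI)
        have "(\<Sum>k<n. weight (Suc t + k)) \<le> (\<Sum>k. weight (Suc t + k))"
          using C[of "Suc t"] weight_pos by (intro sum_le_suminf) (auto intro: less_imp_le)
        also have "\<dots> \<le> C * weight (Suc t)" using C[of "Suc t"] by simp
        finally show "(\<Sum>k<n. weight (Suc t + k)) \<le> C * weight (Suc t)" .
      qed
      finally show "(\<Sum>k<n. ennreal (weight (Suc k)) * g (Suc k) d x) \<le> ennreal (C * weight (Suc t)) * ennreal ((h x)\<^sup>2)"
        by this (rule mult_right_mono, simp_all)
    qed auto
    also have "\<dots> = ennreal C * (ennreal (weight (Suc t)) * f t x)"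
      using C0 by (simp add: ft ennreal_mult' mult.assoc)
    also have "\<dots> \<le> ennreal C * (\<Sum>k. ennreal (weight (Suc k)) * f k x)"
    proof (rule mult_left_mono)
      show "ennreal (weight (Suc t)) * f t x \<le> (\<Sum>k. ennreal (weight (Suc k)) * f k x)"
        using sum_le_suminf[of "\<lambda>k. ennreal (weight (Suc k)) * f k x" "{t}"] by simp
    qed simp
    finally show ?thesis .
  qed
  define p where "p k = measure (S (2 ^ Suc k)) (escapes (2 ^ Suc k) (A k d))" for k
  have p_le: "p (Suc k) \<le> 2 ^ d * measure (S (2 ^ Suc k)) (escapes (2 ^ Suc k) (A (Suc k) d))" for k
    using escapes_cover[OF trunc_set_measurable, of "2 ^ Suc k" 2 "Suc k" d] by (simp add: p_def)
  have p_sum: "summable (\<lambda>k. p (Suc k))"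
    by (rule summable_comparison_test'[OF summable_mult[OF esc, of "2 ^ d"], of 0])
      (use p_le in \<open>simp add: p_def\<close>)
  then have "(\<lambda>k. p (Suc k)) \<longlonglongrightarrow> 0" by (rule summable_LIMSEQ_zero)
  then have "\<forall>\<^sub>F k in sequentially. p (Suc k) < 1 / 8" by (intro order_tendstoD) auto
  then obtain k0 where k0: "\<And>k. k \<ge> k0 \<Longrightarrow> p (Suc k) < 1 / 8" by (auto simp: eventually_sequentially)
  define \<rho> where "\<rho> k = ennreal (weight (Suc k)) * (\<integral>\<^sup>+x. f k x \<partial>Q)" for k
  have rho_small: "\<rho> (Suc k) \<le> ennreal (8 * 2 ^ d * p (Suc k))" if "k \<ge> k0" for k
    unfolding \<rho>_def p_def
  proof (intro weight_le full_mass_bound[where f = "f (Suc k)"] f_le f trunc_set_measurable)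
    show "measure (S (2 ^ Suc (Suc k))) (escapes (2 ^ Suc (Suc k)) (A (Suc k) d)) \<le> 1 / 8"
      using k0[OF that] by (simp add: p_def)
    show "f (Suc k) z = 0" if "z \<in> A (Suc k) d" for z
      using that by (auto simp: f_def B_def indicator_def)
  qed auto
  have rho_fin: "\<rho> k < \<top>" for k
  proof -
    have "(\<integral>\<^sup>+x. f k x \<partial>Q) < \<top>"
      by (rule integral_below_level_finite[OF order_trans[OF f_le g_le[OF d]]])
    then show ?thesis by (simp add: \<rho>_def ennreal_mult_less_top)
  qed
  have rho_sum: "(\<Sum>k. \<rho> k) < \<top>"
  proof -
    have "summable (\<lambda>k. enn2real (\<rho> k))"
    proof (subst summable_Suc_iff[symmetric], rule summable_comparison_test'[OF summable_mult[OF p_sum, of "8 * 2 ^ d"], of k0])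
      fix k assume "k \<ge> k0"
      have "enn2real (\<rho> (Suc k)) \<le> 8 * 2 ^ d * p (Suc k)"
        by (rule enn2real_leI) (use rho_small[OF \<open>k \<ge> k0\<close>] in \<open>simp_all add: p_def\<close>)
      then show "norm (enn2real (\<rho> (Suc k))) \<le> 8 * 2 ^ d * p (Suc k)" by simp
    qed
    then have "(\<Sum>k. ennreal (enn2real (\<rho> k))) = ennreal (\<Sum>k. enn2real (\<rho> k))"
      by (intro suminf_ennreal_eq) auto
    then show ?thesis using rho_fin by simp
  qed
  have "(\<Sum>k. ennreal (weight (Suc k)) * (\<integral>\<^sup>+x. g (Suc k) d x \<partial>Q))
    = (\<integral>\<^sup>+x. (\<Sum>k. ennreal (weight (Suc k)) * g (Suc k) d x) \<partial>Q)"
    by (rule nn_integral_weighted_suminf[OF g_measurable, symmetric])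
  also have "\<dots> \<le> (\<integral>\<^sup>+x. ennreal C * (\<Sum>k. ennreal (weight (Suc k)) * f k x) \<partial>Q)"
    by (intro nn_integral_mono pointwise)
  also have "\<dots> = ennreal C * (\<integral>\<^sup>+x. (\<Sum>k. ennreal (weight (Suc k)) * f k x) \<partial>Q)"
    by (intro nn_integral_cmult borel_measurable_suminf_order borel_measurable_times_ennreal f) simp
  also have "\<dots> = ennreal C * (\<Sum>k. \<rho> k)"
    unfolding \<rho>_def by (simp only: nn_integral_weighted_suminf[OF f])
  also have "\<dots> < \<infinity>" using rho_sum by (simp add: ennreal_mult_less_top)
  finally show ?thesis .
qed

end

section \<open>Independent samples and independent blocks\<close>

text \<open>
  Stated for the complements \<open>F k\<close>: as almost surely all but finitely many of them occur, some tail
  intersection has positive probability \<open>p\<close>. By independence and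
  \<open>1 - x \<le> exp (- x)\<close>, the partial sums beyond that point are at most \<open>- ln p\<close>.
\<close>

lemma (in prob_space) second_Borel_Cantelli_complements:
  assumes indep: "indep_events F (UNIV :: nat set)"
    and ev: "AE \<omega> in M. \<forall>\<^sub>F k in sequentially. \<omega> \<in> F k"
  shows "summable (\<lambda>k. 1 - prob (F k))"
proof -
  have F[measurable]: "F k \<in> sets M" for k using indep by (auto simp: indep_events_def)
  have "\<exists>N. prob (\<Inter>k\<in>{N..}. F k) > 0"
  proof (rule ccontr)
    assume "\<nexists>N. prob (\<Inter>k\<in>{N..}. F k) > 0"
    then have "prob (\<Inter>k\<in>{N..}. F k) = 0" for N
      by (metis measure_nonneg order_antisym_conv not_less)
    then have "AE \<omega> in M. \<omega> \<notin> (\<Inter>k\<in>{N..}. F k)" for N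
      by (subst prob_eq_0[symmetric]) auto
    then have "AE \<omega> in M. \<forall>N. \<omega> \<notin> (\<Inter>k\<in>{N..}. F k)" unfolding AE_all_countable by blast
    with ev have "AE \<omega> in M. False"
    proof eventually_elim
      fix \<omega> assume "\<forall>\<^sub>F k in sequentially. \<omega> \<in> F k" "\<forall>N. \<omega> \<notin> (\<Inter>k\<in>{N..}. F k)"
      then show False by (auto simp: eventually_sequentially)
    qed
    then show False by (simp add: AE_False emeasure_space_1)
  qed
  then obtain N where N: "prob (\<Inter>k\<in>{N..}. F k) > 0" by blast
  define p where "p = prob (\<Inter>k\<in>{N..}. F k)"
  have "summable (\<lambda>k. 1 - prob (F (k + N)))"
  proof (rule summableI_nonneg_bounded)
    show "0 \<le> 1 - prob (F (k + N))" for k by simp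
    fix n
    show "(\<Sum>k<n. 1 - prob (F (k + N))) \<le> - ln p"
    proof (cases "n = 0")
      case True
      have "p \<le> 1" unfolding p_def by simp
      then show ?thesis using N True by (simp add: p_def)
    next
      case False
      have "p \<le> prob (\<Inter>k\<in>(\<lambda>k. k + N) ` {..<n}. F k)"
        unfolding p_def using False by (intro finite_measure_mono) (auto intro!: sets.finite_INT)
      also have "\<dots> = (\<Prod>k\<in>(\<lambda>k. k + N) ` {..<n}. prob (F k))"
        by (rule indep[unfolded indep_events_def, THEN conjunct2, rule_format]) (use False in auto)
      also have "\<dots> = (\<Prod>k<n. prob (F (k + N)))"
        by (subst prod.reindex) (auto simp: inj_on_def)
      also have "\<dots> \<le> (\<Prod>k<n. exp (- (1 - prob (F (k + N)))))"
      proof (intro prod_mono conjI)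
        fix k
        show "prob (F (k + N)) \<le> exp (- (1 - prob (F (k + N))))"
          using exp_ge_add_one_self[of "- (1 - prob (F (k + N)))"] by simp
      qed simp
      also have "\<dots> = exp (- (\<Sum>k<n. 1 - prob (F (k + N))))"
        by (simp add: exp_sum sum_negf[symmetric] del: minus_diff_eq)
      finally have "ln p \<le> ln (exp (- (\<Sum>k<n. 1 - prob (F (k + N)))))"
        using N by (subst ln_le_cancel_iff) (simp_all add: p_def)
      then show ?thesis by simp
    qed
  qed
  then show ?thesis by (subst (asm) summable_iff_shift)
qed

locale iid_family = prob_space M for M :: "'w measure" +
  fixes Y :: "'i \<Rightarrow> 'w \<Rightarrow> 'a" and K :: "'i set" and \<mu> :: "'a measure"
  assumes indep_Y: "indep_vars (\<lambda>_. \<mu>) Y K"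
    and distr_Y: "j \<in> K \<Longrightarrow> distr M \<mu> (Y j) = \<mu>"
    and K_nonempty: "K \<noteq> {}"
begin

lemma Y_measurable: "j \<in> K \<Longrightarrow> Y j \<in> measurable M \<mu>"
  using indep_Y unfolding indep_vars_def by blast

lemma prob_law: "prob_space \<mu>"
proof -
  obtain j where "j \<in> K" using K_nonempty by auto
  then show ?thesis using prob_space_distr[OF Y_measurable, of j] distr_Y by simp
qed

lemma subfamily_measurable:
  "t \<in> I \<rightarrow> K \<Longrightarrow> (\<lambda>\<omega>. \<lambda>i\<in>I. Y (t i) \<omega>) \<in> measurable M (PiM I (\<lambda>_. \<mu>))"
  by (intro measurable_restrict Y_measurable) auto

lemma distr_subfamily:
  assumes "inj_on t I" "t \<in> I \<rightarrow> K"
  shows "distr M (PiM I (\<lambda>_. \<mu>)) (\<lambda>\<omega>. \<lambda>i\<in>I. Y (t i) \<omega>) = PiM I (\<lambda>_. \<mu>)"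
proof -
  have whole: "distr M (PiM K (\<lambda>_. \<mu>)) (\<lambda>\<omega>. \<lambda>i\<in>K. Y i \<omega>) = PiM K (\<lambda>_. \<mu>)"
  proof -
    have "distr M (PiM K (\<lambda>_. \<mu>)) (\<lambda>\<omega>. \<lambda>i\<in>K. Y i \<omega>) = PiM K (\<lambda>i. distr M \<mu> (Y i))"
      using indep_Y by (subst (asm) indep_vars_iff_distr_eq_PiM'[OF K_nonempty Y_measurable])
    also have "\<dots> = PiM K (\<lambda>_. \<mu>)" by (intro PiM_cong refl distr_Y)
    finally show ?thesis .
  qed
  have "PiM I (\<lambda>_. \<mu>) = distr (PiM K (\<lambda>_. \<mu>)) (PiM I (\<lambda>_. \<mu>)) (\<lambda>y. \<lambda>i\<in>I. y (t i))"
    using distr_PiM_reindex[of K "\<lambda>_. \<mu>" t I] prob_law assms by simp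
  also have "\<dots> = distr (distr M (PiM K (\<lambda>_. \<mu>)) (\<lambda>\<omega>. \<lambda>i\<in>K. Y i \<omega>)) (PiM I (\<lambda>_. \<mu>)) (\<lambda>y. \<lambda>i\<in>I. y (t i))"
    by (simp only: whole)
  also have "\<dots> = distr M (PiM I (\<lambda>_. \<mu>)) ((\<lambda>y. \<lambda>i\<in>I. y (t i)) \<circ> (\<lambda>\<omega>. \<lambda>i\<in>K. Y i \<omega>))"
    by (rule distr_distr[OF measurable_reindex[OF assms(2)] subfamily_measurable]) simp
  also have "\<dots> = distr M (PiM I (\<lambda>_. \<mu>)) (\<lambda>\<omega>. \<lambda>i\<in>I. Y (t i) \<omega>)"
  proof (rule distr_cong[OF refl refl])
    fix \<omega>
    show "((\<lambda>y. \<lambda>i\<in>I. y (t i)) \<circ> (\<lambda>\<omega>. \<lambda>i\<in>K. Y i \<omega>)) \<omega> = (\<lambda>i\<in>I. Y (t i) \<omega>)"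
      unfolding o_def using assms(2) by (intro restrict_ext) auto
  qed
  finally show ?thesis by simp
qed

lemma prob_subfamily:
  assumes "inj_on t I" "t \<in> I \<rightarrow> K" "B \<in> sets (PiM I (\<lambda>_. \<mu>))"
  shows "prob {\<omega>\<in>space M. (\<lambda>i\<in>I. Y (t i) \<omega>) \<in> B} = measure (PiM I (\<lambda>_. \<mu>)) B"
proof -
  have "measure (PiM I (\<lambda>_. \<mu>)) B = measure (distr M (PiM I (\<lambda>_. \<mu>)) (\<lambda>\<omega>. \<lambda>i\<in>I. Y (t i) \<omega>)) B"
    using distr_subfamily[OF assms(1,2)] by simp
  also have "\<dots> = prob ((\<lambda>\<omega>. \<lambda>i\<in>I. Y (t i) \<omega>) -` B \<inter> space M)"
    by (rule measure_distr[OF subfamily_measurable[OF assms(2)] assms(3)])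
  also have "(\<lambda>\<omega>. \<lambda>i\<in>I. Y (t i) \<omega>) -` B \<inter> space M = {\<omega>\<in>space M. (\<lambda>i\<in>I. Y (t i) \<omega>) \<in> B}" by auto
  finally show ?thesis by simp
qed

lemma nn_integral_subfamily:
  assumes "inj_on t I" "t \<in> I \<rightarrow> K" "f \<in> borel_measurable (PiM I (\<lambda>_. \<mu>))"
  shows "(\<integral>\<^sup>+\<omega>. f (\<lambda>i\<in>I. Y (t i) \<omega>) \<partial>M) = (\<integral>\<^sup>+x. f x \<partial>PiM I (\<lambda>_. \<mu>))"
  using nn_integral_distr[OF subfamily_measurable[OF assms(2)], of f] assms(3) distr_subfamily[OF assms(1,2)]
  by simp

lemma events_of_subfamily:
  assumes "t \<in> I \<rightarrow> K" "B \<in> sets (PiM I (\<lambda>_. \<mu>))"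
  shows "{\<omega>\<in>space M. (\<lambda>i\<in>I. Y (t i) \<omega>) \<in> B} \<in> events"
proof -
  have "{\<omega>\<in>space M. (\<lambda>i\<in>I. Y (t i) \<omega>) \<in> B} = (\<lambda>\<omega>. \<lambda>i\<in>I. Y (t i) \<omega>) -` B \<inter> space M" by auto
  then show ?thesis using measurable_sets[OF subfamily_measurable[OF assms(1)] assms(2)] by simp
qed

lemma summable_of_disjoint_blocks:
  fixes t :: "nat \<Rightarrow> 'b \<Rightarrow> 'i" and I :: "nat \<Rightarrow> 'b set"
  assumes t: "\<And>k. inj_on (t k) (I k)" "\<And>k. t k \<in> I k \<rightarrow> K"
    and disj: "disjoint_family (\<lambda>k. t k ` I k)"
    and B: "\<And>k. B k \<in> sets (PiM (I k) (\<lambda>_. \<mu>))"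
    and ev: "AE \<omega> in M. \<forall>\<^sub>F k in sequentially. (\<lambda>i\<in>I k. Y (t k i) \<omega>) \<notin> B k"
  shows "summable (\<lambda>k. measure (PiM (I k) (\<lambda>_. \<mu>)) (B k))"
proof -
  define F where "F k = {\<omega>\<in>space M. (\<lambda>i\<in>I k. Y (t k i) \<omega>) \<notin> B k}" for k
  have indep: "indep_vars (\<lambda>k. PiM (t k ` I k) (\<lambda>_. \<mu>)) (\<lambda>k \<omega>. restrict (\<lambda>i. Y i \<omega>) (t k ` I k)) UNIV"
    by (rule indep_vars_restrict[OF indep_Y _ disj]) (use t in auto)
  have "indep_events (\<lambda>k. {\<omega>\<in>space M. (\<lambda>i\<in>I k. restrict (\<lambda>i. Y i \<omega>) (t k ` I k) (t k i)) \<notin> B k}) UNIV"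
  proof (rule indep_eventsI_indep_vars[OF indep, where P = "\<lambda>k x. (\<lambda>i\<in>I k. x (t k i)) \<notin> B k"])
    fix k
    let ?P = "PiM (t k ` I k) (\<lambda>_. \<mu>)"
    have m: "(\<lambda>x. \<lambda>i\<in>I k. x (t k i)) \<in> measurable ?P (PiM (I k) (\<lambda>_. \<mu>))"
      by (rule measurable_reindex) auto
    have "{x\<in>space ?P. (\<lambda>i\<in>I k. x (t k i)) \<notin> B k}
      = (\<lambda>x. \<lambda>i\<in>I k. x (t k i)) -` (space (PiM (I k) (\<lambda>_. \<mu>)) - B k) \<inter> space ?P"
      using measurable_space[OF m] by auto
    then show "{x\<in>space ?P. (\<lambda>i\<in>I k. x (t k i)) \<notin> B k} \<in> sets ?P"
      using measurable_sets[OF m sets.compl_sets[OF B]] by simp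
  qed
  also have "(\<lambda>k. {\<omega>\<in>space M. (\<lambda>i\<in>I k. restrict (\<lambda>i. Y i \<omega>) (t k ` I k) (t k i)) \<notin> B k}) = F"
    by (rule ext) (simp add: F_def cong: restrict_cong)
  finally have indep_F: "indep_events F UNIV" .
  have "AE \<omega> in M. \<forall>\<^sub>F k in sequentially. \<omega> \<in> F k"
    using ev AE_space
  proof eventually_elim
    fix \<omega> assume "\<forall>\<^sub>F k in sequentially. (\<lambda>i\<in>I k. Y (t k i) \<omega>) \<notin> B k" "\<omega> \<in> space M"
    then show "\<forall>\<^sub>F k in sequentially. \<omega> \<in> F k" by (auto simp: F_def)
  qed
  from second_Borel_Cantelli_complements[OF indep_F this]
  have "summable (\<lambda>k. 1 - prob (F k))" .
  moreover have "1 - prob (F k) = measure (PiM (I k) (\<lambda>_. \<mu>)) (B k)" for k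
  proof -
    have "F k = space M - {\<omega>\<in>space M. (\<lambda>i\<in>I k. Y (t k i) \<omega>) \<in> B k}" by (auto simp: F_def)
    then show ?thesis
      using prob_compl[OF events_of_subfamily[OF t(2) B]] prob_subfamily[OF t B] by simp
  qed
  ultimately show ?thesis by simp
qed

end

lemma doubling_iterate:
  fixes \<gamma> :: "nat \<Rightarrow> real"
  assumes "\<And>n. n \<ge> 1 \<Longrightarrow> \<gamma> (2 * n) \<le> C * \<gamma> n" "C \<ge> 0"
  shows "\<gamma> (2 ^ (k + s)) \<le> C ^ s * \<gamma> (2 ^ k)"
proof (induction s)
  case (Suc s)
  have "\<gamma> (2 ^ (k + Suc s)) \<le> C * \<gamma> (2 ^ (k + s))" using assms(1)[of "2 ^ (k + s)"] by simp
  also have "\<dots> \<le> C * (C ^ s * \<gamma> (2 ^ k))" by (intro mult_left_mono Suc assms)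
  finally show ?case by (simp add: mult.assoc)
qed simp

text \<open>
  The index type of the sample is left open, so that a single sequence and \<open>d\<close> independent
  sequences are treated alike.
\<close>

locale sampled_kernel = truncation d \<mu> h \<gamma> + iid_family M Y K \<mu>
  for d :: nat and \<mu> :: "'a measure" and h \<gamma> and M :: "'w measure" and Y :: "'i \<Rightarrow> 'w \<Rightarrow> 'a" and K
begin

text \<open>
  The sums of squares over the blocks are independent of each other and dominated by \<open>V\<close> at a later time, \<open>s\<close>
  doublings away. They are therefore eventually below \<open>(\<gamma> (2 ^ k))\<^sup>2 / 2\<close>, and the second
  Borel-Cantelli lemma applies.
\<close>

lemma summable_escapes_of_blocks:
  fixes t :: "nat \<Rightarrow> nat \<times> nat \<Rightarrow> 'i" and C :: real
  assumes C: "C > 0" "\<And>n. n \<ge> 1 \<Longrightarrow> \<gamma> (2 * n) \<le> C * \<gamma> n"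
    and t: "\<And>k. inj_on (t k) ({1..d} \<times> {1..2 ^ k})" "\<And>k. t k \<in> {1..d} \<times> {1..2 ^ k} \<rightarrow> K"
    and disj: "disjoint_family (\<lambda>k. t k ` ({1..d} \<times> {1..2 ^ k}))"
    and conv: "AE \<omega> in M. (\<lambda>n. 1 / (\<gamma> n)\<^sup>2 * V n \<omega>) \<longlonglongrightarrow> 0"
    and dom: "\<And>k \<omega>. square_sum (2 ^ k) (\<lambda>p\<in>{1..d} \<times> {1..2 ^ k}. Y (t k p) \<omega>) \<le> V (2 ^ (k + s)) \<omega>"
  shows "summable (\<lambda>k. measure (S (2 ^ k)) (escapes (2 ^ k) (A k d)))"
proof -
  define R where "R k = {y\<in>space (S (2 ^ k)). (\<gamma> (2 ^ k))\<^sup>2 / 2 < square_sum (2 ^ k) y}" for k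
  have R: "R k \<in> sets (S (2 ^ k))" for k
    unfolding R_def using square_sum_measurable by measurable
  have "AE \<omega> in M. \<forall>\<^sub>F k in sequentially. (\<lambda>p\<in>{1..d} \<times> {1..2 ^ k}. Y (t k p) \<omega>) \<notin> R k"
    using conv
  proof eventually_elim
    fix \<omega> assume lim: "(\<lambda>n. 1 / (\<gamma> n)\<^sup>2 * V n \<omega>) \<longlonglongrightarrow> 0"
    have "strict_mono (\<lambda>k. 2 ^ (k + s) :: nat)" by (simp add: strict_mono_def)
    from LIMSEQ_subseq_LIMSEQ[OF lim this]
    have "(\<lambda>k. 1 / (\<gamma> (2 ^ (k + s)))\<^sup>2 * V (2 ^ (k + s)) \<omega>) \<longlonglongrightarrow> 0" by (simp add: o_def)
    then have "\<forall>\<^sub>F k in sequentially. 1 / (\<gamma> (2 ^ (k + s)))\<^sup>2 * V (2 ^ (k + s)) \<omega> < 1 / (2 * (C ^ s)\<^sup>2)"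
      using C by (intro order_tendstoD) auto
    then show "\<forall>\<^sub>F k in sequentially. (\<lambda>p\<in>{1..d} \<times> {1..2 ^ k}. Y (t k p) \<omega>) \<notin> R k"
    proof eventually_elim
      fix k assume *: "1 / (\<gamma> (2 ^ (k + s)))\<^sup>2 * V (2 ^ (k + s)) \<omega> < 1 / (2 * (C ^ s)\<^sup>2)"
      have g: "\<gamma> (2 ^ (k + s)) > 0" by (rule \<gamma>_pos) simp
      have "\<gamma> (2 ^ (k + s)) \<le> C ^ s * \<gamma> (2 ^ k)"
        by (rule doubling_iterate) (use C in auto)
      then have "(\<gamma> (2 ^ (k + s)))\<^sup>2 \<le> (C ^ s * \<gamma> (2 ^ k))\<^sup>2" using g by (intro power_mono) auto
      then have sq: "(\<gamma> (2 ^ (k + s)))\<^sup>2 \<le> (C ^ s)\<^sup>2 * (\<gamma> (2 ^ k))\<^sup>2" by (simp only: power_mult_distrib)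
      have "V (2 ^ (k + s)) \<omega> < 1 / (2 * (C ^ s)\<^sup>2) * (\<gamma> (2 ^ (k + s)))\<^sup>2"
        using * g by (simp add: pos_divide_less_eq)
      also have "\<dots> \<le> 1 / (2 * (C ^ s)\<^sup>2) * ((C ^ s)\<^sup>2 * (\<gamma> (2 ^ k))\<^sup>2)"
        by (intro mult_left_mono sq) auto
      also have "\<dots> = (\<gamma> (2 ^ k))\<^sup>2 / 2" using C by simp
      finally show "(\<lambda>p\<in>{1..d} \<times> {1..2 ^ k}. Y (t k p) \<omega>) \<notin> R k"
        using dom[of k \<omega>] unfolding R_def by simp
    qed
  qed
  from summable_of_disjoint_blocks[OF t disj R this]
  have "summable (\<lambda>k. measure (S (2 ^ k)) (R k))" .
  from summable_mult[OF this, of "1 + 2 ^ d * (4 * (1 + 2 ^ d))"]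
  show ?thesis
    by (rule summable_comparison_test'[of _ 0])
      (use escape_forces_large_square_sum in \<open>simp add: R_def\<close>)
qed

end

section \<open>Increasing multiindices against decoupled ones\<close>

text \<open>
  This counts the colourings that colour a given multiindex correctly.
\<close>

lemma card_extensions:
  assumes "finite N" "T \<subseteq> N" "g \<in> T \<rightarrow> D" "finite D"
  shows "card {c \<in> N \<rightarrow>\<^sub>E D. \<forall>x\<in>T. c x = g x} = card D ^ (card N - card T)"
proof -
  have "bij_betw (\<lambda>c. restrict c (N - T)) {c \<in> N \<rightarrow>\<^sub>E D. \<forall>x\<in>T. c x = g x} ((N - T) \<rightarrow>\<^sub>E D)"
  proof (rule bij_betwI[where g = "\<lambda>c. \<lambda>x\<in>N. if x \<in> T then g x else c x"])
    show "(\<lambda>c. restrict c (N - T)) \<in> {c \<in> N \<rightarrow>\<^sub>E D. \<forall>x\<in>T. c x = g x} \<rightarrow> (N - T) \<rightarrow>\<^sub>E D"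
      by (auto simp: PiE_iff)
    show "(\<lambda>c. \<lambda>x\<in>N. if x \<in> T then g x else c x) \<in> ((N - T) \<rightarrow>\<^sub>E D) \<rightarrow> {c \<in> N \<rightarrow>\<^sub>E D. \<forall>x\<in>T. c x = g x}"
      using assms by (auto simp: PiE_iff subset_iff Pi_iff)
    fix c assume "c \<in> {c \<in> N \<rightarrow>\<^sub>E D. \<forall>x\<in>T. c x = g x}"
    then show "(\<lambda>x\<in>N. if x \<in> T then g x else restrict c (N - T) x) = c"
      by (auto simp: fun_eq_iff PiE_iff extensional_def)
  next
    fix c assume "c \<in> (N - T) \<rightarrow>\<^sub>E D"
    then show "restrict (\<lambda>x\<in>N. if x \<in> T then g x else c x) (N - T) = c"
      by (auto simp: fun_eq_iff PiE_iff extensional_def)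
  qed
  then have "card {c \<in> N \<rightarrow>\<^sub>E D. \<forall>x\<in>T. c x = g x} = card ((N - T) \<rightarrow>\<^sub>E D)" by (rule bij_betw_same_card)
  also have "\<dots> = card D ^ (card N - card T)"
    using assms by (simp add: card_PiE card_Diff_subset finite_subset)
  finally show ?thesis .
qed

text \<open>
  Row \<open>\<kappa>\<close> of an array with row length \<open>m\<close> is sent to the \<open>\<kappa>\<close>-th of the consecutive blocks of length \<open>m\<close>
  that start after \<open>b\<close>. Choosing one entry from each row thus gives an increasing multiindex.
\<close>

definition ladder :: "nat \<Rightarrow> nat \<Rightarrow> nat \<times> nat \<Rightarrow> nat" where
  "ladder b m = (\<lambda>(\<kappa>, j). b + (\<kappa> - 1) * m + j)"

lemma inj_on_ladder: "inj_on (ladder b m) ({1..d} \<times> {1..m})"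
proof (rule inj_onI)
  fix p q assume pq: "p \<in> {1..d} \<times> {1..m}" "q \<in> {1..d} \<times> {1..m}" "ladder b m p = ladder b m q"
  obtain \<kappa> j \<kappa>' j' where p: "p = (\<kappa>, j)" and q: "q = (\<kappa>', j')" by (cases p, cases q)
  have j: "1 \<le> j" "j \<le> m" "1 \<le> j'" "j' \<le> m" "1 \<le> \<kappa>" "1 \<le> \<kappa>'" using pq p q by auto
  have "(\<kappa> - 1) * m + (j - 1) = (\<kappa>' - 1) * m + (j' - 1)" using pq(3) p q j by (simp add: ladder_def)
  then have eq: "(j - 1) + (\<kappa> - 1) * m = (j' - 1) + (\<kappa>' - 1) * m" by (simp add: add.commute)
  have quot: "(a + c * m) div m = c" if "a < m" for a c :: nat using that by simp
  have "((j - 1) + (\<kappa> - 1) * m) div m = \<kappa> - 1" "((j' - 1) + (\<kappa>' - 1) * m) div m = \<kappa>' - 1"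
    by (rule quot, use j in linarith)+
  then have k: "\<kappa> - 1 = \<kappa>' - 1" using eq by simp
  then have "j - 1 = j' - 1" using eq by simp
  with k j have "\<kappa> = \<kappa>'" "j = j'" by linarith+
  then show "p = q" using p q by simp
qed

lemma ladder_range:
  assumes "\<kappa> \<in> {1..d}" "j \<in> {1..m}"
  shows "b + 1 \<le> ladder b m (\<kappa>, j)" "ladder b m (\<kappa>, j) \<le> b + d * m"
proof -
  have "(\<kappa> - 1) * m + m = \<kappa> * m" using assms by (cases \<kappa>) auto
  moreover have "\<kappa> * m \<le> d * m" using assms by (intro mult_le_mono1) auto
  moreover have "ladder b m (\<kappa>, j) = b + ((\<kappa> - 1) * m + j)" by (simp add: ladder_def)
  moreover have "j \<le> m" using assms by simp
  ultimately show "ladder b m (\<kappa>, j) \<le> b + d * m" by linarith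
qed (use assms in \<open>simp add: ladder_def\<close>)

lemma ladder_simplex:
  assumes i: "i \<in> index_cube d m" and n: "b + d * m \<le> n"
  shows "(\<lambda>\<kappa>\<in>{1..d}. ladder b m (\<kappa>, i \<kappa>)) \<in> index_simplex d n"
proof -
  have i_mem: "i \<kappa> \<in> {1..m}" if "\<kappa> \<in> {1..d}" for \<kappa>
    using PiE_mem[OF i[unfolded index_cube_def] that] .
  have "ladder b m (\<kappa>, i \<kappa>) \<in> {1..n}" if "\<kappa> \<in> {1..d}" for \<kappa>
    using ladder_range[OF that i_mem[OF that], of b] n by auto
  moreover have "ladder b m (\<kappa>, i \<kappa>) < ladder b m (\<kappa>', i \<kappa>')"
    if "\<kappa> \<in> {1..d}" "\<kappa>' \<in> {1..d}" "\<kappa> < \<kappa>'" for \<kappa> \<kappa>'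
  proof -
    have "(\<kappa> - 1) * m + i \<kappa> \<le> (\<kappa> - 1) * m + m" using i_mem[OF that(1)] by simp
    also have "\<dots> = \<kappa> * m" using that by (cases \<kappa>) auto
    also have "\<dots> \<le> (\<kappa>' - 1) * m" using that by (intro mult_le_mono1) auto
    also have "\<dots> < (\<kappa>' - 1) * m + i \<kappa>'" using i_mem[OF that(2)] by simp
    finally show ?thesis by (simp add: ladder_def)
  qed
  ultimately show ?thesis
    by (auto simp: index_simplex_def index_cube_def strict_mono_on_def)
qed

locale single_sequence = sampled_kernel d \<mu> h \<gamma> M X "{1..}"
  for d :: nat and \<mu> :: "'a measure" and h \<gamma> and M :: "'w measure" and X :: "nat \<Rightarrow> 'w \<Rightarrow> 'a"
begin

definition simplex_escape :: "nat \<Rightarrow> (nat \<Rightarrow> 'a) set \<Rightarrow> 'w set" where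
  "simplex_escape n B = {\<omega>\<in>space M. \<exists>i\<in>index_simplex d n. multi_X d X i \<omega> \<notin> B}"

lemma index_simplex_sub: "index_simplex d n \<subseteq> index_cube d n"
  by (auto simp: index_simplex_def)

lemma multi_X_measurable: "i \<in> index_cube d n \<Longrightarrow> multi_X d X i \<in> measurable M Q"
  unfolding multi_X_def[abs_def] by (rule subfamily_measurable) (auto simp: index_cube_def dest: PiE_mem)

lemma simplex_escape_measurable:
  assumes B: "B \<in> sets Q" shows "simplex_escape n B \<in> events"
proof -
  have "simplex_escape n B = (\<Union>i\<in>index_simplex d n. multi_X d X i -` (space Q - B) \<inter> space M)"
    unfolding simplex_escape_def using measurable_space[OF multi_X_measurable] index_simplex_sub[of n] by blast
  also have "\<dots> \<in> events"
    using B index_simplex_sub finite_subset[OF index_simplex_sub finite_index_cube]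
    by (intro sets.finite_UN measurable_sets[OF multi_X_measurable] sets.compl_sets) auto
  finally show ?thesis .
qed

lemma sample_ladder:
  assumes "i \<in> index_cube d m"
  shows "sample (\<lambda>p\<in>{1..d} \<times> {1..m}. X (ladder b m p) \<omega>) i
    = multi_X d X (\<lambda>\<kappa>\<in>{1..d}. ladder b m (\<kappa>, i \<kappa>)) \<omega>"
  unfolding sample_def multi_X_def
  using assms by (intro restrict_ext) (auto simp: index_cube_def dest: PiE_mem)

lemma ladder_in: "ladder b m \<in> {1..d} \<times> {1..m} \<rightarrow> {1..}"
  using ladder_range(1)[of _ d _ m b] by force

lemma simplex_escape_lower:
  assumes B: "B \<in> sets Q" and n: "d * m \<le> n"
  shows "measure (S m) (escapes m B) \<le> prob (simplex_escape n B)"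
proof -
  have "measure (S m) (escapes m B)
    = prob {\<omega>\<in>space M. (\<lambda>p\<in>{1..d} \<times> {1..m}. X (ladder 0 m p) \<omega>) \<in> escapes m B}"
    by (rule prob_subfamily[OF inj_on_ladder ladder_in escapes_measurable[OF B], symmetric])
  also have "\<dots> \<le> prob (simplex_escape n B)"
  proof (rule finite_measure_mono[OF _ simplex_escape_measurable[OF B]], rule subsetI)
    fix \<omega> assume w: "\<omega> \<in> {\<omega>\<in>space M. (\<lambda>p\<in>{1..d} \<times> {1..m}. X (ladder 0 m p) \<omega>) \<in> escapes m B}"
    then obtain i where i: "i \<in> index_cube d m" "sample (\<lambda>p\<in>{1..d} \<times> {1..m}. X (ladder 0 m p) \<omega>) i \<notin> B"
      unfolding escapes_def by blast
    have "(\<lambda>\<kappa>\<in>{1..d}. ladder 0 m (\<kappa>, i \<kappa>)) \<in> index_simplex d n"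
      by (rule ladder_simplex[OF i(1)]) (use n in simp)
    then show "\<omega> \<in> simplex_escape n B"
      using i(2) w unfolding simplex_escape_def sample_ladder[OF i(1)] by blast
  qed
  finally show ?thesis .
qed

text \<open>
  Double counting over the \<open>d ^ n\<close> colourings \<open>c\<close> of \<open>{1..n}\<close>. For fixed \<open>c\<close>, the variable
  with index \<open>j\<close> may be read off row \<open>c j\<close> of an array without changing the joint law, and then a tuple
  whose \<open>\<kappa>\<close>-th index has colour \<open>\<kappa>\<close> is a decoupled one. A given multiindex is coloured in this way by
  \<open>d ^ (n - d)\<close> colourings.
\<close>

lemma simplex_escape_upper:
  assumes B: "B \<in> sets Q"
  shows "prob (simplex_escape n B) \<le> d ^ d * measure (S n) (escapes n B)"
proof (cases "d \<le> n")
  case False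
  have "index_simplex d n = {}"
  proof (rule ccontr)
    assume "index_simplex d n \<noteq> {}"
    then obtain i where i: "i \<in> index_simplex d n" by blast
    have "inj_on i {1..d}"
      using i strict_mono_on_imp_inj_on[of "{1..d}" i] by (simp add: index_simplex_def)
    moreover have "i ` {1..d} \<subseteq> {1..n}" using i by (auto simp: index_simplex_def index_cube_def)
    ultimately have "card {1..d} \<le> card {1..n}" by (intro card_inj_on_le) auto
    then show False using False by simp
  qed
  then show ?thesis by (simp add: simplex_escape_def)
next
  case dn: True
  define Col where "Col = {1..n} \<rightarrow>\<^sub>E {1..d}"
  have Col: "finite Col" "card Col = d ^ n" unfolding Col_def by (auto intro!: finite_PiE simp: card_PiE)
  define W where "W c = {x\<in>space (PiM {1..n} (\<lambda>_. \<mu>)).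
      \<exists>i\<in>index_simplex d n. (\<forall>\<kappa>\<in>{1..d}. c (i \<kappa>) = \<kappa>) \<and> (\<lambda>\<kappa>\<in>{1..d}. x (i \<kappa>)) \<notin> B}" for c
  define E where "E c = {\<omega>\<in>space M. (\<lambda>j\<in>{1..n}. X j \<omega>) \<in> W c}" for c
  have i_in: "i \<in> {1..d} \<rightarrow> {1..n}" if "i \<in> index_simplex d n" for i
    using that by (auto simp: index_simplex_def index_cube_def)
  have W: "W c \<in> sets (PiM {1..n} (\<lambda>_. \<mu>))" for c
  proof -
    let ?I = "{i\<in>index_simplex d n. \<forall>\<kappa>\<in>{1..d}. c (i \<kappa>) = \<kappa>}"
    have "W c = (\<Union>i\<in>?I. (\<lambda>x. \<lambda>\<kappa>\<in>{1..d}. x (i \<kappa>)) -` (space Q - B) \<inter> space (PiM {1..n} (\<lambda>_. \<mu>)))"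
      unfolding W_def using measurable_space[OF measurable_reindex[OF i_in]] by blast
    also have "\<dots> \<in> sets (PiM {1..n} (\<lambda>_. \<mu>))"
      using finite_subset[OF index_simplex_sub finite_index_cube, of n]
      by (intro sets.finite_UN measurable_sets[OF measurable_reindex[OF i_in]] sets.compl_sets[OF B]) auto
    finally show ?thesis .
  qed
  have E_ev: "E c \<in> events" for c
    unfolding E_def by (rule events_of_subfamily[OF _ W]) auto
  have E_le: "prob (E c) \<le> measure (S n) (escapes n B)" if c: "c \<in> Col" for c
  proof -
    interpret S: prob_space "S n" by (rule prob_S)
    have t: "(\<lambda>j. (c j, j)) \<in> {1..n} \<rightarrow> {1..d} \<times> {1..n}" "inj_on (\<lambda>j. (c j, j)) {1..n}"
      using c by (auto simp: Col_def inj_on_def)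
    have "prob (E c) = measure (PiM {1..n} (\<lambda>_. \<mu>)) (W c)"
      unfolding E_def by (rule prob_subfamily[OF _ _ W]) auto
    also have "\<dots> = S.prob {y\<in>space (S n). (\<lambda>j\<in>{1..n}. y (c j, j)) \<in> W c}"
      unfolding measure_def using emeasure_PiM_reindex[OF prob_\<mu> t(2,1) W] by simp
    also have "\<dots> \<le> S.prob (escapes n B)"
    proof (rule S.finite_measure_mono[OF _ escapes_measurable[OF B]], rule subsetI)
      fix y assume y: "y \<in> {y\<in>space (S n). (\<lambda>j\<in>{1..n}. y (c j, j)) \<in> W c}"
      then obtain i where i: "i \<in> index_simplex d n" "\<forall>\<kappa>\<in>{1..d}. c (i \<kappa>) = \<kappa>"
        "(\<lambda>\<kappa>\<in>{1..d}. (\<lambda>j\<in>{1..n}. y (c j, j)) (i \<kappa>)) \<notin> B" unfolding W_def by blast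
      have "(\<lambda>\<kappa>\<in>{1..d}. (\<lambda>j\<in>{1..n}. y (c j, j)) (i \<kappa>)) = sample y i"
        unfolding sample_def using i(2) i_in[OF i(1)] by (intro restrict_ext) auto
      then show "y \<in> escapes n B" using i y index_simplex_sub unfolding escapes_def by auto
    qed
    finally show ?thesis .
  qed
  have count: "real (d ^ (n - d)) * indicator (simplex_escape n B) \<omega> \<le> (\<Sum>c\<in>Col. indicator (E c) \<omega>)"
    if w: "\<omega> \<in> space M" for \<omega>
  proof (cases "\<omega> \<in> simplex_escape n B")
    case True
    then obtain i where i: "i \<in> index_simplex d n" "multi_X d X i \<omega> \<notin> B" unfolding simplex_escape_def by blast
    have inj: "inj_on i {1..d}"
      using i strict_mono_on_imp_inj_on[of "{1..d}" i] by (simp add: index_simplex_def)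
    let ?T = "i ` {1..d}"
    let ?Good = "{c \<in> Col. \<forall>x\<in>?T. c x = the_inv_into {1..d} i x}"
    have "card ?Good = card {1..d} ^ (card {1..n} - card ?T)"
      unfolding Col_def using i_in[OF i(1)] inj
      by (intro card_extensions) (auto simp: the_inv_into_f_f)
    then have good: "card ?Good = d ^ (n - d)" using inj by (simp add: card_image)
    have "\<omega> \<in> E c" if c: "c \<in> ?Good" for c
    proof -
      have "\<forall>\<kappa>\<in>{1..d}. c (i \<kappa>) = \<kappa>" using c inj by (simp add: the_inv_into_f_f)
      moreover have "(\<lambda>\<kappa>\<in>{1..d}. (\<lambda>j\<in>{1..n}. X j \<omega>) (i \<kappa>)) = multi_X d X i \<omega>"
        unfolding multi_X_def using i_in[OF i(1)] by (intro restrict_ext) auto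
      moreover have "(\<lambda>j\<in>{1..n}. X j \<omega>) \<in> space (PiM {1..n} (\<lambda>_. \<mu>))"
        using measurable_space[OF subfamily_measurable[of "\<lambda>j. j" "{1..n}"] w] by auto
      ultimately show ?thesis unfolding E_def W_def using i w by auto
    qed
    then have "real (card ?Good) \<le> (\<Sum>c\<in>?Good. indicator (E c) \<omega>)" by simp
    also have "\<dots> \<le> (\<Sum>c\<in>Col. indicator (E c) \<omega>)" using Col by (intro sum_mono2) auto
    finally show ?thesis using True good by simp
  qed (simp add: sum_nonneg)
  have "real (d ^ (n - d)) * prob (simplex_escape n B)
    = (\<integral>\<omega>. real (d ^ (n - d)) * indicator (simplex_escape n B) \<omega> \<partial>M)"
    using simplex_escape_measurable[OF B] by simp
  also have "\<dots> \<le> (\<integral>\<omega>. (\<Sum>c\<in>Col. indicator (E c) \<omega>) \<partial>M)"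
    using simplex_escape_measurable[OF B] E_ev
    by (intro integral_mono count Bochner_Integration.integrable_sum integrable_mult_right)
      (auto simp: emeasure_eq_measure)
  also have "\<dots> = (\<Sum>c\<in>Col. prob (E c))"
    using E_ev by (subst Bochner_Integration.integral_sum) (auto simp: emeasure_eq_measure)
  also have "\<dots> \<le> (\<Sum>c\<in>Col. measure (S n) (escapes n B))" by (intro sum_mono E_le)
  also have "\<dots> = real (d ^ n) * measure (S n) (escapes n B)" using Col by simp
  also have "real (d ^ n) = real (d ^ (n - d)) * d ^ d" using dn by (simp flip: power_add)
  finally show ?thesis using d by (simp add: mult.assoc mult_le_cancel_left_pos)
qed

end

lemma (in single_sequence) square_sum_ladder_le:
  assumes n: "b + d * m \<le> n"
  shows "square_sum m (\<lambda>p\<in>{1..d} \<times> {1..m}. X (ladder b m p) \<omega>) \<le> (\<Sum>i\<in>index_simplex d n. (h (multi_X d X i \<omega>))\<^sup>2)"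
proof -
  let ?lad = "\<lambda>i. \<lambda>\<kappa>\<in>{1..d}. ladder b m (\<kappa>, i \<kappa>)"
  have inj: "inj_on ?lad (index_cube d m)"
  proof (rule inj_onI)
    fix i j assume i: "i \<in> index_cube d m" and j: "j \<in> index_cube d m" and eq: "?lad i = ?lad j"
    show "i = j"
    proof (rule PiE_ext[OF i[unfolded index_cube_def] j[unfolded index_cube_def]])
      fix \<kappa> assume "\<kappa> \<in> {1..d}"
      then show "i \<kappa> = j \<kappa>" using fun_cong[OF eq, of \<kappa>] by (simp add: ladder_def)
    qed
  qed
  have "square_sum m (\<lambda>p\<in>{1..d} \<times> {1..m}. X (ladder b m p) \<omega>)
    = (\<Sum>i\<in>index_cube d m. (h (multi_X d X (?lad i) \<omega>))\<^sup>2)"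
    unfolding square_sum_def by (intro sum.cong refl) (simp only: sample_ladder)
  also have "\<dots> = (\<Sum>i\<in>?lad ` index_cube d m. (h (multi_X d X i \<omega>))\<^sup>2)"
    by (rule sum.reindex[OF inj, unfolded o_def, symmetric])
  also have "\<dots> \<le> (\<Sum>i\<in>index_simplex d n. (h (multi_X d X i \<omega>))\<^sup>2)"
  proof (rule sum_mono2)
    show "finite (index_simplex d n)" using finite_subset[OF index_simplex_sub finite_index_cube] .
    show "?lad ` index_cube d m \<subseteq> index_simplex d n" using ladder_simplex[OF _ n] by blast
  qed simp
  finally show ?thesis .
qed

context single_sequence begin

text \<open>
  Since \<open>d \<le> 2 ^ d\<close>, an array with rows of length \<open>2 ^ (k - d)\<close> fits into a sequence of length \<open>2 ^ k\<close>.
\<close>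

lemma escapes_summable_of_simplex_escapes:
  assumes "summable (\<lambda>k. prob (simplex_escape (2 ^ Suc k) (A (Suc k) d)))"
  shows "summable (\<lambda>k. measure (S (2 ^ Suc k)) (escapes (2 ^ Suc k) (A (Suc k) d)))"
proof (rule summable_comparison_test'[OF summable_mult[OF assms, of "real ((2 ^ d) ^ d)"], of d])
  fix k assume k: "d \<le> k"
  let ?m = "2 ^ (Suc k - d) :: nat"
  have split: "2 ^ d * ?m = 2 ^ Suc k" using k by (simp flip: power_add)
  have "measure (S (2 ^ Suc k)) (escapes (2 ^ Suc k) (A (Suc k) d))
      \<le> (2 ^ d) ^ d * measure (S ?m) (escapes ?m (A (Suc k) d))"
    using escapes_cover[OF trunc_set_measurable, of ?m "2 ^ d" "Suc k" d] unfolding split by simp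
  also have "\<dots> \<le> (2 ^ d) ^ d * prob (simplex_escape (2 ^ Suc k) (A (Suc k) d))"
  proof (intro mult_left_mono simplex_escape_lower trunc_set_measurable)
    have "d * ?m \<le> 2 ^ d * ?m" using less_exp[of d] by (intro mult_le_mono1) simp
    then show "d * ?m \<le> 2 ^ Suc k" unfolding split .
  qed simp
  finally show "norm (measure (S (2 ^ Suc k)) (escapes (2 ^ Suc k) (A (Suc k) d)))
      \<le> real ((2 ^ d) ^ d) * prob (simplex_escape (2 ^ Suc k) (A (Suc k) d))" by simp
qed

lemma simplex_escapes_summable_of_escapes:
  assumes "summable (\<lambda>k. measure (S (2 ^ Suc k)) (escapes (2 ^ Suc k) (A (Suc k) d)))"
  shows "summable (\<lambda>k. prob (simplex_escape (2 ^ Suc k) (A (Suc k) d)))"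
proof (rule summable_comparison_test'[OF summable_mult[OF assms, of "real (d ^ d)"], of 0])
  show "norm (prob (simplex_escape (2 ^ Suc k) (A (Suc k) d)))
      \<le> real (d ^ d) * measure (S (2 ^ Suc k)) (escapes (2 ^ Suc k) (A (Suc k) d))" for k
    using simplex_escape_upper[OF trunc_set_measurable, of "2 ^ Suc k" "Suc k" d] by simp
qed

text \<open>
  The blocks are ladders inside \<open>{2 ^ (k + d)<..2 ^ (k + d + 1)}\<close>.
\<close>

lemma escapes_summable_of_simplex_squares:
  fixes C :: real
  assumes C: "C > 0" "\<And>n. n \<ge> 1 \<Longrightarrow> \<gamma> (2 * n) \<le> C * \<gamma> n"
    and conv: "AE \<omega> in M. (\<lambda>n. 1 / (\<gamma> n)\<^sup>2 * (\<Sum>i\<in>index_simplex d n. (h (multi_X d X i \<omega>))\<^sup>2)) \<longlonglongrightarrow> 0"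
  shows "summable (\<lambda>k. measure (S (2 ^ k)) (escapes (2 ^ k) (A k d)))"
proof -
  have room: "2 ^ (k + d) + d * 2 ^ k \<le> (2 :: nat) ^ (k + Suc d)" for k
  proof -
    have "d * 2 ^ k \<le> 2 ^ d * (2 ^ k :: nat)" using less_exp[of d] by (intro mult_le_mono1) simp
    then show ?thesis by (simp add: power_add mult_ac)
  qed
  show ?thesis
  proof (rule summable_escapes_of_blocks[OF C inj_on_ladder ladder_in _ conv square_sum_ladder_le[OF room]])
    show "disjoint_family (\<lambda>k. ladder (2 ^ (k + d)) (2 ^ k) ` ({1..d} \<times> {1..2 ^ k}))"
    proof -
      have rng: "2 ^ (k + d) < x \<and> x \<le> 2 ^ (Suc k + d)"
        if block: "x \<in> ladder (2 ^ (k + d)) (2 ^ k) ` ({1..d} \<times> {1..2 ^ k})" for x k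
      proof -
        obtain p where p: "x = ladder (2 ^ (k + d)) (2 ^ k) p" "p \<in> {1..d} \<times> {1..2 ^ k}"
          using block by (rule imageE)
        then have "fst p \<in> {1..d}" "snd p \<in> {1..2 ^ k}" by auto
        from ladder_range[OF this, of "2 ^ (k + d)"] show ?thesis using room[of k] p(1) by simp
      qed
      have False if "x \<in> ladder (2 ^ (k + d)) (2 ^ k) ` ({1..d} \<times> {1..2 ^ k})"
        "x \<in> ladder (2 ^ (l + d)) (2 ^ l) ` ({1..d} \<times> {1..2 ^ l})" "k < l" for x k l
      proof -
        have "(2 :: nat) ^ (Suc k + d) \<le> 2 ^ (l + d)" using that(3) by (intro power_increasing) auto
        then show False using rng[OF that(1)] rng[OF that(2)] by linarith
      qed
      then show ?thesis unfolding disjoint_family_on_def by (metis disjoint_iff linorder_neqE_nat)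
    qed
  qed
qed

end

locale row_sequences = sampled_kernel d \<mu> h \<gamma> M X "{1..d} \<times> {1..}"
  for d :: nat and \<mu> :: "'a measure" and h \<gamma> and M :: "'w measure" and X :: "nat \<times> nat \<Rightarrow> 'w \<Rightarrow> 'a"
begin

lemma sample_rows:
  assumes "i \<in> index_cube d n"
  shows "sample (\<lambda>p\<in>{1..d} \<times> {1..n}. X p \<omega>) i = multi_X_dec d (\<lambda>k j. X (k, j)) i \<omega>"
  unfolding sample_def multi_X_dec_def
  using assms by (intro restrict_ext) (auto simp: index_cube_def dest: PiE_mem)

lemma rows_space: "\<omega> \<in> space M \<Longrightarrow> (\<lambda>p\<in>{1..d} \<times> {1..n}. X p \<omega>) \<in> space (S n)"
proof -
  have t: "(\<lambda>p. p) \<in> {1..d} \<times> {1..n} \<rightarrow> {1..d} \<times> {1..}" by auto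
  show "\<omega> \<in> space M \<Longrightarrow> (\<lambda>p\<in>{1..d} \<times> {1..n}. X p \<omega>) \<in> space (S n)"
    by (rule measurable_space[OF subfamily_measurable[OF t]])
qed

lemma prob_cube_escape:
  assumes B: "B \<in> sets Q"
  shows "prob {\<omega>\<in>space M. \<exists>i\<in>index_cube d n. multi_X_dec d (\<lambda>k j. X (k, j)) i \<omega> \<notin> B}
    = measure (S n) (escapes n B)"
proof -
  have "{\<omega>\<in>space M. \<exists>i\<in>index_cube d n. multi_X_dec d (\<lambda>k j. X (k, j)) i \<omega> \<notin> B}
    = {\<omega>\<in>space M. (\<lambda>p\<in>{1..d} \<times> {1..n}. X p \<omega>) \<in> escapes n B}"
    unfolding escapes_def using rows_space sample_rows by fastforce
  also have "prob \<dots> = measure (S n) (escapes n B)"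
    by (rule prob_subfamily[OF _ _ escapes_measurable[OF B]]) auto
  finally show ?thesis .
qed

text \<open>
  The blocks consist of the columns with index in \<open>{2 ^ k<..2 ^ (k + 1)}\<close>.
\<close>

lemma escapes_summable_of_cube_squares:
  fixes C :: real
  assumes C: "C > 0" "\<And>n. n \<ge> 1 \<Longrightarrow> \<gamma> (2 * n) \<le> C * \<gamma> n"
    and conv: "AE \<omega> in M. (\<lambda>n. 1 / (\<gamma> n)\<^sup>2 *
      (\<Sum>i\<in>index_cube d n. (h (multi_X_dec d (\<lambda>k j. X (k, j)) i \<omega>))\<^sup>2)) \<longlonglongrightarrow> 0"
  shows "summable (\<lambda>k. measure (S (2 ^ k)) (escapes (2 ^ k) (A k d)))"
proof -
  define t :: "nat \<Rightarrow> nat \<times> nat \<Rightarrow> nat \<times> nat" where "t = (\<lambda>k (\<kappa>, j). (\<kappa>, 2 ^ k + j))"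
  have t_inj: "inj_on (t k) ({1..d} \<times> {1..2 ^ k})" for k by (auto simp: t_def inj_on_def)
  have t_in: "t k \<in> {1..d} \<times> {1..2 ^ k} \<rightarrow> {1..d} \<times> {1..}" for k by (auto simp: t_def)
  have disj: "disjoint_family (\<lambda>k. t k ` ({1..d} \<times> {1..2 ^ k}))"
  proof -
    have rng: "2 ^ k < snd x \<and> snd x \<le> 2 ^ Suc k" if "x \<in> t k ` ({1..d} \<times> {1..2 ^ k})" for x k
      using that by (auto simp: t_def)
    have False if "x \<in> t k ` ({1..d} \<times> {1..2 ^ k})" "x \<in> t l ` ({1..d} \<times> {1..2 ^ l})" "k < l" for x k l
    proof -
      have "(2 :: nat) ^ Suc k \<le> 2 ^ l" using that(3) by (intro power_increasing) auto
      then show False using rng[OF that(1)] rng[OF that(2)] by linarith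
    qed
    then show ?thesis unfolding disjoint_family_on_def by (metis disjoint_iff linorder_neqE_nat)
  qed
  have dom: "square_sum (2 ^ k) (\<lambda>p\<in>{1..d} \<times> {1..2 ^ k}. X (t k p) \<omega>)
    \<le> (\<Sum>i\<in>index_cube d (2 ^ (k + 1)). (h (multi_X_dec d (\<lambda>k j. X (k, j)) i \<omega>))\<^sup>2)" for k \<omega>
  proof -
    let ?sh = "\<lambda>i. \<lambda>\<kappa>\<in>{1..d}. 2 ^ k + i \<kappa>"
    have inj: "inj_on ?sh (index_cube d (2 ^ k))"
    proof (rule inj_onI)
      fix i j assume i: "i \<in> index_cube d (2 ^ k)" and j: "j \<in> index_cube d (2 ^ k)" and eq: "?sh i = ?sh j"
      show "i = j"
      proof (rule PiE_ext[OF i[unfolded index_cube_def] j[unfolded index_cube_def]])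
        fix \<kappa> assume "\<kappa> \<in> {1..d}"
        then show "i \<kappa> = j \<kappa>" using fun_cong[OF eq, of \<kappa>] by simp
      qed
    qed
    have smp: "sample (\<lambda>p\<in>{1..d} \<times> {1..2 ^ k}. X (t k p) \<omega>) i = multi_X_dec d (\<lambda>k j. X (k, j)) (?sh i) \<omega>"
      if "i \<in> index_cube d (2 ^ k)" for i
      unfolding sample_def multi_X_dec_def t_def
      using that by (intro restrict_ext) (auto simp: index_cube_def dest: PiE_mem)
    have "square_sum (2 ^ k) (\<lambda>p\<in>{1..d} \<times> {1..2 ^ k}. X (t k p) \<omega>)
      = (\<Sum>i\<in>index_cube d (2 ^ k). (h (multi_X_dec d (\<lambda>k j. X (k, j)) (?sh i) \<omega>))\<^sup>2)"
      unfolding square_sum_def by (intro sum.cong refl) (simp only: smp)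
    also have "\<dots> = (\<Sum>i\<in>?sh ` index_cube d (2 ^ k). (h (multi_X_dec d (\<lambda>k j. X (k, j)) i \<omega>))\<^sup>2)"
      by (rule sum.reindex[OF inj, unfolded o_def, symmetric])
    also have "\<dots> \<le> (\<Sum>i\<in>index_cube d (2 ^ (k + 1)). (h (multi_X_dec d (\<lambda>k j. X (k, j)) i \<omega>))\<^sup>2)"
    proof (rule sum_mono2[OF finite_index_cube])
      show "?sh ` index_cube d (2 ^ k) \<subseteq> index_cube d (2 ^ (k + 1))"
        unfolding index_cube_def
      proof (rule image_subsetI, rule PiE_I)
        fix i :: "nat \<Rightarrow> nat" and \<kappa> assume i: "i \<in> {1..d} \<rightarrow>\<^sub>E {1..2 ^ k}" and k: "\<kappa> \<in> {1..d}"
        show "?sh i \<kappa> \<in> {1..2 ^ (k + 1)}" using PiE_mem[OF i k] k by simp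
      qed auto
    qed simp
    finally show ?thesis .
  qed
  show ?thesis by (rule summable_escapes_of_blocks[OF C t_inj t_in disj conv dom])
qed

end

section \<open>Signed sums over a family of multiindices\<close>

text \<open>
  A common frame for both kinds of signed sums. A multiindex is a map \<open>\<phi>\<close> from \<open>{1..d}\<close> to the index
  set of the sample, and the multiindices admitted at time \<open>n\<close> are those with values in \<open>J n\<close>. As \<open>\<phi>\<close>
  is determined by its range, signed sums become Walsh polynomials with one coefficient for each range.
\<close>

locale signed_scheme = sampled_kernel d \<mu> h \<gamma> M Y K
  for d :: nat and \<mu> :: "'a measure" and h \<gamma> and M :: "'w measure" and Y :: "'i \<Rightarrow> 'w \<Rightarrow> 'a" and K +
  fixes \<epsilon> :: "'i \<Rightarrow> 'w \<Rightarrow> real" and J :: "nat \<Rightarrow> 'i set" and F :: "(nat \<Rightarrow> 'i) set"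
  assumes rad: "rademacher_family M \<epsilon> K"
    and ind: "indep_elements M (PiM K (\<lambda>_. borel)) (\<lambda>\<omega>. \<lambda>i\<in>K. \<epsilon> i \<omega>) (PiM K (\<lambda>_. \<mu>)) (\<lambda>\<omega>. \<lambda>i\<in>K. Y i \<omega>)"
    and finJ: "finite (J n)" and JK: "J n \<subseteq> K" and monoJ: "mono J"
    and F_in: "\<phi> \<in> F \<Longrightarrow> \<phi> \<in> {1..d} \<rightarrow> K" and F_inj: "\<phi> \<in> F \<Longrightarrow> inj_on \<phi> {1..d}"
    and F_image: "inj_on (\<lambda>\<phi>. \<phi> ` {1..d}) F"
    and F_card: "card {\<phi>\<in>F. \<phi> ` {1..d} \<subseteq> J n} \<le> n ^ d"
begin

definition family :: "nat \<Rightarrow> (nat \<Rightarrow> 'i) set" where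
  "family n = {\<phi>\<in>F. \<phi> ` {1..d} \<subseteq> J n}"

definition tuple :: "(nat \<Rightarrow> 'i) \<Rightarrow> 'w \<Rightarrow> nat \<Rightarrow> 'a" where
  "tuple \<phi> \<omega> = (\<lambda>\<kappa>\<in>{1..d}. Y (\<phi> \<kappa>) \<omega>)"

definition signed_sum :: "nat \<Rightarrow> 'w \<Rightarrow> real" where
  "signed_sum n \<omega> = (\<Sum>\<phi>\<in>family n. (\<Prod>\<kappa>\<in>{1..d}. \<epsilon> (\<phi> \<kappa>) \<omega>) * h (tuple \<phi> \<omega>))"

definition squares :: "nat \<Rightarrow> 'w \<Rightarrow> real" where
  "squares n \<omega> = (\<Sum>\<phi>\<in>family n. (h (tuple \<phi> \<omega>))\<^sup>2)"

text \<open>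
  The coefficient of a Walsh monomial: the kernel at the tuple whose index set is \<open>B\<close>.
\<close>

definition coef :: "((nat \<Rightarrow> 'a) \<Rightarrow> real) \<Rightarrow> ('i \<Rightarrow> 'a) \<Rightarrow> 'i set \<Rightarrow> real" where
  "coef H y B = (if B \<in> (\<lambda>\<phi>. \<phi> ` {1..d}) ` F
     then H (\<lambda>\<kappa>\<in>{1..d}. y (the_inv_into F (\<lambda>\<phi>. \<phi> ` {1..d}) B \<kappa>)) else 0)"

abbreviation "Z \<equiv> \<lambda>\<omega>. \<lambda>i\<in>K. Y i \<omega>"

sublocale chaos: rademacher_chaos M \<epsilon> K "PiM K (\<lambda>_. \<mu>)" Z J
  by (unfold_locales) (rule prob_space_axioms rad ind finJ JK monoJ)+

lemma finite_family: "finite (family n)"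
proof (rule inj_on_finite)
  show "inj_on (\<lambda>\<phi>. \<phi> ` {1..d}) (family n)"
    using F_image by (rule inj_on_subset) (auto simp: family_def)
  show "(\<lambda>\<phi>. \<phi> ` {1..d}) ` family n \<subseteq> Pow (J n)" by (auto simp: family_def)
  show "finite (Pow (J n))" using finJ by simp
qed

lemma family_F: "\<phi> \<in> family n \<Longrightarrow> \<phi> \<in> F"
  by (simp add: family_def)

lemma coef_image:
  assumes "\<phi> \<in> F" shows "coef H y (\<phi> ` {1..d}) = H (\<lambda>\<kappa>\<in>{1..d}. y (\<phi> \<kappa>))"
  using assms the_inv_into_f_f[OF F_image assms] by (simp add: coef_def)

lemma tuple_Z: "\<phi> \<in> F \<Longrightarrow> (\<lambda>\<kappa>\<in>{1..d}. Z \<omega> (\<phi> \<kappa>)) = tuple \<phi> \<omega>"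
  unfolding tuple_def by (intro restrict_ext) (simp add: funcset_mem[OF F_in])

lemma coef_measurable:
  assumes H: "H \<in> borel_measurable Q" shows "(\<lambda>y. coef H y B) \<in> borel_measurable (PiM K (\<lambda>_. \<mu>))"
proof (cases "B \<in> (\<lambda>\<phi>. \<phi> ` {1..d}) ` F")
  case True
  then obtain \<phi> where \<phi>: "\<phi> \<in> F" "B = \<phi> ` {1..d}" by auto
  show ?thesis unfolding \<phi>(2) coef_image[OF \<phi>(1)]
    by (rule measurable_compose[OF measurable_reindex[OF F_in[OF \<phi>(1)]] H])
qed (simp add: coef_def)

lemma coef_degree: "card B > d \<Longrightarrow> coef H y B = 0"
proof -
  have "card (\<phi> ` {1..d}) \<le> d" for \<phi> :: "nat \<Rightarrow> 'i"
    using card_image_le[of "{1..d}" \<phi>] by simp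
  then show "card B > d \<Longrightarrow> coef H y B = 0" by (auto simp: coef_def not_le[symmetric])
qed

lemma sum_coef:
  assumes G: "\<And>B. G B 0 = (0::real)"
  shows "(\<Sum>B\<in>Pow (J n). G B (coef H (Z \<omega>) B)) = (\<Sum>\<phi>\<in>family n. G (\<phi> ` {1..d}) (H (tuple \<phi> \<omega>)))"
proof -
  have "(\<Sum>B\<in>Pow (J n). G B (coef H (Z \<omega>) B)) = (\<Sum>B\<in>(\<lambda>\<phi>. \<phi> ` {1..d}) ` family n. G B (coef H (Z \<omega>) B))"
  proof (rule sum.mono_neutral_right)
    show "\<forall>B\<in>Pow (J n) - (\<lambda>\<phi>. \<phi> ` {1..d}) ` family n. G B (coef H (Z \<omega>) B) = 0"
    proof
      fix B assume "B \<in> Pow (J n) - (\<lambda>\<phi>. \<phi> ` {1..d}) ` family n"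
      then have "B \<notin> (\<lambda>\<phi>. \<phi> ` {1..d}) ` F" by (auto simp: family_def)
      then show "G B (coef H (Z \<omega>) B) = 0" using G by (simp add: coef_def)
    qed
  qed (use finJ in \<open>auto simp: family_def\<close>)
  also have "\<dots> = (\<Sum>\<phi>\<in>family n. G (\<phi> ` {1..d}) (coef H (Z \<omega>) (\<phi> ` {1..d})))"
    by (rule sum.reindex[OF inj_on_subset[OF F_image], unfolded o_def]) (auto simp: family_def)
  also have "\<dots> = (\<Sum>\<phi>\<in>family n. G (\<phi> ` {1..d}) (H (tuple \<phi> \<omega>)))"
    by (intro sum.cong refl) (simp only: coef_image[OF family_F] tuple_Z[OF family_F])
  finally show ?thesis .
qed

lemma energy_coef: "chaos.energy (coef H) n (Z \<omega>) = (\<Sum>\<phi>\<in>family n. (H (tuple \<phi> \<omega>))\<^sup>2)"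
  unfolding chaos.energy_def by (rule sum_coef[where G = "\<lambda>_ x. x\<^sup>2"]) simp

lemma AE_signs: "AE \<omega> in M. \<forall>n. \<forall>j\<in>J n. \<epsilon> j \<omega> = 1 \<or> \<epsilon> j \<omega> = -1"
proof -
  have each: "AE \<omega> in M. \<epsilon> j \<omega> = 1 \<or> \<epsilon> j \<omega> = -1" if j: "j \<in> K" for j
  proof -
    have [measurable]: "\<epsilon> j \<in> borel_measurable M"
      using rad j unfolding rademacher_family_def indep_vars_def by blast
    have half: "prob {\<omega>\<in>space M. \<epsilon> j \<omega> = 1} = 1 / 2" "prob {\<omega>\<in>space M. \<epsilon> j \<omega> = -1} = 1 / 2"
      using rad j unfolding rademacher_family_def by auto
    have "prob ({\<omega>\<in>space M. \<epsilon> j \<omega> = 1} \<union> {\<omega>\<in>space M. \<epsilon> j \<omega> = -1})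
        = prob {\<omega>\<in>space M. \<epsilon> j \<omega> = 1} + prob {\<omega>\<in>space M. \<epsilon> j \<omega> = -1}"
      by (intro finite_measure_Union) auto
    then have "prob ({\<omega>\<in>space M. \<epsilon> j \<omega> = 1} \<union> {\<omega>\<in>space M. \<epsilon> j \<omega> = -1}) = 1"
      using half by simp
    then have "AE \<omega> in M. \<omega> \<in> {\<omega>\<in>space M. \<epsilon> j \<omega> = 1} \<union> {\<omega>\<in>space M. \<epsilon> j \<omega> = -1}"
      by (subst AE_in_set_eq_1) auto
    then show ?thesis by eventually_elim auto
  qed
  show ?thesis
    unfolding AE_all_countable using each JK by (intro allI AE_finite_allI finJ) auto
qed

lemma chaos_eq_signed_sum:
  assumes signs: "\<forall>j\<in>J n. \<epsilon> j \<omega> = 1 \<or> \<epsilon> j \<omega> = -1"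
  shows "chaos.chaos (coef h) n \<omega> = signed_sum n \<omega>"
proof -
  have "(\<Prod>\<kappa>\<in>{1..d}. \<epsilon> (\<phi> \<kappa>) \<omega>) = walsh (\<phi> ` {1..d}) (neg_set \<epsilon> \<omega>)" if \<phi>: "\<phi> \<in> family n" for \<phi>
  proof -
    have "(\<Prod>\<kappa>\<in>{1..d}. \<epsilon> (\<phi> \<kappa>) \<omega>) = (\<Prod>j\<in>\<phi> ` {1..d}. \<epsilon> j \<omega>)"
      by (rule prod.reindex[OF F_inj[OF family_F[OF \<phi>]], unfolded o_def, symmetric])
    also have "\<dots> = (\<Prod>j\<in>\<phi> ` {1..d}. if j \<in> neg_set \<epsilon> \<omega> then -1 else 1)"
    proof (rule prod.cong[OF refl])
      fix j assume "j \<in> \<phi> ` {1..d}"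
      then have "\<epsilon> j \<omega> = 1 \<or> \<epsilon> j \<omega> = -1" using signs \<phi> by (auto simp: family_def)
      then show "\<epsilon> j \<omega> = (if j \<in> neg_set \<epsilon> \<omega> then -1 else 1)" by (auto simp: neg_set_def)
    qed
    also have "\<dots> = walsh (\<phi> ` {1..d}) (neg_set \<epsilon> \<omega>)"
      by (simp add: prod.If_cases walsh_def)
    finally show ?thesis .
  qed
  then have "signed_sum n \<omega> = (\<Sum>\<phi>\<in>family n. h (tuple \<phi> \<omega>) * walsh (\<phi> ` {1..d}) (neg_set \<epsilon> \<omega>))"
    unfolding signed_sum_def by (intro sum.cong refl) simp
  also have "\<dots> = chaos.chaos (coef h) n \<omega>"
    unfolding chaos.chaos_def walsh_poly_def
    by (rule sum_coef[where G = "\<lambda>B x. x * walsh B (neg_set \<epsilon> \<omega>)", symmetric]) simp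
  finally show ?thesis by simp
qed

lemma signed_convergence_imp_square_convergence:
  assumes "AE \<omega> in M. (\<lambda>n. 1 / \<gamma> n * signed_sum n \<omega>) \<longlonglongrightarrow> 0"
  shows "AE \<omega> in M. (\<lambda>n. 1 / (\<gamma> n)\<^sup>2 * squares n \<omega>) \<longlonglongrightarrow> 0"
proof -
  have "AE \<omega> in M. (\<lambda>n. 1 / \<gamma> n * chaos.chaos (coef h) n \<omega>) \<longlonglongrightarrow> 0"
    using assms AE_signs by eventually_elim (simp add: chaos_eq_signed_sum)
  from chaos.chaos_convergence_imp_energy_convergence[OF coef_measurable[OF h] coef_degree \<gamma>_pos this]
  show ?thesis by (simp add: energy_coef squares_def)
qed

definition family_escape :: "nat \<Rightarrow> (nat \<Rightarrow> 'a) set \<Rightarrow> 'w set" where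
  "family_escape n B = {\<omega>\<in>space M. \<exists>\<phi>\<in>family n. tuple \<phi> \<omega> \<notin> B}"

lemma tuple_measurable: "\<phi> \<in> F \<Longrightarrow> tuple \<phi> \<in> measurable M Q"
  unfolding tuple_def[abs_def] by (rule subfamily_measurable[OF F_in])

lemma family_escape_measurable:
  assumes B: "B \<in> sets Q" shows "family_escape n B \<in> events"
proof -
  have "family_escape n B = (\<Union>\<phi>\<in>family n. tuple \<phi> -` (space Q - B) \<inter> space M)"
    unfolding family_escape_def using measurable_space[OF tuple_measurable[OF family_F]] by blast
  also have "\<dots> \<in> events"
    by (intro sets.finite_UN finite_family measurable_sets[OF tuple_measurable[OF family_F]] sets.compl_sets[OF B])
  finally show ?thesis .
qed

text \<open>
  By Borel-Cantelli all tuples are eventually inside the truncation sets, so that the kernel may be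
  replaced by its truncation; the expected energy of the latter, relative to \<open>(\<gamma> (2 ^ k))\<^sup>2\<close>, is at most the
  \<open>k\<close>-th term of the energy series.
\<close>

lemma signed_convergence_of_summable_escapes:
  fixes C :: real
  assumes mono: "mono_on {1..} \<gamma>" and dbl: "\<And>n. n \<ge> 1 \<Longrightarrow> \<gamma> (2 * n) \<le> C * \<gamma> n"
    and esc: "summable (\<lambda>k. prob (family_escape (2 ^ Suc k) (A (Suc k) d)))"
    and energy: "(\<Sum>k. ennreal (weight (Suc k)) * (\<integral>\<^sup>+x. g (Suc k) d x \<partial>Q)) < \<infinity>"
  shows "AE \<omega> in M. (\<lambda>n. 1 / \<gamma> n * signed_sum n \<omega>) \<longlonglongrightarrow> 0"
proof -
  \<comment> \<open>The hypotheses only concern \<open>k \<ge> 1\<close>; with \<open>H 0 = 0\<close> the term \<open>k = 0\<close> drops out of the series below.\<close>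
  define H where "H k x = (if k = 0 then 0 else h x * indicator (A k d) x)" for k x
  have H: "H k \<in> borel_measurable Q" for k
    unfolding H_def using h trunc_set_measurable by measurable
  define e where "e k = (\<integral>\<^sup>+\<omega>. ennreal (chaos.energy (coef (H k)) (2 ^ k) (Z \<omega>) / (\<gamma> (2 ^ k))\<^sup>2) \<partial>M)" for k
  have e0: "e 0 = 0" by (simp add: e_def energy_coef H_def)
  have e_le: "e k \<le> ennreal (weight k) * (\<integral>\<^sup>+x. g k d x \<partial>Q)" for k
  proof -
    define a where "a = (\<gamma> (2 ^ k))\<^sup>2"
    have a: "a > 0" using \<gamma>_pos[of "2 ^ k"] by (simp add: a_def)
    have "e k = (\<integral>\<^sup>+\<omega>. (\<Sum>\<phi>\<in>family (2 ^ k). ennreal ((H k (tuple \<phi> \<omega>))\<^sup>2 / a)) \<partial>M)"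
      unfolding e_def energy_coef a_def[symmetric] sum_divide_distrib
      using a by (intro nn_integral_cong) (simp add: sum_ennreal)
    also have "\<dots> = (\<Sum>\<phi>\<in>family (2 ^ k). \<integral>\<^sup>+\<omega>. ennreal ((H k (tuple \<phi> \<omega>))\<^sup>2 / a) \<partial>M)"
    proof (rule nn_integral_sum)
      fix \<phi> assume "\<phi> \<in> family (2 ^ k)"
      then have [measurable]: "(\<lambda>\<omega>. H k (tuple \<phi> \<omega>)) \<in> borel_measurable M"
        by (intro measurable_compose[OF tuple_measurable H] family_F)
      show "(\<lambda>\<omega>. ennreal ((H k (tuple \<phi> \<omega>))\<^sup>2 / a)) \<in> borel_measurable M" by measurable
    qed
    also have "\<dots> \<le> (\<Sum>\<phi>\<in>family (2 ^ k). ennreal (1 / a) * (\<integral>\<^sup>+x. g k d x \<partial>Q))"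
    proof (rule sum_mono)
      fix \<phi> assume "\<phi> \<in> family (2 ^ k)"
      then have \<phi>: "\<phi> \<in> F" by (rule family_F)
      have "(\<integral>\<^sup>+\<omega>. ennreal ((H k (tuple \<phi> \<omega>))\<^sup>2 / a) \<partial>M) \<le> (\<integral>\<^sup>+\<omega>. ennreal (1 / a) * g k d (tuple \<phi> \<omega>) \<partial>M)"
        using a by (intro nn_integral_mono) (auto simp: H_def g_def indicator_def ennreal_mult'[symmetric])
      also have "\<dots> = ennreal (1 / a) * (\<integral>\<^sup>+\<omega>. g k d (tuple \<phi> \<omega>) \<partial>M)"
        by (intro nn_integral_cmult measurable_compose[OF tuple_measurable[OF \<phi>] g_measurable])
      also have "(\<integral>\<^sup>+\<omega>. g k d (tuple \<phi> \<omega>) \<partial>M) = (\<integral>\<^sup>+x. g k d x \<partial>Q)"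
        unfolding tuple_def by (rule nn_integral_subfamily[OF F_inj[OF \<phi>] F_in[OF \<phi>] g_measurable])
      finally show "(\<integral>\<^sup>+\<omega>. ennreal ((H k (tuple \<phi> \<omega>))\<^sup>2 / a) \<partial>M) \<le> ennreal (1 / a) * (\<integral>\<^sup>+x. g k d x \<partial>Q)" .
    qed
    also have "\<dots> = of_nat (card (family (2 ^ k))) * (ennreal (1 / a) * (\<integral>\<^sup>+x. g k d x \<partial>Q))" by simp
    also have "\<dots> \<le> of_nat ((2 ^ k) ^ d) * (ennreal (1 / a) * (\<integral>\<^sup>+x. g k d x \<partial>Q))"
      using F_card[of "2 ^ k"] unfolding family_def by (intro mult_right_mono of_nat_mono) auto
    also have "(of_nat ((2 ^ k) ^ d) :: ennreal) = ennreal (2 ^ (d * k))"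
      by (simp add: ennreal_of_nat_eq_real_of_nat power_mult[symmetric] mult.commute del: of_nat_power)
    also have "ennreal (2 ^ (d * k)) * (ennreal (1 / a) * (\<integral>\<^sup>+x. g k d x \<partial>Q)) = ennreal (weight k) * (\<integral>\<^sup>+x. g k d x \<partial>Q)"
      using a by (simp add: weight_def a_def[symmetric] ennreal_mult'[symmetric] mult.assoc[symmetric])
    finally show ?thesis .
  qed
  have "(\<Sum>k. e k) \<le> (\<Sum>k. ennreal (weight (Suc k)) * (\<integral>\<^sup>+x. g (Suc k) d x \<partial>Q))"
  proof (rule suminf_le_const)
    fix n
    have "(\<Sum>k<n. e k) \<le> (\<Sum>k<Suc n. e k)" by (intro sum_mono2) auto
    also have "\<dots> = (\<Sum>k<n. e (Suc k))" unfolding sum.lessThan_Suc_shift e0 by simp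
    also have "\<dots> \<le> (\<Sum>k<n. ennreal (weight (Suc k)) * (\<integral>\<^sup>+x. g (Suc k) d x \<partial>Q))" by (intro sum_mono e_le)
    also have "\<dots> \<le> (\<Sum>k. ennreal (weight (Suc k)) * (\<integral>\<^sup>+x. g (Suc k) d x \<partial>Q))" by (rule sum_le_suminf) auto
    finally show "(\<Sum>k<n. e k) \<le> (\<Sum>k. ennreal (weight (Suc k)) * (\<integral>\<^sup>+x. g (Suc k) d x \<partial>Q))" .
  qed auto
  then have e_fin: "(\<Sum>k. e k) \<noteq> \<infinity>" using energy by auto
  have "AE \<omega> in M. \<forall>\<^sub>F k in sequentially. \<omega> \<in> space M - family_escape (2 ^ Suc k) (A (Suc k) d)"
    using esc by (intro borel_cantelli_AE1 family_escape_measurable trunc_set_measurable) (auto simp: emeasure_eq_measure)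
  then have ev: "AE \<omega> in M. \<forall>\<^sub>F k in sequentially. \<forall>B\<subseteq>J (2 ^ k). coef h (Z \<omega>) B = coef (H k) (Z \<omega>) B"
  proof eventually_elim
    fix \<omega> assume "\<forall>\<^sub>F k in sequentially. \<omega> \<in> space M - family_escape (2 ^ Suc k) (A (Suc k) d)"
    then have "\<forall>\<^sub>F k in sequentially. \<forall>B\<subseteq>J (2 ^ Suc k). coef h (Z \<omega>) B = coef (H (Suc k)) (Z \<omega>) B"
    proof eventually_elim
      fix k assume w: "\<omega> \<in> space M - family_escape (2 ^ Suc k) (A (Suc k) d)"
      show "\<forall>B\<subseteq>J (2 ^ Suc k). coef h (Z \<omega>) B = coef (H (Suc k)) (Z \<omega>) B"
      proof (intro allI impI)
        fix B assume B: "B \<subseteq> J (2 ^ Suc k)"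
        show "coef h (Z \<omega>) B = coef (H (Suc k)) (Z \<omega>) B"
        proof (cases "B \<in> (\<lambda>\<phi>. \<phi> ` {1..d}) ` F")
          case True
          then obtain \<phi> where \<phi>: "\<phi> \<in> F" "B = \<phi> ` {1..d}" by auto
          then have "\<phi> \<in> family (2 ^ Suc k)" using B by (simp add: family_def)
          then have "tuple \<phi> \<omega> \<in> A (Suc k) d" using w unfolding family_escape_def by blast
          then show ?thesis unfolding \<phi>(2) coef_image[OF \<phi>(1)] tuple_Z[OF \<phi>(1)] by (simp add: H_def)
        qed (simp add: coef_def)
      qed
    qed
    then show "\<forall>\<^sub>F k in sequentially. \<forall>B\<subseteq>J (2 ^ k). coef h (Z \<omega>) B = coef (H k) (Z \<omega>) B"
      by (subst (asm) eventually_sequentially_Suc)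
  qed
  have "AE \<omega> in M. (\<lambda>n. 1 / \<gamma> n * chaos.chaos (coef h) n \<omega>) \<longlonglongrightarrow> 0"
    by (rule chaos.chaos_convergence_of_summable_energy[OF coef_measurable[OF h] coef_measurable[OF H]
          \<gamma>_pos mono dbl e_fin[unfolded e_def] ev])
  then show ?thesis
    using AE_signs by eventually_elim (simp add: chaos_eq_signed_sum)
qed

end

section \<open>The six equivalent conditions\<close>

definition increasing_indices :: "nat \<Rightarrow> (nat \<Rightarrow> nat) set" where
  "increasing_indices d = {\<phi> \<in> {1..d} \<rightarrow>\<^sub>E {1..}. strict_mono_on {1..d} \<phi>}"

text \<open>
  The multiindex of a decoupled tuple records the row along with the position in the row.
\<close>

definition row_index :: "nat \<Rightarrow> (nat \<Rightarrow> nat) \<Rightarrow> nat \<Rightarrow> nat \<times> nat" where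
  "row_index d i = (\<lambda>\<kappa>\<in>{1..d}. (\<kappa>, i \<kappa>))"

definition row_indices :: "nat \<Rightarrow> (nat \<Rightarrow> nat \<times> nat) set" where
  "row_indices d = row_index d ` ({1..d} \<rightarrow>\<^sub>E {1..})"

lemma card_index_cube: "card (index_cube d n) = n ^ d"
  unfolding index_cube_def by (simp add: card_PiE)

lemma increasing_indices_below: "{\<phi>\<in>increasing_indices d. \<phi> ` {1..d} \<subseteq> {1..n}} = index_simplex d n"
proof (intro equalityI subsetI)
  fix \<phi> assume "\<phi> \<in> {\<phi>\<in>increasing_indices d. \<phi> ` {1..d} \<subseteq> {1..n}}"
  then have "\<phi> \<in> {1..d} \<rightarrow>\<^sub>E {1..}" "\<phi> ` {1..d} \<subseteq> {1..n}" "strict_mono_on {1..d} \<phi>"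
    by (auto simp: increasing_indices_def)
  then show "\<phi> \<in> index_simplex d n"
    unfolding index_simplex_def index_cube_def PiE_iff by blast
next
  fix \<phi> assume "\<phi> \<in> index_simplex d n"
  then have "\<phi> \<in> {1..d} \<rightarrow>\<^sub>E {1..n}" "strict_mono_on {1..d} \<phi>"
    by (auto simp: index_simplex_def index_cube_def)
  moreover from this(1) have "\<phi> \<in> {1..d} \<rightarrow>\<^sub>E {1..}" by (rule PiE_mono[THEN subsetD, rotated]) auto
  ultimately show "\<phi> \<in> {\<phi>\<in>increasing_indices d. \<phi> ` {1..d} \<subseteq> {1..n}}"
    unfolding increasing_indices_def by blast
qed

text \<open>
  Both maps list the same set in increasing order.
\<close>

lemma strict_mono_on_image_eq:
  fixes \<phi> \<psi> :: "nat \<Rightarrow> nat"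
  assumes "strict_mono_on {1..d} \<phi>" "strict_mono_on {1..d} \<psi>" "\<phi> ` {1..d} = \<psi> ` {1..d}" "\<kappa> \<in> {1..d}"
  shows "\<phi> \<kappa> = \<psi> \<kappa>"
proof -
  have sorted: "sorted_wrt (<) (map f [1..<Suc d])" if "strict_mono_on {1..d} f" for f :: "nat \<Rightarrow> nat"
    using that unfolding sorted_wrt_map
    by (intro sorted_wrt_mono_rel[OF _ sorted_wrt_upt]) (auto simp: strict_mono_on_def)
  have "map \<phi> [1..<Suc d] = map \<psi> [1..<Suc d]"
  proof (rule strict_sorted_equal)
    show "set (map \<phi> [1..<Suc d]) = set (map \<psi> [1..<Suc d])"
      using assms(3) by (simp only: set_map set_upt atLeastLessThanSuc_atLeastAtMost)
  qed (rule sorted assms)+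
  then have "\<forall>x\<in>set [1..<Suc d]. \<phi> x = \<psi> x" by (simp only: map_eq_conv)
  moreover have "\<kappa> \<in> set [1..<Suc d]" using assms(4) by auto
  ultimately show ?thesis by blast
qed

lemma inj_on_row_index: "inj_on (row_index d) ({1..d} \<rightarrow>\<^sub>E B)"
proof (rule inj_onI)
  fix i j assume i: "i \<in> {1..d} \<rightarrow>\<^sub>E B" and j: "j \<in> {1..d} \<rightarrow>\<^sub>E B" and eq: "row_index d i = row_index d j"
  show "i = j"
  proof (rule PiE_ext[OF i j])
    fix \<kappa> assume "\<kappa> \<in> {1..d}"
    then show "i \<kappa> = j \<kappa>" using fun_cong[OF eq, of \<kappa>] by (simp add: row_index_def)
  qed
qed

lemma row_index_image: "row_index d i ` {1..d} = (\<lambda>\<kappa>. (\<kappa>, i \<kappa>)) ` {1..d}"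
  unfolding row_index_def by (rule image_cong) auto

lemma row_indices_below: "{\<phi>\<in>row_indices d. \<phi> ` {1..d} \<subseteq> {1..d} \<times> {1..n}} = row_index d ` index_cube d n"
proof (intro equalityI subsetI)
  fix \<phi> assume "\<phi> \<in> {\<phi>\<in>row_indices d. \<phi> ` {1..d} \<subseteq> {1..d} \<times> {1..n}}"
  then obtain i where i: "i \<in> {1..d} \<rightarrow>\<^sub>E {1..}" "\<phi> = row_index d i" "row_index d i ` {1..d} \<subseteq> {1..d} \<times> {1..n}"
    unfolding row_indices_def by blast
  have "i \<kappa> \<in> {1..n}" if "\<kappa> \<in> {1..d}" for \<kappa> using i(3) that unfolding row_index_image by blast
  then have "i \<in> index_cube d n" using i(1) unfolding index_cube_def PiE_iff by blast
  then show "\<phi> \<in> row_index d ` index_cube d n" using i(2) by blast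
next
  fix \<phi> assume "\<phi> \<in> row_index d ` index_cube d n"
  then obtain i where i: "i \<in> {1..d} \<rightarrow>\<^sub>E {1..n}" "\<phi> = row_index d i" unfolding index_cube_def by blast
  then have "i \<in> {1..d} \<rightarrow>\<^sub>E {1..}" by (intro PiE_mono[THEN subsetD, OF _ i(1)]) auto
  moreover have "row_index d i ` {1..d} \<subseteq> {1..d} \<times> {1..n}" unfolding row_index_image using PiE_mem[OF i(1)] by blast
  ultimately show "\<phi> \<in> {\<phi>\<in>row_indices d. \<phi> ` {1..d} \<subseteq> {1..d} \<times> {1..n}}"
    using i(2) unfolding row_indices_def by blast
qed

lemma indep_elements_compose:
  assumes M: "prob_space M" and ind: "indep_elements M S Y T Z" and f: "f \<in> measurable T T'"
  shows "indep_elements M S Y T' (\<lambda>\<omega>. f (Z \<omega>))"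
proof -
  interpret prob_space M by fact
  have Z: "Z \<in> measurable M T" using ind by (simp add: indep_elements_def)
  have "indep_set {Y -` A \<inter> space M | A. A \<in> sets S} {(\<lambda>\<omega>. f (Z \<omega>)) -` B \<inter> space M | B. B \<in> sets T'}"
  proof -
    have sub: "{(\<lambda>\<omega>. f (Z \<omega>)) -` B \<inter> space M | B. B \<in> sets T'} \<subseteq> {Z -` B \<inter> space M | B. B \<in> sets T}"
    proof
      fix W assume "W \<in> {(\<lambda>\<omega>. f (Z \<omega>)) -` B \<inter> space M | B. B \<in> sets T'}"
      then obtain B where B: "B \<in> sets T'" "W = (\<lambda>\<omega>. f (Z \<omega>)) -` B \<inter> space M" by blast
      have "W = Z -` (f -` B \<inter> space T) \<inter> space M" using B(2) measurable_space[OF Z] by auto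
      then show "W \<in> {Z -` B \<inter> space M | B. B \<in> sets T}" using measurable_sets[OF f B(1)] by blast
    qed
    have "indep_set {Y -` A \<inter> space M | A. A \<in> sets S} {Z -` B \<inter> space M | B. B \<in> sets T}"
      using ind by (simp add: indep_elements_def)
    then show ?thesis
      unfolding indep_set_def by (rule indep_sets_mono_sets) (use sub in \<open>auto split: bool.split\<close>)
  qed
  then show ?thesis using ind measurable_compose[OF Z f] by (simp add: indep_elements_def)
qed

lemma indep_vars_cong_law:
  assumes "prob_space M" "sets E = sets \<mu>" "prob_space.indep_vars M (\<lambda>_. E) Y K"
  shows "prob_space.indep_vars M (\<lambda>_. \<mu>) Y K"
  using assms(3)
  unfolding prob_space.indep_vars_def[OF assms(1)] measurable_cong_sets[OF refl assms(2)] assms(2) .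

lemma sets_PiM_const_cong:
  "sets E = sets \<mu> \<Longrightarrow> sets (PiM I (\<lambda>_. E)) = sets (PiM I (\<lambda>_. \<mu>))"
  by (rule sets_PiM_cong[OF refl])

lemma summable_on_positive_nat:
  fixes f :: "nat \<Rightarrow> real"
  assumes "\<And>k. 0 \<le> f k"
  shows "f summable_on {1..} \<longleftrightarrow> summable (\<lambda>k. f (Suc k))"
proof -
  have "{1..} = range Suc" by (simp only: One_nat_def atLeast_Suc_greaterThan greaterThan_0)
  then have "f summable_on {1..} \<longleftrightarrow> (f \<circ> Suc) summable_on UNIV"
    by (simp only: summable_on_reindex[OF inj_Suc])
  also have "\<dots> \<longleftrightarrow> summable (\<lambda>k. f (Suc k))"
    using assms by (subst summable_on_UNIV_nonneg_real_iff) (auto simp: o_def)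
  finally show ?thesis .
qed

theorem theorem2:
  fixes M :: "'w measure" and E \<mu> :: "'a measure"
    and X :: "nat \<Rightarrow> 'w \<Rightarrow> 'a" and X' :: "nat \<Rightarrow> nat \<Rightarrow> 'w \<Rightarrow> 'a"
    and \<epsilon> :: "nat \<Rightarrow> 'w \<Rightarrow> real" and \<epsilon>' :: "nat \<Rightarrow> nat \<Rightarrow> 'w \<Rightarrow> real"
    and d :: nat and h :: "(nat \<Rightarrow> 'a) \<Rightarrow> real" and \<gamma> :: "nat \<Rightarrow> real" and C :: real
  assumes "prob_space M"
    and "prob_space.indep_vars M (\<lambda>_. E) X {1..}"
    and "\<And>j. j \<ge> 1 \<Longrightarrow> distr M E (X j) = \<mu>"
    and "prob_space.indep_vars M (\<lambda>_. E) (\<lambda>(k, j). X' k j) ({1..d} \<times> {1..})"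
    and "\<And>k j. k \<in> {1..d} \<Longrightarrow> j \<ge> 1 \<Longrightarrow> distr M E (X' k j) = \<mu>"
    and "rademacher_family M \<epsilon> {1..}"
    and "rademacher_family M (\<lambda>(k, i). \<epsilon>' k i) ({1..d} \<times> {1..})"
    and "indep_elements M
           (PiM {1..} (\<lambda>_. borel)) (\<lambda>\<omega>. \<lambda>i\<in>{1..}. \<epsilon> i \<omega>)
           (PiM {1..} (\<lambda>_. E) \<Otimes>\<^sub>M PiM ({1..d} \<times> {1..}) (\<lambda>_. E)
              \<Otimes>\<^sub>M PiM ({1..d} \<times> {1..}) (\<lambda>_. borel))
           (\<lambda>\<omega>. (\<lambda>j\<in>{1..}. X j \<omega>, \<lambda>(k, j)\<in>{1..d} \<times> {1..}. X' k j \<omega>,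
                 \<lambda>(k, i)\<in>{1..d} \<times> {1..}. \<epsilon>' k i \<omega>))"
    and "indep_elements M
           (PiM ({1..d} \<times> {1..}) (\<lambda>_. borel)) (\<lambda>\<omega>. \<lambda>(k, i)\<in>{1..d} \<times> {1..}. \<epsilon>' k i \<omega>)
           (PiM {1..} (\<lambda>_. E) \<Otimes>\<^sub>M PiM ({1..d} \<times> {1..}) (\<lambda>_. E)
              \<Otimes>\<^sub>M PiM {1..} (\<lambda>_. borel))
           (\<lambda>\<omega>. (\<lambda>j\<in>{1..}. X j \<omega>, \<lambda>(k, j)\<in>{1..d} \<times> {1..}. X' k j \<omega>,
                 \<lambda>i\<in>{1..}. \<epsilon> i \<omega>))"
    and "d \<ge> 1"
    and "h \<in> borel_measurable (PiM {1..d} (\<lambda>_. E))"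
    and "symmetric_kernel d E h"
    and "\<And>n. n \<ge> 1 \<Longrightarrow> \<gamma> n > 0"
    and "mono_on {1..} \<gamma>"
    and "\<And>n. n \<ge> 1 \<Longrightarrow> \<gamma> (2 * n) \<le> C * \<gamma> n"
    and "\<And>l. l \<ge> 1 \<Longrightarrow>
           summable (\<lambda>k. 2 ^ (d * (l + k)) / (\<gamma> (2 ^ (l + k)))\<^sup>2) \<and>
           (\<Sum>k. 2 ^ (d * (l + k)) / (\<gamma> (2 ^ (l + k)))\<^sup>2) \<le> C * (2 ^ (d * l) / (\<gamma> (2 ^ l))\<^sup>2)"
  shows "let
      a = (AE \<omega> in M. (\<lambda>n. 1 / \<gamma> n *
             (\<Sum>i\<in>index_simplex d n. multi_sign d \<epsilon> i \<omega> * h (multi_X d X i \<omega>))) \<longlonglongrightarrow> 0);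
      b = (AE \<omega> in M. (\<lambda>n. 1 / \<gamma> n *
             (\<Sum>i\<in>index_cube d n. multi_sign_dec d \<epsilon>' i \<omega> * h (multi_X_dec d X' i \<omega>))) \<longlonglongrightarrow> 0);
      c = (AE \<omega> in M. (\<lambda>n. 1 / (\<gamma> n)\<^sup>2 *
             (\<Sum>i\<in>index_simplex d n. (h (multi_X d X i \<omega>))\<^sup>2)) \<longlonglongrightarrow> 0);
      d' = (AE \<omega> in M. (\<lambda>n. 1 / (\<gamma> n)\<^sup>2 *
             (\<Sum>i\<in>index_cube d n. (h (multi_X_dec d X' i \<omega>))\<^sup>2)) \<longlonglongrightarrow> 0);
      e = ((\<lambda>k. measure M {\<omega> \<in> space M. \<exists>i\<in>index_simplex d (2 ^ k).
             multi_X d X i \<omega> \<notin> trunc_set d \<mu> h \<gamma> k d}) summable_on {1..});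
      f = ((\<lambda>k. measure M {\<omega> \<in> space M. \<exists>i\<in>index_cube d (2 ^ k).
             multi_X_dec d X' i \<omega> \<notin> trunc_set d \<mu> h \<gamma> k d}) summable_on {1..})
    in (a \<longleftrightarrow> b) \<and> (b \<longleftrightarrow> c) \<and> (c \<longleftrightarrow> d') \<and> (d' \<longleftrightarrow> e) \<and> (e \<longleftrightarrow> f)"
proof -
  note M = assms(1) and indep_X = assms(2) and law_X = assms(3) and indep_X' = assms(4) and law_X' = assms(5)
    and rad = assms(6) and rad' = assms(7) and ind = assms(8) and ind' = assms(9) and d = assms(10)
    and h = assms(11) and \<gamma>_pos = assms(13) and mono = assms(14) and dbl = assms(15) and reg = assms(16)
  interpret prob_space M by (rule M)
  have "\<forall>i\<in>{1..}. X i \<in> measurable M E" using indep_X unfolding indep_vars_def by blast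
  then have X1: "X 1 \<in> measurable M E" by simp
  have sets_E: "sets E = sets \<mu>" using law_X[of 1] by (metis order_refl sets_distr)
  have prob_\<mu>: "prob_space \<mu>" using prob_space_distr[OF X1] law_X[of 1] by simp
  note sets_PiM = sets_PiM_const_cong[OF sets_E]
  have h_\<mu>: "h \<in> borel_measurable (PiM {1..d} (\<lambda>_. \<mu>))"
    using h measurable_cong_sets[OF sets_PiM refl] by blast
  define X2 where "X2 = (\<lambda>(k, j). X' k j)"
  define \<epsilon>2 where "\<epsilon>2 = (\<lambda>(k, i). \<epsilon>' k i)"
  let ?K = "{1..d} \<times> {1 :: nat..}"
  have law_\<mu>: "distr M \<mu> Y = distr M E Y" for Y by (rule distr_cong) (simp_all add: sets_E)
  have C: "C > 0"
  proof -
    have "0 < \<gamma> (2 * 1)" "\<gamma> (2 * 1) \<le> C * \<gamma> 1" "0 < \<gamma> 1" by (rule \<gamma>_pos dbl, simp)+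
    then have "0 < C * \<gamma> 1" by linarith
    then show ?thesis using \<open>0 < \<gamma> 1\<close> by (simp add: zero_less_mult_iff)
  qed

  interpret T: truncation d \<mu> h \<gamma>
    by (rule truncation.intro[OF prob_\<mu> h_\<mu> d \<gamma>_pos])
  have X_family: "iid_family M X {1..} \<mu>"
  proof (intro iid_family.intro iid_family_axioms.intro M)
    show "indep_vars (\<lambda>_. \<mu>) X {1..}" by (rule indep_vars_cong_law[OF M sets_E indep_X])
    show "distr M \<mu> (X j) = \<mu>" if "j \<in> {1..}" for j
      unfolding law_\<mu> by (rule law_X) (use that in simp)
  qed simp
  have X2_family: "iid_family M X2 ?K \<mu>"
  proof (intro iid_family.intro iid_family_axioms.intro M)
    show "indep_vars (\<lambda>_. \<mu>) X2 ?K"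
      unfolding X2_def by (rule indep_vars_cong_law[OF M sets_E indep_X'])
    show "distr M \<mu> (X2 p) = \<mu>" if p: "p \<in> ?K" for p
    proof -
      obtain k j where kj: "p = (k, j)" "k \<in> {1..d}" "j \<ge> 1" using p by (cases p) simp
      show ?thesis unfolding law_\<mu> kj(1) X2_def prod.case by (rule law_X'[OF kj(2,3)])
    qed
    show "?K \<noteq> {}" using d by auto
  qed

  have ind1: "indep_elements M (PiM {1..} (\<lambda>_. borel)) (\<lambda>\<omega>. \<lambda>i\<in>{1..}. \<epsilon> i \<omega>)
      (PiM {1..} (\<lambda>_. \<mu>)) (\<lambda>\<omega>. \<lambda>j\<in>{1..}. X j \<omega>)"
  proof -
    have "fst \<in> measurable (PiM {1..} (\<lambda>_. E) \<Otimes>\<^sub>M R) (PiM {1..} (\<lambda>_. \<mu>))" for R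
      unfolding measurable_cong_sets[OF refl sets_PiM[symmetric]] by (rule measurable_fst)
    from indep_elements_compose[OF M ind this] show ?thesis by (simp only: fst_conv)
  qed
  have ind2: "indep_elements M (PiM ?K (\<lambda>_. borel)) (\<lambda>\<omega>. \<lambda>p\<in>?K. \<epsilon>2 p \<omega>)
      (PiM ?K (\<lambda>_. \<mu>)) (\<lambda>\<omega>. \<lambda>p\<in>?K. X2 p \<omega>)"
  proof -
    have curry: "(\<lambda>(k, i)\<in>?K. \<epsilon>' k i \<omega>) = (\<lambda>p\<in>?K. \<epsilon>2 p \<omega>)" "(\<lambda>(k, j)\<in>?K. X' k j \<omega>) = (\<lambda>p\<in>?K. X2 p \<omega>)" for \<omega>
      unfolding \<epsilon>2_def X2_def by (rule restrict_ext, simp add: case_prod_beta)+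
    have "(\<lambda>z. fst (snd z)) \<in> measurable (R1 \<Otimes>\<^sub>M PiM ?K (\<lambda>_. E) \<Otimes>\<^sub>M R2) (PiM ?K (\<lambda>_. \<mu>))" for R1 R2
      unfolding measurable_cong_sets[OF refl sets_PiM[symmetric]]
      by (rule measurable_compose[OF measurable_snd measurable_fst])
    from indep_elements_compose[OF M ind'[unfolded curry] this] show ?thesis by (simp only: fst_conv snd_conv)
  qed

  have kernel1: "sampled_kernel d \<mu> h \<gamma> M X {1..}"
    by (intro sampled_kernel.intro T.truncation_axioms X_family)
  have kernel2: "sampled_kernel d \<mu> h \<gamma> M X2 ?K"
    by (intro sampled_kernel.intro T.truncation_axioms X2_family)

  interpret U: single_sequence d \<mu> h \<gamma> M X
    by (rule single_sequence.intro[OF kernel1])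
  interpret V: row_sequences d \<mu> h \<gamma> M X2
    by (rule row_sequences.intro[OF kernel2])

  interpret U: signed_scheme d \<mu> h \<gamma> M X "{1..}" \<epsilon> "\<lambda>n. {1..n}" "increasing_indices d"
  proof (intro signed_scheme.intro kernel1 signed_scheme_axioms.intro rad ind1)
    show "mono (\<lambda>n::nat. {1..n})" by (auto simp: mono_def)
    show "\<phi> \<in> {1..d} \<rightarrow> {1..}" if "\<phi> \<in> increasing_indices d" for \<phi>
      using that by (auto simp: increasing_indices_def)
    show "inj_on \<phi> {1..d}" if "\<phi> \<in> increasing_indices d" for \<phi>
      using that strict_mono_on_imp_inj_on[of "{1..d}" \<phi>] by (simp add: increasing_indices_def)
    show "inj_on (\<lambda>\<phi>. \<phi> ` {1..d}) (increasing_indices d)"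
    proof (rule inj_onI)
      fix \<phi> \<psi> assume "\<phi> \<in> increasing_indices d" "\<psi> \<in> increasing_indices d" "\<phi> ` {1..d} = \<psi> ` {1..d}"
      then show "\<phi> = \<psi>"
        unfolding increasing_indices_def
        by (intro PiE_ext[of \<phi> "{1..d}" "\<lambda>_. {1..}" \<psi>] strict_mono_on_image_eq[of d \<phi> \<psi>]) blast+
    qed
    show "card {\<phi>\<in>increasing_indices d. \<phi> ` {1..d} \<subseteq> {1..n}} \<le> n ^ d" for n
      unfolding increasing_indices_below card_index_cube[symmetric]
      by (rule card_mono[OF T.finite_index_cube U.index_simplex_sub])
  qed auto

  interpret V: signed_scheme d \<mu> h \<gamma> M X2 ?K \<epsilon>2 "\<lambda>n. {1..d} \<times> {1..n}" "row_indices d"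
  proof (intro signed_scheme.intro kernel2 signed_scheme_axioms.intro ind2)
    show "rademacher_family M \<epsilon>2 ?K" using rad' unfolding \<epsilon>2_def .
    show "mono (\<lambda>n. {1..d} \<times> {1..n})" by (auto simp: mono_def)
    show "\<phi> \<in> {1..d} \<rightarrow> ?K" if "\<phi> \<in> row_indices d" for \<phi>
      using that by (auto simp: row_indices_def row_index_def dest: PiE_mem)
    show "inj_on \<phi> {1..d}" if "\<phi> \<in> row_indices d" for \<phi>
      using that by (auto simp: row_indices_def row_index_def inj_on_def)
    show "inj_on (\<lambda>\<phi>. \<phi> ` {1..d}) (row_indices d)"
    proof (rule inj_onI)
      fix \<phi> \<psi> assume *: "\<phi> \<in> row_indices d" "\<psi> \<in> row_indices d" "\<phi> ` {1..d} = \<psi> ` {1..d}"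
      then obtain i j where ij: "\<phi> = row_index d i" "\<psi> = row_index d j" unfolding row_indices_def by blast
      have "i \<kappa> = j \<kappa>" if "\<kappa> \<in> {1..d}" for \<kappa>
        using *(3) that unfolding ij row_index_image by blast
      then show "\<phi> = \<psi>" unfolding ij row_index_def by (intro restrict_ext) simp
    qed
    show "card {\<phi>\<in>row_indices d. \<phi> ` {1..d} \<subseteq> {1..d} \<times> {1..n}} \<le> n ^ d" for n
      unfolding row_indices_below card_index_cube[symmetric] by (rule card_image_le[OF T.finite_index_cube])
  qed auto

  have U_tuple: "U.tuple = multi_X d X" by (intro ext) (simp add: U.tuple_def multi_X_def)
  have U_family: "U.family n = index_simplex d n" for n
    unfolding U.family_def by (rule increasing_indices_below)
  have U_signed: "U.signed_sum n \<omega> = (\<Sum>i\<in>index_simplex d n. multi_sign d \<epsilon> i \<omega> * h (multi_X d X i \<omega>))" for n \<omega>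
    unfolding U.signed_sum_def U_tuple U_family multi_sign_def ..
  have U_squares: "U.squares n \<omega> = (\<Sum>i\<in>index_simplex d n. (h (multi_X d X i \<omega>))\<^sup>2)" for n \<omega>
    unfolding U.squares_def U_tuple U_family ..
  have U_escape: "U.family_escape n B = U.simplex_escape n B" for n B
    unfolding U.family_escape_def U.simplex_escape_def U_tuple U_family ..

  have X2_curry: "(\<lambda>k j. X2 (k, j)) = X'" by (simp add: X2_def)
  have V_tuple: "V.tuple (row_index d i) \<omega> = multi_X_dec d X' i \<omega>" for i \<omega>
    unfolding V.tuple_def multi_X_dec_def by (intro restrict_ext) (simp add: row_index_def X2_def)
  have V_family: "V.family n = row_index d ` index_cube d n" for n
    unfolding V.family_def by (rule row_indices_below)
  have V_sum: "(\<Sum>\<phi>\<in>V.family n. G \<phi>) = (\<Sum>i\<in>index_cube d n. G (row_index d i))" for G :: "_ \<Rightarrow> real" and n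
    unfolding V_family index_cube_def by (rule sum.reindex[OF inj_on_row_index, unfolded o_def])
  have V_signed: "V.signed_sum n \<omega> = (\<Sum>i\<in>index_cube d n. multi_sign_dec d \<epsilon>' i \<omega> * h (multi_X_dec d X' i \<omega>))" for n \<omega>
    unfolding V.signed_sum_def V_sum V_tuple multi_sign_dec_def
    by (intro sum.cong refl arg_cong2[where f = "(*)"] prod.cong) (simp_all add: row_index_def \<epsilon>2_def)
  have V_squares: "V.squares n \<omega> = (\<Sum>i\<in>index_cube d n. (h (multi_X_dec d X' i \<omega>))\<^sup>2)" for n \<omega>
    unfolding V.squares_def V_sum V_tuple ..
  have V_escape: "V.family_escape n B = {\<omega>\<in>space M. \<exists>i\<in>index_cube d n. multi_X_dec d X' i \<omega> \<notin> B}" for n B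
    unfolding V.family_escape_def V_family V_tuple[symmetric] by blast

  define a where "a \<longleftrightarrow> (AE \<omega> in M. (\<lambda>n. 1 / \<gamma> n * U.signed_sum n \<omega>) \<longlonglongrightarrow> 0)"
  define b where "b \<longleftrightarrow> (AE \<omega> in M. (\<lambda>n. 1 / \<gamma> n * V.signed_sum n \<omega>) \<longlonglongrightarrow> 0)"
  define c where "c \<longleftrightarrow> (AE \<omega> in M. (\<lambda>n. 1 / (\<gamma> n)\<^sup>2 * U.squares n \<omega>) \<longlonglongrightarrow> 0)"
  define d' where "d' \<longleftrightarrow> (AE \<omega> in M. (\<lambda>n. 1 / (\<gamma> n)\<^sup>2 * V.squares n \<omega>) \<longlonglongrightarrow> 0)"
  define e where "e \<longleftrightarrow> (\<lambda>k. prob (U.simplex_escape (2 ^ k) (T.A k d))) summable_on {1..}"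
  define f where "f \<longleftrightarrow> (\<lambda>k. prob (V.family_escape (2 ^ k) (T.A k d))) summable_on {1..}"

  have e_iff: "e \<longleftrightarrow> summable (\<lambda>k. prob (U.simplex_escape (2 ^ Suc k) (T.A (Suc k) d)))"
    unfolding e_def by (rule summable_on_positive_nat) simp
  have V_prob: "prob (V.family_escape n B) = measure (T.S n) (T.escapes n B)"
    if "B \<in> sets T.Q" for n B
    using V.prob_cube_escape[OF that] unfolding V_escape X2_curry .
  have f_iff: "f \<longleftrightarrow> summable (\<lambda>k. measure (T.S (2 ^ Suc k)) (T.escapes (2 ^ Suc k) (T.A (Suc k) d)))"
    unfolding f_def V_prob[OF T.trunc_set_measurable] by (rule summable_on_positive_nat) simp

  have ef: "e \<longleftrightarrow> f"
    unfolding e_iff f_iff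
    using U.escapes_summable_of_simplex_escapes U.simplex_escapes_summable_of_escapes by blast
  have energy: "(\<Sum>k. ennreal (T.weight (Suc k)) * (\<integral>\<^sup>+x. T.g (Suc k) d x \<partial>T.Q)) < \<infinity>" if f
  proof (rule T.summable_energy)
    show "summable (\<lambda>k. T.weight (l + k)) \<and> (\<Sum>k. T.weight (l + k)) \<le> C * T.weight l" if "l \<ge> 1" for l
      using reg[OF that] unfolding T.weight_def .
  qed (use that f_iff in simp)
  have fa: a if f
    unfolding a_def using that ef energy[OF that] e_iff
    by (intro U.signed_convergence_of_summable_escapes[OF mono dbl]) (simp_all only: U_escape)
  have fb: b if f
    unfolding b_def
    by (rule V.signed_convergence_of_summable_escapes[OF mono dbl _ energy[OF that]])
      (use that f_iff V_prob[OF T.trunc_set_measurable] in simp_all)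
  have ac: c if a
    using U.signed_convergence_imp_square_convergence that unfolding a_def c_def by blast
  have bd: d' if b
    using V.signed_convergence_imp_square_convergence that unfolding b_def d'_def by blast
  have cf: f if c
    using U.escapes_summable_of_simplex_squares[OF C dbl that[unfolded c_def U_squares]]
    unfolding f_iff by (subst summable_Suc_iff)
  have df: f if d'
    using V.escapes_summable_of_cube_squares[OF C dbl that[unfolded d'_def V_squares, folded X2_curry]]
    unfolding f_iff by (subst summable_Suc_iff)
  have "(a \<longleftrightarrow> b) \<and> (b \<longleftrightarrow> c) \<and> (c \<longleftrightarrow> d') \<and> (d' \<longleftrightarrow> e) \<and> (e \<longleftrightarrow> f)"
    using ef fa fb ac bd cf df by blast
  then show ?thesis
    unfolding Let_def a_def b_def c_def d'_def e_def f_def U_signed U_squares V_signed V_squares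
      V_escape U.simplex_escape_def .
qed

end
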